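(* Let $\mathcal{V}$ be a Banach $Cl$-space, let $T\in\mathcal{B}^{\rm r}(\mathcal{V})$, and let $U\subset\mathbb{C}$ be a conjugate symmetric open set with $\sigma_{\mathbb C}(T)\subset U$. For every function $f\in\mathcal{O}_s(U)$, one has $f(\sigma_{\mathbb C}(T))=\sigma_{\mathbb C}(f(T))$.
   Context: Fix an integer $n\ge0$. $\mathfrak{C}_n$ is the unital associative real algebra generated by $e_1,\dots,e_n$ with $e_j^2=-1$, $e_je_k=-e_ke_j$ ($j\ne k$), with basis $e_J=e_{j_1}\cdots e_{j_p}$ for $J=\{j_1<\dots<j_p\}\subset\{1,\dots,n\}$, $e_\emptyset=1$, and norm $|\sum_J a_Je_J|^2=\sum_J a_J^2$. A Banach $Cl$-space is a real Banach space $\mathcal{V}$ which is a two-sided module (bimodule) over the real algebra $\mathfrak{C}_n$, such that for some constant $C>0$, $\|x\mathbf a\|\le C\|x\||\mathbf a|$ and $\|\mathbf a x\|\le C\|x\||\mathbf a|$ for all $x\in\mathcal{V}$, $\mathbf a\in\mathfrak{C}_n$. $\mathcal{B}^{\rm r}(\mathcal{V})$ is the algebra of bounded $\mathbb{R}$-linear operators $T$ on $\mathcal{V}$ with $T(x\mathbf a)=T(x)\mathbf a$ for all $x\in\mathcal{V}$, $\mathbf a\in\mathfrak{C}_n$. $\mathcal{V}_{\mathbb C}=\mathcal{V}+i\mathcal{V}$ is the complexification, $T_{\mathbb C}(x+iy)=Tx+iTy$, and $\sigma_{\mathbb C}(T)=\sigma(T_{\mathbb C})$ is the complex spectrum of $T$.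 $\mathcal{O}_s(U)$ is the real algebra of analytic functions $f:U\to\mathbb{C}$ with $f(\bar\zeta)=\overline{f(\zeta)}$ for all $\zeta\in U$. For $f\in\mathcal{O}_s(U)$, $f(T)\in\mathcal{B}^{\rm r}(\mathcal{V})$ is the operator determined by $f(T)_{\mathbb C}=\frac{1}{2\pi i}\int_\Gamma f(\zeta)(\zeta-T_{\mathbb C})^{-1}d\zeta$, where $\Gamma$ is the positively oriented, piecewise smooth boundary of a bounded open set $\Delta$ with $\sigma_{\mathbb C}(T)\subset\Delta\subset\overline\Delta\subset U$ (this integral leaves $\mathcal{V}$ invariant). *)

theory Defs
  imports "HOL-Complex_Analysis.Complex_Analysis"
begin

section \<open>The Clifford algebra $\mathfrak{C}_n$\<close>

text \<open>
  The element $\sum_J a_J e_J$ of $\mathfrak{C}_n$ is represented by its coefficient family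
  $J \mapsto a_J$, extended by zero to the index sets that are not contained in
  $\{1,\dots,n\}$. Addition and real scaling are pointwise.
\<close>

type_synonym clifford = "nat set \<Rightarrow> real"

definition cl_carrier :: "nat \<Rightarrow> clifford set" where
  "cl_carrier n = {a. \<forall>J. \<not> J \<subseteq> {1..n} \<longrightarrow> a J = 0}"

definition cl_basis :: "nat set \<Rightarrow> clifford" where
  "cl_basis J = (\<lambda>K. if K = J then 1 else 0)"

text \<open>
  $e_I e_J = \pm e_{I \triangle J}$: sorting the word $e_I e_J$ costs one sign for every pair
  $(i,j) \in I \times J$ with $j < i$ (a transposition) and one for every pair with $i = j$
  (from $e_i^2 = -1$). The lemmas below verify that this yields the unital associative algebra
  with the defining relations of $\mathfrak{C}_n$.
\<close>

definition cl_sign :: "nat set \<Rightarrow> nat set \<Rightarrow> real" where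
  "cl_sign I J = (-1) ^ card {(i, j). i \<in> I \<and> j \<in> J \<and> j \<le> i}"

definition cl_mult :: "nat \<Rightarrow> clifford \<Rightarrow> clifford \<Rightarrow> clifford" where
  "cl_mult n a b = (\<lambda>K. \<Sum>(I, J) \<in> {(I, J). I \<subseteq> {1..n} \<and> J \<subseteq> {1..n} \<and> sym_diff I J = K}.
     cl_sign I J * a I * b J)"

definition cl_norm :: "nat \<Rightarrow> clifford \<Rightarrow> real" where
  "cl_norm n a = sqrt (\<Sum>J\<in>Pow {1..n}. (a J)\<^sup>2)"

lemma finite_cl_pairs: "finite {(I, J). I \<subseteq> {1..n::nat} \<and> J \<subseteq> {1..n} \<and> P I J}"
  by (rule finite_subset[of _ "Pow {1..n} \<times> Pow {1..n}"]) auto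

lemma cl_mult_carrier: "cl_mult n a b \<in> cl_carrier n"
proof -
  have "cl_mult n a b K = 0" if "\<not> K \<subseteq> {1..n}" for K
  proof -
    have "{(I, J). I \<subseteq> {1..n} \<and> J \<subseteq> {1..n} \<and> sym_diff I J = K} = {}"
      using that by blast
    then show ?thesis by (simp only: cl_mult_def sum.empty)
  qed
  then show ?thesis by (simp add: cl_carrier_def)
qed

lemma cl_mult_basis:
  assumes "I \<subseteq> {1..n}" "J \<subseteq> {1..n}"
  shows "cl_mult n (cl_basis I) (cl_basis J) = (\<lambda>K. cl_sign I J * cl_basis (sym_diff I J) K)"
proof
  fix K
  let ?A = "{(I, J). I \<subseteq> {1..n} \<and> J \<subseteq> {1..n} \<and> sym_diff I J = K}"
  have finA: "finite ?A" by (rule finite_cl_pairs)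
  have "cl_mult n (cl_basis I) (cl_basis J) K
      = (\<Sum>p\<in>?A. if p = (I, J) then cl_sign I J else 0)"
    unfolding cl_mult_def by (rule sum.cong) (auto simp: cl_basis_def split: if_splits)
  also have "\<dots> = (if (I, J) \<in> ?A then cl_sign I J else 0)"
    by (simp only: sum.delta[OF finA])
  also have "\<dots> = cl_sign I J * cl_basis (sym_diff I J) K"
    using assms by (auto simp: cl_basis_def)
  finally show "cl_mult n (cl_basis I) (cl_basis J) K
      = cl_sign I J * cl_basis (sym_diff I J) K" .
qed

lemma cl_generator_square:
  assumes "j \<in> {1..n}"
  shows "cl_mult n (cl_basis {j}) (cl_basis {j}) = (\<lambda>K. - cl_basis {} K)"
proof -
  have "{(i, k). i \<in> {j} \<and> k \<in> {j} \<and> k \<le> i} = {(j, j)}" by auto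
  then have "cl_sign {j} {j} = -1" by (simp only: cl_sign_def) simp
  then show ?thesis using assms by (simp add: cl_mult_basis)
qed

lemma cl_generators_anticommute:
  assumes "j \<in> {1..n}" "k \<in> {1..n}" "j \<noteq> k"
  shows "cl_mult n (cl_basis {j}) (cl_basis {k})
    = (\<lambda>K. - cl_mult n (cl_basis {k}) (cl_basis {j}) K)"
proof -
  have *: "{(i, l). i \<in> {j} \<and> l \<in> {k} \<and> l \<le> i} = (if k \<le> j then {(j, k)} else {})" for j k :: nat
    by auto
  have "cl_sign {j} {k} = - cl_sign {k} {j}"
    using assms(3) unfolding cl_sign_def * by auto
  moreover have "sym_diff {j} {k} = sym_diff {k} {j}" by blast
  ultimately show ?thesis using assms by (simp add: cl_mult_basis)
qed

lemma cl_basis_ordered_product: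
  assumes "j \<in> {1..n}" "J \<subseteq> {1..n}" "\<And>k. k \<in> J \<Longrightarrow> j < k"
  shows "cl_basis (insert j J) = cl_mult n (cl_basis {j}) (cl_basis J)"
proof -
  have "{(i, k). i \<in> {j} \<and> k \<in> J \<and> k \<le> i} = {}" using assms(3) by fastforce
  then have "cl_sign {j} J = 1" by (simp only: cl_sign_def) simp
  moreover have "sym_diff {j} J = insert j J" using assms(3) by blast
  ultimately show ?thesis using assms(1,2) by (simp add: cl_mult_basis)
qed

lemma cl_mult_one:
  assumes "a \<in> cl_carrier n"
  shows "cl_mult n (cl_basis {}) a = a" and "cl_mult n a (cl_basis {}) = a"
proof -
  have s: "cl_sign {} J = 1" "cl_sign J {} = 1" for J by (simp_all add: cl_sign_def)
  have "cl_mult n (cl_basis {}) a K = a K \<and> cl_mult n a (cl_basis {}) K = a K" for K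
  proof (cases "K \<subseteq> {1..n}")
    case True
    let ?A = "{(I, J). I \<subseteq> {1..n} \<and> J \<subseteq> {1..n} \<and> sym_diff I J = K}"
    have finA: "finite ?A" by (rule finite_cl_pairs)
    have "cl_mult n (cl_basis {}) a K = (\<Sum>p\<in>?A. if p = ({}, K) then a K else 0)"
      unfolding cl_mult_def by (rule sum.cong) (auto simp: cl_basis_def s split: if_splits)
    moreover have "cl_mult n a (cl_basis {}) K = (\<Sum>p\<in>?A. if p = (K, {}) then a K else 0)"
      unfolding cl_mult_def by (rule sum.cong) (auto simp: cl_basis_def s split: if_splits)
    ultimately show ?thesis
      using True unfolding sum.delta[OF finA] by auto
  next
    case False
    then show ?thesis
      using assms cl_mult_carrier[of n "cl_basis {}" a] cl_mult_carrier[of n a "cl_basis {}"]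
      by (simp add: cl_carrier_def)
  qed
  then show "cl_mult n (cl_basis {}) a = a" and "cl_mult n a (cl_basis {}) = a" by auto
qed

lemma cl_sign_prod:
  assumes "finite I" "finite J"
  shows "cl_sign I J = (\<Prod>i\<in>I. \<Prod>j\<in>J. if j \<le> i then -1 else 1)"
proof -
  have "(\<Prod>i\<in>I. \<Prod>j\<in>J. if j \<le> i then -1 else 1::real)
      = (\<Prod>p\<in>I \<times> J. if snd p \<le> fst p then -1 else 1)"
    by (simp add: prod.cartesian_product case_prod_unfold)
  also have "\<dots> = (\<Prod>p\<in>{p \<in> I \<times> J. snd p \<le> fst p}. -1)"
    using assms by (intro prod.inter_filter[symmetric]) auto
  also have "{p \<in> I \<times> J. snd p \<le> fst p} = {(i, j). i \<in> I \<and> j \<in> J \<and> j \<le> i}" by auto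
  finally show ?thesis by (simp add: cl_sign_def)
qed

lemma prod_sym_diff:
  fixes g :: "nat \<Rightarrow> real"
  assumes "finite I" "finite J" "\<And>i. g i * g i = 1"
  shows "prod g (sym_diff I J) = prod g I * prod g J"
proof -
  have "prod g I = prod g (I - J) * prod g (I \<inter> J)"
    using prod.Int_Diff[OF assms(1), of g J] by (simp add: mult.commute)
  moreover have "prod g J = prod g (J - I) * prod g (I \<inter> J)"
    using prod.Int_Diff[OF assms(2), of g I] by (simp add: mult.commute Int_commute)
  moreover have "prod g (I \<inter> J) * prod g (I \<inter> J) = 1"
    by (simp add: prod.distrib[symmetric] assms(3))
  moreover have "prod g (sym_diff I J) = prod g (I - J) * prod g (J - I)"
    using assms by (intro prod.union_disjoint) auto
  ultimately show ?thesis by (simp add: algebra_simps)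
qed

lemma cl_sign_sym_diff:
  assumes "finite I" "finite J" "finite K"
  shows "cl_sign (sym_diff I J) K = cl_sign I K * cl_sign J K"
    and "cl_sign I (sym_diff J K) = cl_sign I J * cl_sign I K"
proof -
  have "(\<Prod>k\<in>K. if k \<le> i then -1 else 1::real) * (\<Prod>k\<in>K. if k \<le> i then -1 else 1) = 1" for i
    by (simp add: prod.distrib[symmetric] prod.neutral)
  then show "cl_sign (sym_diff I J) K = cl_sign I K * cl_sign J K"
    using assms by (simp add: cl_sign_prod prod_sym_diff)
  show "cl_sign I (sym_diff J K) = cl_sign I J * cl_sign I K"
    using assms by (simp add: cl_sign_prod prod_sym_diff prod.distrib)
qed

lemma cl_mult_alt:
  "cl_mult n a b K = (if K \<subseteq> {1..n} then
     \<Sum>I\<in>Pow {1..n}. cl_sign I (sym_diff I K) * a I * b (sym_diff I K) else 0)"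
proof (cases "K \<subseteq> {1..n}")
  case True
  have *: "sym_diff I (sym_diff I L) = L" for I L :: "nat set" by blast
  show ?thesis
    using True unfolding cl_mult_def
    by (simp, intro sum.reindex_bij_witness[of _ "\<lambda>I. (I, sym_diff I K)" fst]) (auto simp: *)
next
  case False
  then show ?thesis using cl_mult_carrier[of n a b] by (auto simp: cl_carrier_def)
qed

lemma cl_mult_assoc:
  "cl_mult n (cl_mult n a b) c = cl_mult n a (cl_mult n b c)"
proof
  fix K
  show "cl_mult n (cl_mult n a b) c K = cl_mult n a (cl_mult n b c) K"
  proof (cases "K \<subseteq> {1..n}")
    case False
    then show ?thesis by (simp only: cl_mult_alt if_False)
  next
    case True
    let ?P = "Pow {1..n}"
    have fin: "finite I" if "I \<subseteq> {1..n}" for I :: "nat set" using that finite_subset by blast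
    have inv: "sym_diff I (sym_diff I J) = J" for I J :: "nat set" by blast
    have "cl_mult n (cl_mult n a b) c K
        = (\<Sum>L\<in>?P. \<Sum>I\<in>?P. cl_sign L (sym_diff L K) * cl_sign I (sym_diff I L)
             * a I * b (sym_diff I L) * c (sym_diff L K))"
      using True by (simp add: cl_mult_alt sum_distrib_left sum_distrib_right mult_ac)
    also have "\<dots> = (\<Sum>I\<in>?P. \<Sum>L\<in>?P. cl_sign L (sym_diff L K) * cl_sign I (sym_diff I L)
             * a I * b (sym_diff I L) * c (sym_diff L K))"
      by (rule sum.swap)
    also have "\<dots> = (\<Sum>I\<in>?P. \<Sum>J\<in>?P. cl_sign I (sym_diff I K)
             * cl_sign J (sym_diff J (sym_diff I K)) * a I * b J * c (sym_diff J (sym_diff I K)))"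
    proof (rule sum.cong[OF refl])
      fix I assume I: "I \<in> ?P"
      show "(\<Sum>L\<in>?P. cl_sign L (sym_diff L K) * cl_sign I (sym_diff I L)
             * a I * b (sym_diff I L) * c (sym_diff L K))
          = (\<Sum>J\<in>?P. cl_sign I (sym_diff I K)
             * cl_sign J (sym_diff J (sym_diff I K)) * a I * b J * c (sym_diff J (sym_diff I K)))"
      proof (rule sum.reindex_bij_witness[of _ "sym_diff I" "sym_diff I"])
        fix L assume L: "L \<in> ?P"
        define J where "J = sym_diff I L"
        define M where "M = sym_diff L K"
        have sub: "I \<subseteq> {1..n}" "J \<subseteq> {1..n}" "M \<subseteq> {1..n}"
          using I L True by (auto simp: J_def M_def)
        have L': "L = sym_diff I J" unfolding J_def by blast
        have JM: "sym_diff J (sym_diff I K) = M" unfolding J_def M_def by blast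
        have IK: "sym_diff I K = sym_diff J M" unfolding J_def M_def by blast
        have "cl_sign L M * cl_sign I J = cl_sign I (sym_diff J M) * cl_sign J M"
          using sub unfolding L' by (simp add: cl_sign_sym_diff fin)
        then show "cl_sign I (sym_diff I K)
             * cl_sign (sym_diff I L) (sym_diff (sym_diff I L) (sym_diff I K)) * a I
             * b (sym_diff I L) * c (sym_diff (sym_diff I L) (sym_diff I K))
           = cl_sign L (sym_diff L K) * cl_sign I (sym_diff I L)
             * a I * b (sym_diff I L) * c (sym_diff L K)"
          unfolding J_def[symmetric] JM unfolding IK M_def[symmetric] by simp
      qed (use I inv in auto)
    qed
    also have "\<dots> = cl_mult n a (cl_mult n b c) K"
      unfolding cl_mult_alt[of n a] using True
      by (auto intro!: sum.cong simp: cl_mult_alt[of n b] sum_distrib_left mult_ac)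
    finally show ?thesis .
  qed
qed


section \<open>Banach $Cl$-spaces\<close>

locale banach_cl_space =
  fixes n :: nat
    and lact :: "clifford \<Rightarrow> 'v::banach \<Rightarrow> 'v"
    and ract :: "'v \<Rightarrow> clifford \<Rightarrow> 'v"
  assumes lact_add_right: "a \<in> cl_carrier n \<Longrightarrow> lact a (x + y) = lact a x + lact a y"
    and lact_scaleR_right: "a \<in> cl_carrier n \<Longrightarrow> lact a (r *\<^sub>R x) = r *\<^sub>R lact a x"
    and lact_add_left: "a \<in> cl_carrier n \<Longrightarrow> b \<in> cl_carrier n \<Longrightarrow>
          lact (\<lambda>J. a J + b J) x = lact a x + lact b x"
    and lact_scaleR_left: "a \<in> cl_carrier n \<Longrightarrow> lact (\<lambda>J. r * a J) x = r *\<^sub>R lact a x"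
    and lact_one: "lact (cl_basis {}) x = x"
    and lact_mult: "a \<in> cl_carrier n \<Longrightarrow> b \<in> cl_carrier n \<Longrightarrow>
          lact (cl_mult n a b) x = lact a (lact b x)"
    and ract_add_left: "a \<in> cl_carrier n \<Longrightarrow> ract (x + y) a = ract x a + ract y a"
    and ract_scaleR_left: "a \<in> cl_carrier n \<Longrightarrow> ract (r *\<^sub>R x) a = r *\<^sub>R ract x a"
    and ract_add_right: "a \<in> cl_carrier n \<Longrightarrow> b \<in> cl_carrier n \<Longrightarrow>
          ract x (\<lambda>J. a J + b J) = ract x a + ract x b"
    and ract_scaleR_right: "a \<in> cl_carrier n \<Longrightarrow> ract x (\<lambda>J. r * a J) = r *\<^sub>R ract x a"
    and ract_one: "ract x (cl_basis {}) = x"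
    and ract_mult: "a \<in> cl_carrier n \<Longrightarrow> b \<in> cl_carrier n \<Longrightarrow>
          ract x (cl_mult n a b) = ract (ract x a) b"
    and lact_ract: "a \<in> cl_carrier n \<Longrightarrow> b \<in> cl_carrier n \<Longrightarrow>
          ract (lact a x) b = lact a (ract x b)"
    and bounded_actions: "\<exists>C>0. \<forall>x. \<forall>a\<in>cl_carrier n.
          norm (ract x a) \<le> C * norm x * cl_norm n a \<and> norm (lact a x) \<le> C * norm x * cl_norm n a"

text \<open>The algebra $\mathcal{B}^{\mathrm r}(\mathcal{V})$.\<close>

definition right_linear_ops ::
    "nat \<Rightarrow> ('v::banach \<Rightarrow> clifford \<Rightarrow> 'v) \<Rightarrow> ('v \<Rightarrow>\<^sub>L 'v) set" where
  "right_linear_ops n ract = {T. \<forall>x. \<forall>a\<in>cl_carrier n.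
     blinfun_apply T (ract x a) = ract (blinfun_apply T x) a}"


section \<open>Complexification and complex spectrum\<close>

text \<open>
  $x + iy \in \mathcal{V}_{\mathbb C}$ is the pair $(x,y)$. The product norm is used only for the
  topology: by the open mapping theorem it is equivalent to every complete complex norm on
  $\mathcal{V}_{\mathbb C}$ whose restriction to $\mathcal{V}$ is equivalent to the given norm.
\<close>

definition cscale :: "complex \<Rightarrow> ('v::banach \<times> 'v) \<Rightarrow>\<^sub>L ('v \<times> 'v)" where
  "cscale c = Blinfun (\<lambda>z. (Re c *\<^sub>R fst z - Im c *\<^sub>R snd z, Im c *\<^sub>R fst z + Re c *\<^sub>R snd z))"

definition complexify :: "('v::banach \<Rightarrow>\<^sub>L 'v) \<Rightarrow> ('v \<times> 'v) \<Rightarrow>\<^sub>L ('v \<times> 'v)" where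
  "complexify T = Blinfun (\<lambda>z. (T (fst z), T (snd z)))"

lemma cscale_apply:
  "cscale c z = (Re c *\<^sub>R fst z - Im c *\<^sub>R snd z, Im c *\<^sub>R fst z + Re c *\<^sub>R snd z)"
  unfolding cscale_def
  by (subst bounded_linear_Blinfun_apply) (auto intro!: bounded_linear_intros)

lemma complexify_apply: "complexify T z = (T (fst z), T (snd z))"
  unfolding complexify_def
  by (subst bounded_linear_Blinfun_apply) (auto intro!: bounded_linear_intros)

text \<open>
  Complex-linearity of the inverse need not be required: the two-sided inverse of a
  complex-linear operator is complex-linear.
\<close>

definition op_inverse_of :: "('w::real_normed_vector \<Rightarrow>\<^sub>L 'w) \<Rightarrow> ('w \<Rightarrow>\<^sub>L 'w) \<Rightarrow> bool" where
  "op_inverse_of A B \<longleftrightarrow> A o\<^sub>L B = id_blinfun \<and> B o\<^sub>L A = id_blinfun"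

lemma op_inverse_of_complex_linear:
  assumes "op_inverse_of A B" "A o\<^sub>L cscale c = cscale c o\<^sub>L A"
  shows "B o\<^sub>L cscale c = cscale c o\<^sub>L B"
proof (rule blinfun_eqI)
  fix z
  have AB: "A (B w) = w" "B (A w) = w" for w
    using assms(1) unfolding op_inverse_of_def
    by (metis blinfun_apply_blinfun_compose blinfun_apply_id_blinfun id_apply)+
  have "A (cscale c (B z)) = cscale c z"
    using assms(2) by (metis AB(1) blinfun_apply_blinfun_compose)
  then show "blinfun_apply (B o\<^sub>L cscale c) z = blinfun_apply (cscale c o\<^sub>L B) z"
    by (metis AB(2) blinfun_apply_blinfun_compose)
qed

definition cspectrum :: "('v::banach \<Rightarrow>\<^sub>L 'v) \<Rightarrow> complex set" where
  "cspectrum T = {\<mu>. \<not> (\<exists>B. op_inverse_of (cscale \<mu> - complexify T) B)}"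

definition cresolvent :: "('v::banach \<Rightarrow>\<^sub>L 'v) \<Rightarrow> complex \<Rightarrow> ('v \<times> 'v) \<Rightarrow>\<^sub>L ('v \<times> 'v)" where
  "cresolvent T \<zeta> = (THE B. op_inverse_of (cscale \<zeta> - complexify T) B)"


section \<open>The analytic functional calculus\<close>

text \<open>The algebra $\mathcal{O}_s(U)$; values outside \<open>U\<close> are irrelevant.\<close>

definition stem_functions :: "complex set \<Rightarrow> (complex \<Rightarrow> complex) set" where
  "stem_functions U = {f. f analytic_on U \<and> (\<forall>\<zeta>\<in>U. f (cnj \<zeta>) = cnj (f \<zeta>))}"

text \<open>
  \<open>\<Gamma>\<close> is the positively oriented, piecewise smooth boundary of \<open>\<Delta>\<close>: it consists of finitely many
  pairwise disjoint piecewise smooth Jordan curves that together make up the frontier of \<open>\<Delta>\<close>. The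
  orientation (\<open>\<Delta>\<close> on the left) is expressed by the total winding number, which is 1 around the
  points of \<open>\<Delta>\<close> and 0 around the points outside its closure.
\<close>

definition positively_oriented_boundary ::
    "complex set \<Rightarrow> (real \<Rightarrow> complex) set \<Rightarrow> bool" where
  "positively_oriented_boundary \<Delta> \<Gamma> \<longleftrightarrow>
     finite \<Gamma> \<and>
     (\<forall>\<gamma>\<in>\<Gamma>. valid_path \<gamma> \<and> simple_path \<gamma> \<and> pathfinish \<gamma> = pathstart \<gamma>) \<and>
     pairwise (\<lambda>\<gamma> \<delta>. disjnt (path_image \<gamma>) (path_image \<delta>)) \<Gamma> \<and>
     (\<Union>\<gamma>\<in>\<Gamma>. path_image \<gamma>) = frontier \<Delta> \<and>
     (\<forall>z\<in>\<Delta>. (\<Sum>\<gamma>\<in>\<Gamma>. winding_number \<gamma> z) = 1) \<and>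
     (\<forall>z. z \<notin> closure \<Delta> \<longrightarrow> (\<Sum>\<gamma>\<in>\<Gamma>. winding_number \<gamma> z) = 0)"

definition admissible_contour ::
    "complex set \<Rightarrow> complex set \<Rightarrow> complex set \<Rightarrow> (real \<Rightarrow> complex) set \<Rightarrow> bool" where
  "admissible_contour \<sigma> U \<Delta> \<Gamma> \<longleftrightarrow>
     open \<Delta> \<and> bounded \<Delta> \<and> \<sigma> \<subseteq> \<Delta> \<and> closure \<Delta> \<subseteq> U \<and> positively_oriented_boundary \<Delta> \<Gamma>"

text \<open>
  $\frac{1}{2\pi i}\int_\Gamma f(\zeta)(\zeta - T_{\mathbb C})^{-1}\,d\zeta$, an integral in the
  Banach space of bounded operators on $\mathcal{V}_{\mathbb C}$. As in the library's
  \<open>contour_integral\<close>, the integral over a path is the integral of its pull-back to $[0,1]$.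
\<close>

definition riesz_integral ::
    "('v::banach \<Rightarrow>\<^sub>L 'v) \<Rightarrow> (complex \<Rightarrow> complex) \<Rightarrow> (real \<Rightarrow> complex) set
      \<Rightarrow> ('v \<times> 'v) \<Rightarrow>\<^sub>L ('v \<times> 'v)" where
  "riesz_integral T f \<Gamma> = cscale (1 / (2 * of_real pi * \<i>)) o\<^sub>L
     (\<Sum>\<gamma>\<in>\<Gamma>. integral {0..1} (\<lambda>t.
        cscale (f (\<gamma> t) * vector_derivative \<gamma> (at t within {0..1})) o\<^sub>L cresolvent T (\<gamma> t)))"

text \<open>
  The operator $f(T)$. It is independent of the choice of the contour, so that the description is
  the one of a uniquely determined operator.
\<close>

definition functional_calculus ::
    "nat \<Rightarrow> ('v::banach \<Rightarrow> clifford \<Rightarrow> 'v) \<Rightarrow> complex set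
      \<Rightarrow> (complex \<Rightarrow> complex) \<Rightarrow> ('v \<Rightarrow>\<^sub>L 'v) \<Rightarrow> ('v \<Rightarrow>\<^sub>L 'v)" where
  "functional_calculus n ract U f T =
     (THE S. S \<in> right_linear_ops n ract \<and>
        (\<exists>\<Delta> \<Gamma>. admissible_contour (cspectrum T) U \<Delta> \<Gamma> \<and> complexify S = riesz_integral T f \<Gamma>))"

end

theory Submission
  imports Defs
begin

text \<open>
  The Riesz integral of $f(\zeta) (\zeta - T_{\mathbb C})^{-1}$ depends only on the homology class of the
  contour, by Cauchy's theorem for cycles applied to the integrand composed with complex
  functionals $\psi$, which separate operators by Hahn-Banach. It commutes with conjugation and with
  every operator commuting with $T$, hence it is the complexification of a right-linear operator.
  From $(\zeta - w)(\zeta - T)^{-1} = I + (T - w)(\zeta - T)^{-1}$ and Cauchy's theorem one gets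
  $f(T) - f(w) = (T - w) q(T)$ for $f(\zeta) - f(w) = (\zeta - w) q(\zeta)$, so $f(w)$ is in the
  spectrum of $f(T)$ whenever $w$ is in the spectrum of $T$. Conversely, if $f - \mu$ has no zero on
  the spectrum, then $(1/(f - \mu))(T)$ inverts $f(T) - \mu$.

  A contour around a compact set $K$ in an open set is found with the Riemann mapping theorem: for a
  compact connected $L \supseteq K$, each component of the complement of $L$ that leaves the open
  set is simply connected in the sphere, and its part outside the open set is enclosed by the
  conformal image of a circle.
\<close>


section \<open>Cauchy's theorem for cycles\<close>

text \<open>\<open>functional_calculus\<close> is a definite description over all admissible
  contours. It denotes \<open>f(T)\<close> only once a contour has been produced and all contours
  are known to give the same operator, so both facts precede the spectral argument. The auxiliary
  functions, a divided difference of \<open>f\<close> and \<open>1 / (f - \<mu>)\<close>, are in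
  general not conjugate symmetric. Hence the calculus is developed for arbitrary holomorphic
  functions, with values in the operators on the complexification, and the symmetry of
  \<open>f\<close> serves the descent to the real space. Two cases of multiplicativity are proved: a
  linear factor \<open>z - w\<close>, and the pair \<open>h\<close>, \<open>1 / h\<close>. The
  second lets a Cauchy-type integral depend holomorphically on a parameter, which is obtained from a
  bound on the speed of the contour; an admissible contour need not satisfy it. Independence of the
  contour permits passing to a constructed one that does.\<close>

lemma winding_number_sum_as_contour_integral:
  assumes "\<And>g. g holomorphic_on W \<Longrightarrow> contour_integral q g = (\<Sum>i\<in>I. contour_integral (p i) g)"
    and "valid_path q" "path_image q \<subseteq> W"
    and "\<And>i. i \<in> I \<Longrightarrow> valid_path (p i) \<and> path_image (p i) \<subseteq> W" and "z \<notin> W"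
  shows "winding_number q z = (\<Sum>i\<in>I. winding_number (p i) z)"
proof -
  have "(\<lambda>w. 1 / (w - z)) holomorphic_on W"
    using assms(5) by (intro holomorphic_intros) auto
  then have "contour_integral q (\<lambda>w. 1 / (w - z)) = (\<Sum>i\<in>I. contour_integral (p i) (\<lambda>w. 1 / (w - z)))"
    by (rule assms(1))
  moreover have "winding_number q z = 1 / (2 * pi * \<i>) * contour_integral q (\<lambda>w. 1 / (w - z))"
    using assms by (intro winding_number_valid_path) auto
  moreover have "winding_number (p i) z = 1 / (2 * pi * \<i>) * contour_integral (p i) (\<lambda>w. 1 / (w - z))" if "i \<in> I" for i
    using assms(4)[OF that] assms(5) by (intro winding_number_valid_path) auto
  ultimately show ?thesis by (simp add: sum_distrib_left)
qed

text \<open>Each loop is reached from the base point along a connector that is run back afterwards,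
  so the connectors cancel in every integral. A family of loops thereby becomes a single loop, the
  form in which \<open>Cauchy_theorem_global\<close> applies.\<close>

lemma loops_join:
  fixes W :: "complex set"
  assumes "open W" "connected W" "a \<in> W" and "finite I"
    and "\<And>i. i \<in> I \<Longrightarrow> valid_path (p i) \<and> pathfinish (p i) = pathstart (p i) \<and> path_image (p i) \<subseteq> W"
  shows "\<exists>q. valid_path q \<and> pathstart q = a \<and> pathfinish q = a \<and> path_image q \<subseteq> W \<and>
    (\<forall>g. g holomorphic_on W \<longrightarrow> contour_integral q g = (\<Sum>i\<in>I. contour_integral (p i) g))"
  using assms(4,5)
proof (induction I)
  case empty
  have "valid_path (linepath a a)" by (rule valid_path_linepath)
  moreover have "path_image (linepath a a) \<subseteq> W" using assms(3) by simp
  ultimately show ?case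
    using pathstart_linepath[of a a] pathfinish_linepath[of a a] contour_integral_trivial[of a]
    by (metis sum.empty)
next
  case (insert i I)
  obtain q where q: "valid_path q" "pathstart q = a" "pathfinish q = a" "path_image q \<subseteq> W"
    and qint: "\<And>g. g holomorphic_on W \<Longrightarrow> contour_integral q g = (\<Sum>i\<in>I. contour_integral (p i) g)"
    using insert.IH insert.prems by blast
  have p: "valid_path (p i)" "pathfinish (p i) = pathstart (p i)" "path_image (p i) \<subseteq> W"
    using insert.prems by auto
  have "pathstart (p i) \<in> W" using p(3) by blast
  then obtain c where c: "polynomial_function c" "path_image c \<subseteq> W" "pathstart c = a" "pathfinish c = pathstart (p i)"
    using connected_open_polynomial_connected[OF assms(1,2,3)] by blast
  have vc: "valid_path c" using c(1) by (rule valid_path_polynomial_function)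
  let ?q = "q +++ (c +++ (p i +++ reversepath c))"
  have "contour_integral ?q g = (\<Sum>i\<in>insert i I. contour_integral (p i) g)" if g: "g holomorphic_on W" for g
  proof -
    have ci: "g contour_integrable_on \<gamma>" if "valid_path \<gamma>" "path_image \<gamma> \<subseteq> W" for \<gamma>
      using contour_integrable_holomorphic_simple[OF g assms(1)] that by blast
    note [simp] = ci[OF q(1,4)] ci[OF p(1,3)] ci[OF vc c(2)]
    show ?thesis
      using insert.hyps q p c vc
      by (simp add: qint[OF g] contour_integrable_joinI contour_integrable_reversepath contour_integral_reversepath)
  qed
  moreover have "valid_path ?q" "pathstart ?q = a" "pathfinish ?q = a"
    using q p c vc by (auto intro!: valid_path_join)
  moreover have "path_image ?q \<subseteq> W"
    using q p c by (intro subset_path_image_join) (auto simp: path_image_reversepath)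
  ultimately show ?case by blast
qed

lemma eventually_winding_number_eq:
  assumes "path \<gamma>" "pathfinish \<gamma> = pathstart \<gamma>" "z \<notin> path_image \<gamma>"
  shows "eventually (\<lambda>w. winding_number \<gamma> w = winding_number \<gamma> z) (nhds z)"
proof -
  have "eventually (\<lambda>w. w \<in> {w. w \<notin> path_image \<gamma> \<and> winding_number \<gamma> w = winding_number \<gamma> z}) (nhds z)"
    by (intro eventually_nhds_in_open open_winding_number_levelsets assms) (use assms in auto)
  then show ?thesis by eventually_elim auto
qed

text \<open>
  The index of the loops inside one component \<open>C\<close>, continued across \<open>C\<close> by minus the index of the
  other loops, is locally constant on the whole plane and vanishes near infinity.
\<close>

lemma winding_number_sum_component:
  fixes U :: "complex set"
  assumes "open U" and "C \<in> components U" and "finite I" "J \<subseteq> I"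
    and path: "\<And>i. i \<in> I \<Longrightarrow> path (p i) \<and> pathfinish (p i) = pathstart (p i)"
    and inC: "\<And>i. i \<in> J \<Longrightarrow> path_image (p i) \<subseteq> C"
    and outC: "\<And>i. i \<in> I - J \<Longrightarrow> path_image (p i) \<subseteq> U - C"
    and zero: "\<And>z. z \<notin> U \<Longrightarrow> (\<Sum>i\<in>I. winding_number (p i) z) = 0"
    and "z \<notin> C"
  shows "(\<Sum>i\<in>J. winding_number (p i) z) = 0"
proof -
  define A where "A z = (\<Sum>i\<in>J. winding_number (p i) z)" for z
  define B where "B z = - (\<Sum>i\<in>I - J. winding_number (p i) z)" for z
  define N where "N z = (if z \<in> C then B z else A z)" for z
  have finJ: "finite J" using assms finite_subset by blast
  have opC: "open C" using assms open_components by blast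
  have CU: "C \<subseteq> U" using assms in_components_subset by blast
  have opUC: "open (U - C)"
  proof -
    have "U - C = \<Union>(components U - {C})"
      using assms(2) Union_components[of U] components_nonoverlap[of C U] by blast
    moreover have "open (\<Union>(components U - {C}))" using open_components[OF assms(1)] by blast
    ultimately show ?thesis by simp
  qed
  have evA: "eventually (\<lambda>w. A w = A z) (nhds z)" if "z \<notin> C" for z
  proof -
    have "eventually (\<lambda>w. \<forall>i\<in>J. winding_number (p i) w = winding_number (p i) z) (nhds z)"
      using finJ assms(4) path inC that
      by (intro eventually_ball_finite ballI eventually_winding_number_eq) blast+
    then show ?thesis unfolding A_def by eventually_elim (intro sum.cong, auto)
  qed
  have evB: "eventually (\<lambda>w. B w = B z) (nhds z)" if "z \<notin> U - C" for z
  proof -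
    have "eventually (\<lambda>w. \<forall>i\<in>I - J. winding_number (p i) w = winding_number (p i) z) (nhds z)"
      using assms(3) path outC that
      by (intro eventually_ball_finite ballI eventually_winding_number_eq) blast+
    then show ?thesis unfolding B_def by eventually_elim (intro arg_cong[of _ _ uminus] sum.cong, auto)
  qed
  \<comment> \<open>Off \<open>U\<close> both formulas are locally constant, and vanishing of the
    total index makes them agree there. This is what allows \<open>N\<close> to switch from one to
    the other at the boundary of \<open>C\<close>.\<close>
  have AB: "A z = B z" if "z \<notin> U" for z
    using zero[OF that] sum.subset_diff[OF assms(4,3), of "\<lambda>i. winding_number (p i) z"]
    by (simp add: A_def B_def add_eq_0_iff)
  have evN: "eventually (\<lambda>w. N w = N z) (nhds z)" for z
  proof -
    consider "z \<in> C" | "z \<in> U - C" | "z \<notin> U" by blast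
    then show ?thesis
    proof cases
      case 1
      then have "eventually (\<lambda>w. w \<in> C) (nhds z)" using opC eventually_nhds_in_open by blast
      moreover have "eventually (\<lambda>w. B w = B z) (nhds z)" using evB 1 by blast
      ultimately show ?thesis by eventually_elim (use 1 in \<open>simp add: N_def\<close>)
    next
      case 2
      then have "eventually (\<lambda>w. w \<in> U - C) (nhds z)" using opUC eventually_nhds_in_open by blast
      moreover have "eventually (\<lambda>w. A w = A z) (nhds z)" using evA 2 by blast
      ultimately show ?thesis by eventually_elim (use 2 in \<open>simp add: N_def\<close>)
    next
      case 3
      then have zC: "z \<notin> C" using CU by blast
      have "eventually (\<lambda>w. A w = A z) (nhds z)" using evA zC by blast
      moreover have "eventually (\<lambda>w. B w = B z) (nhds z)" using evB 3 by blast
      ultimately show ?thesis by eventually_elim (use zC AB[OF 3] in \<open>simp add: N_def\<close>)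
    qed
  qed
  have "N constant_on UNIV"
  proof (rule locally_constant_imp_constant)
    show "\<exists>T. openin (top_of_set UNIV) T \<and> z \<in> T \<and> (\<forall>w\<in>T. N w = N z)" for z
      using evN[of z] by (simp add: eventually_nhds)
  qed (rule connected_UNIV)
  then have const: "N w = N z" for w by (metis constant_on_def UNIV_I)
  have "\<exists>B. \<forall>w. B \<le> norm w \<longrightarrow> winding_number (p i) w = 0" if "i \<in> I" for i
    using winding_number_zero_at_infinity path that by blast
  then obtain b where b: "\<And>i w. i \<in> I \<Longrightarrow> b i \<le> norm w \<Longrightarrow> winding_number (p i) w = 0" by metis
  \<comment> \<open>A point beyond the bounds of all loops, where both formulas for \<open>N\<close>
    vanish. The inserted 0 keeps \<open>Max\<close> meaningful for empty \<open>I\<close>.\<close>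
  define R where "R = Max (insert 0 (b ` I))"
  have R: "R \<ge> 0" "b i \<le> R" if "i \<in> I" for i using that assms(3) by (auto simp: R_def)
  have "N (complex_of_real R) = 0"
    using b R assms(3,4) unfolding N_def A_def B_def
    by (auto intro!: sum.neutral) 
  then show ?thesis using const[of "complex_of_real R"] assms(9) by (simp add: N_def A_def)
qed

text \<open>The loops may lie in different components of \<open>U\<close>, so they cannot simply be
  joined. They are grouped by component and joined within each one. The hypothesis concerns only the
  total index off \<open>U\<close>; \<open>winding_number_sum_component\<close> splits it into one
  condition for each group, valid off its component.\<close>

theorem Cauchy_theorem_homology:
  fixes U :: "complex set"
  assumes U: "open U" and f: "f holomorphic_on U" and I: "finite I"
    and p: "\<And>i. i \<in> I \<Longrightarrow> valid_path (p i) \<and> pathfinish (p i) = pathstart (p i) \<and> path_image (p i) \<subseteq> U"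
    and zero: "\<And>z. z \<notin> U \<Longrightarrow> (\<Sum>i\<in>I. winding_number (p i) z) = 0"
  shows "(\<Sum>i\<in>I. contour_integral (p i) f) = 0"
proof -
  define cc where "cc i = connected_component_set U (pathstart (p i))" for i
  have start: "pathstart (p i) \<in> U" if "i \<in> I" for i using p[OF that] pathstart_in_path_image by blast
  have comp: "cc i \<in> components U" if "i \<in> I" for i
    using start[OF that] by (auto simp: cc_def components_def)
  have img: "path_image (p i) \<subseteq> cc i" if "i \<in> I" for i
  proof -
    have "connected (path_image (p i))"
      using p[OF that] connected_path_image valid_path_imp_path by blast
    then show ?thesis
      unfolding cc_def using p[OF that] pathstart_in_path_image
      by (intro connected_component_maximal) auto
  qed
  have "(\<Sum>i\<in>I. contour_integral (p i) f) = (\<Sum>C\<in>cc ` I. \<Sum>i\<in>{i\<in>I. cc i = C}. contour_integral (p i) f)"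
    by (rule sum.image_gen[OF I])
  also have "\<dots> = 0"
  proof (rule sum.neutral, rule ballI)
    fix C assume "C \<in> cc ` I"
    then obtain i0 where i0: "i0 \<in> I" "C = cc i0" by blast
    define J where "J = {i\<in>I. cc i = C}"
    have C: "C \<in> components U" using comp i0 by blast
    have opC: "open C" "connected C" "C \<subseteq> U"
      using C U open_components in_components_connected in_components_subset by blast+
    have aC: "pathstart (p i0) \<in> C" using img[OF i0(1)] i0(2) pathstart_in_path_image by blast
    have J: "finite J" "J \<subseteq> I" using I by (auto simp: J_def)
    have pJ: "valid_path (p i) \<and> pathfinish (p i) = pathstart (p i) \<and> path_image (p i) \<subseteq> C" if "i \<in> J" for i
      using that p img by (auto simp: J_def)
    obtain q where q: "valid_path q" "pathstart q = pathstart (p i0)" "pathfinish q = pathstart (p i0)" "path_image q \<subseteq> C"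
      and qint: "\<And>g. g holomorphic_on C \<Longrightarrow> contour_integral q g = (\<Sum>i\<in>J. contour_integral (p i) g)"
      using loops_join[OF opC(1,2) aC J(1), of p] pJ by auto
    have out: "path_image (p i) \<subseteq> U - C" if "i \<in> I - J" for i
    proof -
      have i: "i \<in> I" "cc i \<noteq> C" using that by (auto simp: J_def)
      then have "cc i \<inter> C = {}" using components_nonoverlap[OF comp[OF i(1)] C] by simp
      then show ?thesis using p[OF i(1)] img[OF i(1)] by blast
    qed
    have "winding_number q z = 0" if z: "z \<notin> C" for z
    proof -
      have "winding_number q z = (\<Sum>i\<in>J. winding_number (p i) z)"
        by (rule winding_number_sum_as_contour_integral[OF qint q(1,4) _ z]) (use pJ in auto)
      also have "\<dots> = 0"
        by (rule winding_number_sum_component[OF U C I J(2) _ _ out zero z])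
          (use pJ valid_path_imp_path[OF conjunct1[OF p]] p in auto)
      finally show ?thesis .
    qed
    moreover have fC: "f holomorphic_on C" using f opC(3) holomorphic_on_subset by blast
    ultimately have "(f has_contour_integral 0) q"
      using q by (intro Cauchy_theorem_global[OF opC(1)]) simp_all
    then have "contour_integral q f = 0" by (rule contour_integral_unique)
    then show "(\<Sum>i\<in>{i\<in>I. cc i = C}. contour_integral (p i) f) = 0"
      using qint[OF fC] by (simp add: J_def)
  qed
  finally show ?thesis .
qed


section \<open>Existence of contours\<close>

text \<open>
  A \<open>valid_path\<close> may have unbounded speed (and even be non-rectifiable) near its finitely many
  exceptional points; \<open>Cauchy_next_derivative\<close> needs a bound.
\<close>

definition bounded_speed :: "(real \<Rightarrow> complex) \<Rightarrow> bool" where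
  "bounded_speed \<gamma> \<longleftrightarrow> (\<exists>B. \<forall>t\<in>{0..1}. \<exists>D. (\<gamma> has_vector_derivative D) (at t) \<and> norm D \<le> B)"

lemma bounded_speed_vector_derivative:
  assumes "bounded_speed \<gamma>"
  obtains B where "\<And>t. t \<in> {0..1} \<Longrightarrow> norm (vector_derivative \<gamma> (at t)) \<le> B"
proof -
  obtain B where "\<And>t. t \<in> {0..1} \<Longrightarrow> \<exists>D. (\<gamma> has_vector_derivative D) (at t) \<and> norm D \<le> B"
    using assms unfolding bounded_speed_def by blast
  then have "norm (vector_derivative \<gamma> (at t)) \<le> B" if "t \<in> {0..1}" for t
    using that vector_derivative_at by metis
  then show ?thesis by (rule that)
qed

lemma bounded_speed_reversepath:
  assumes "bounded_speed \<gamma>"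
  shows "bounded_speed (reversepath \<gamma>)"
proof -
  obtain B where B: "\<And>t. t \<in> {0..1} \<Longrightarrow> \<exists>D. (\<gamma> has_vector_derivative D) (at t) \<and> norm D \<le> B"
    using assms unfolding bounded_speed_def by blast
  have "\<exists>D. (reversepath \<gamma> has_vector_derivative D) (at t) \<and> norm D \<le> B" if t: "t \<in> {0..1}" for t
  proof -
    obtain D where D: "(\<gamma> has_vector_derivative D) (at (1 - t))" "norm D \<le> B"
      using B[of "1 - t"] t by auto
    have "((\<lambda>t::real. 1 - t) has_vector_derivative -1) (at t)"
      by (auto intro!: derivative_eq_intros simp: has_vector_derivative_def)
    then have "(\<gamma> \<circ> (\<lambda>t. 1 - t) has_vector_derivative (-1) *\<^sub>R D) (at t)"
      using D(1) by (intro vector_diff_chain_at) auto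
    then show ?thesis using D(2) by (auto simp: reversepath_def o_def)
  qed
  then show ?thesis unfolding bounded_speed_def by blast
qed

section \<open>Jordan domains as conformal images of discs\<close>

definition jordan_domain :: "complex set \<Rightarrow> (real \<Rightarrow> complex) \<Rightarrow> bool" where
  "jordan_domain D \<gamma> \<longleftrightarrow> open D \<and> bounded D \<and> frontier D = path_image \<gamma> \<and> interior (closure D) = D \<and>
     valid_path \<gamma> \<and> simple_path \<gamma> \<and> pathfinish \<gamma> = pathstart \<gamma> \<and> bounded_speed \<gamma> \<and>
     (\<forall>z\<in>D. winding_number \<gamma> z = 1) \<and> (\<forall>z. z \<notin> closure D \<longrightarrow> winding_number \<gamma> z = 0)"

text \<open>The index integral pulls back along \<open>g\<close> to the integral of
  \<open>deriv g w / (g w - z)\<close> over the circle. For \<open>z = g a\<close> write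
  \<open>g w - g a = (w - a) * k w\<close>; injectivity makes \<open>k\<close> zero-free, so the
  integrand is \<open>1 / (w - a)\<close> plus the logarithmic derivative of \<open>k\<close>, which
  is holomorphic in the disc.\<close>

lemma winding_number_injective_image_circlepath:
  assumes g: "g holomorphic_on ball 0 1" "inj_on g (ball 0 1)" and r: "0 < r" "r < 1"
  shows "a \<in> ball 0 r \<Longrightarrow> winding_number (g \<circ> circlepath 0 r) (g a) = 1"
    and "z \<notin> g ` cball 0 r \<Longrightarrow> winding_number (g \<circ> circlepath 0 r) z = 0"
proof -
  let ?c = "circlepath 0 r"
  have cimg: "path_image ?c \<subseteq> ball 0 1" using r by auto
  have vp: "valid_path (g \<circ> ?c)"
    using valid_path_compose_holomorphic[OF _ g(1) open_ball cimg] by simp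
  have wn: "winding_number (g \<circ> ?c) z = 1 / (2 * pi * \<i>) * contour_integral ?c (\<lambda>w. deriv g w * (1 / (g w - z)))"
    if "z \<notin> path_image (g \<circ> ?c)" for z
  proof -
    have "contour_integral (g \<circ> ?c) (\<lambda>w. 1 / (w - z)) = contour_integral ?c (\<lambda>w. deriv g w * (1 / (g w - z)))"
      using g(1) cimg by (intro contour_integral_comp_analyticW[of _ "ball 0 1"]) (auto simp: analytic_on_open)
    then show ?thesis using winding_number_valid_path[OF vp that] by simp
  qed
  have dg: "deriv g holomorphic_on ball 0 1" using g(1) by (intro holomorphic_deriv) auto
  {
    assume a: "a \<in> ball 0 r"
    then have a1: "a \<in> ball 0 1" using r by auto
    define k where "k w = (if w = a then deriv g a else (g w - g a) / (w - a))" for w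
    have k: "k holomorphic_on ball 0 1"
      unfolding k_def by (rule pole_lemma_open[OF g(1) open_ball])
    have knz: "k w \<noteq> 0" if w: "w \<in> ball 0 1" for w
    proof (cases "w = a")
      case True
      then show ?thesis
        using holomorphic_injective_imp_regular[OF g(1) open_ball g(2) a1] by (simp add: k_def)
    next
      case False
      then show ?thesis using g(2) a1 w by (auto simp: k_def inj_on_def)
    qed
    have eq: "deriv g w * (1 / (g w - g a)) = 1 / (w - a) + deriv k w / k w" if w: "w \<in> sphere 0 r" for w
    proof -
      have wa: "w \<noteq> a" and w1: "w \<in> ball 0 1" using w a r by auto
      have "g = (\<lambda>w. g a + (w - a) * k w)" by (auto simp: k_def fun_eq_iff)
      moreover have "((\<lambda>w. g a + (w - a) * k w) has_field_derivative (k w + (w - a) * deriv k w)) (at w)"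
        using holomorphic_derivI[OF k open_ball w1] by (auto intro!: derivative_eq_intros)
      ultimately have "deriv g w = k w + (w - a) * deriv k w"
        using DERIV_imp_deriv by metis
      moreover have "g w - g a = (w - a) * k w" using wa by (simp add: k_def)
      ultimately have "deriv g w * (1 / (g w - g a)) = (k w + (w - a) * deriv k w) / ((w - a) * k w)" by simp
      also have "\<dots> = 1 / (w - a) + deriv k w / k w" using wa knz[OF w1] by (simp add: add_divide_distrib)
      finally show ?thesis .
    qed
    have "((\<lambda>w. deriv k w / k w) has_contour_integral 0) ?c"
      using cimg k knz by (intro Cauchy_theorem_convex_simple[of _ "ball 0 1"]) (auto intro!: holomorphic_intros)
    moreover have "((\<lambda>w. 1 / (w - a)) has_contour_integral (2 * of_real pi * \<i> * 1)) ?c"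
      using Cauchy_integral_circlepath_simple[of "\<lambda>_. 1" 0 r a] a by simp
    ultimately have "((\<lambda>w. 1 / (w - a) + deriv k w / k w) has_contour_integral (2 * of_real pi * \<i> * 1 + 0)) ?c"
      by (intro has_contour_integral_add)
    then have "((\<lambda>w. deriv g w * (1 / (g w - g a))) has_contour_integral (2 * of_real pi * \<i> * 1 + 0)) ?c"
      by (rule has_contour_integral_eq) (use eq r in auto)
    then have "contour_integral ?c (\<lambda>w. deriv g w * (1 / (g w - g a))) = 2 * of_real pi * \<i>"
      using contour_integral_unique by fastforce
    moreover have "g a \<notin> path_image (g \<circ> ?c)"
    proof
      assume "g a \<in> path_image (g \<circ> ?c)"
      then obtain w where "w \<in> sphere 0 r" "g w = g a" using r by (auto simp: path_image_compose)
      moreover then have "w \<in> ball 0 1" using r by auto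
      ultimately have "w = a" using g(2) a1 by (auto simp: inj_on_def)
      then show False using a \<open>w \<in> sphere 0 r\<close> by auto
    qed
    ultimately show "winding_number (g \<circ> ?c) (g a) = 1" using wn by simp
  }
  {
    assume z: "z \<notin> g ` cball 0 r"
    \<comment> \<open>Cauchy's theorem needs room around the closed disc. If \<open>z\<close> has a
      preimage, it is unique and its modulus exceeds \<open>r\<close>, so that modulus serves as
      \<open>\<rho>\<close>; otherwise \<open>\<rho> = 1\<close> does.\<close>
    have "\<exists>\<rho>. r < \<rho> \<and> \<rho> \<le> 1 \<and> z \<notin> g ` ball 0 \<rho>"
    proof (cases "z \<in> g ` ball 0 1")
      case True
      then obtain a where a: "a \<in> ball 0 1" "z = g a" by blast
      then have "r < norm a" using z by (force simp: not_le[symmetric])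
      moreover have "z \<notin> g ` ball 0 (norm a)"
      proof
        assume "z \<in> g ` ball 0 (norm a)"
        then obtain w where "norm w < norm a" "g w = g a" using a(2) by (auto simp: image_iff)
        then have "w = a" using a(1) by (simp add: inj_on_eq_iff[OF g(2)])
        then show False using \<open>norm w < norm a\<close> by simp
      qed
      ultimately show ?thesis using a by (intro exI[of _ "norm a"]) auto
    qed (use r in auto)
    then obtain \<rho> where \<rho>: "r < \<rho>" "\<rho> \<le> 1" "z \<notin> g ` ball 0 \<rho>" by blast
    have "((\<lambda>w. deriv g w * (1 / (g w - z))) has_contour_integral 0) ?c"
    proof (rule Cauchy_theorem_convex_simple[of _ "ball 0 \<rho>"])
      have sub: "ball 0 \<rho> \<subseteq> ball (0::complex) 1" using \<rho> by auto
      show "(\<lambda>w. deriv g w * (1 / (g w - z))) holomorphic_on ball 0 \<rho>"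
        using holomorphic_on_subset[OF g(1) sub] holomorphic_on_subset[OF dg sub] \<rho>(3)
        by (intro holomorphic_intros) auto
    qed (use r \<rho> in auto)
    moreover have "z \<notin> path_image (g \<circ> ?c)"
      using z r by (auto simp: path_image_compose)
    ultimately show "winding_number (g \<circ> ?c) z = 0"
      using wn contour_integral_unique by fastforce
  }
qed

text \<open>The boundary of \<open>S\<close> itself may be wild. The Riemann map sends
  \<open>H\<close> into a disc of some radius \<open>r < 1\<close>, and \<open>g\<close> is still
  conformal around the closed disc of that radius. The image of its circle is therefore a smooth
  Jordan curve of bounded speed inside \<open>S\<close>.\<close>

lemma jordan_domain_exists:
  assumes S: "open S" "bounded S" "simply_connected S" "S \<noteq> {}" and H: "compact H" "H \<subseteq> S"
  obtains D \<gamma> where "jordan_domain D \<gamma>" "H \<subseteq> D" "closure D \<subseteq> S"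
proof -
  have "S \<noteq> UNIV" using S(2) by auto
  then obtain f g where f: "f holomorphic_on S" and g: "g holomorphic_on ball 0 1"
    and fg: "\<And>z. z \<in> S \<Longrightarrow> f z \<in> ball 0 1 \<and> g (f z) = z"
    and gf: "\<And>z. z \<in> ball 0 1 \<Longrightarrow> g z \<in> S \<and> f (g z) = z"
    using Riemann_mapping_theorem[of S] S by blast
  have inj: "inj_on g (ball 0 1)" using gf by (metis inj_onI)
  have cf: "continuous_on S f" and cg: "continuous_on (ball 0 1) g"
    using f g holomorphic_on_imp_continuous_on by auto
  have "\<exists>r. 0 < r \<and> r < 1 \<and> f ` H \<subseteq> ball 0 r"
  proof (cases "H = {}")
    case True
    then show ?thesis by (intro exI[of _ "1/2"]) auto
  next
    case False
    have "compact ((\<lambda>z. norm (f z)) ` H)"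
      using H cf continuous_on_subset by (intro compact_continuous_image continuous_intros) blast+
    then obtain z where z: "z \<in> H" "\<And>w. w \<in> H \<Longrightarrow> norm (f w) \<le> norm (f z)"
      using False compact_attains_sup[of "(\<lambda>z. norm (f z)) ` H"] by auto
    have "norm (f z) < 1" using fg z(1) H(2) by force
    then obtain r where "norm (f z) < r" "r < 1" using dense by blast
    moreover have "0 < r" using \<open>norm (f z) < r\<close> norm_ge_zero[of "f z"] by linarith
    ultimately show ?thesis using z by (intro exI[of _ r]) force
  qed
  then obtain r where r: "0 < r" "r < 1" "f ` H \<subseteq> ball 0 r" by blast
  have sub: "cball 0 r \<subseteq> ball (0::complex) 1" "ball 0 r \<subseteq> ball (0::complex) 1" using r by auto
  define D where "D = g ` ball 0 r"
  define \<gamma> where "\<gamma> = g \<circ> circlepath 0 r"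
  have cimg: "path_image (circlepath 0 r) \<subseteq> ball 0 1" using r by auto
  have preim: "g ` X = S \<inter> f -` X" if X: "X \<subseteq> ball 0 1" for X
  proof
    show "g ` X \<subseteq> S \<inter> f -` X" using gf X by auto
    show "S \<inter> f -` X \<subseteq> g ` X"
    proof
      fix z assume "z \<in> S \<inter> f -` X"
      then have "f z \<in> X" "z = g (f z)" using fg by auto
      then show "z \<in> g ` X" by blast
    qed
  qed
  have Dp: "D = S \<inter> f -` ball 0 r"
    unfolding D_def by (rule preim[OF sub(2)])
  have opD: "open D"
    unfolding Dp by (rule continuous_open_preimage[OF cf S(1) open_ball])
  have cgr: "continuous_on (cball 0 r) g" using cg sub continuous_on_subset by blast
  have cmp: "compact (g ` cball 0 r)"
    by (rule compact_continuous_image[OF cgr compact_cball])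
  have clD: "closure D = g ` cball 0 r"
  proof
    have "D \<subseteq> g ` cball 0 r" by (auto simp: D_def)
    then show "closure D \<subseteq> g ` cball 0 r"
      by (rule closure_minimal) (rule compact_imp_closed[OF cmp])
    have "g ` closure (ball 0 r) \<subseteq> closure (g ` ball 0 r)"
      by (rule continuous_image_closure_subset[OF cgr]) (use r in auto)
    then show "g ` cball 0 r \<subseteq> closure D" using r by (simp add: D_def)
  qed
  \<comment> \<open>\<open>f\<close> maps the interior of the closed image onto an open subset of
    \<open>cball 0 r\<close>, which must then lie in the open ball.\<close>
  have int: "interior (closure D) = D"
  proof
    let ?O = "interior (g ` cball 0 r)"
    have OS: "?O \<subseteq> S" using interior_subset gf sub by blast
    have "f ` ?O = ball 0 1 \<inter> g -` ?O"
    proof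
      show "f ` ?O \<subseteq> ball 0 1 \<inter> g -` ?O" using OS fg by force
      show "ball 0 1 \<inter> g -` ?O \<subseteq> f ` ?O"
      proof
        fix w assume w: "w \<in> ball 0 1 \<inter> g -` ?O"
        then have "w = f (g w)" using gf by auto
        then show "w \<in> f ` ?O" using w by blast
      qed
    qed
    then have "open (f ` ?O)"
      using continuous_open_preimage[OF cg open_ball open_interior, of "g ` cball 0 r"] by simp
    moreover have "f ` ?O \<subseteq> cball 0 r" using interior_subset[of "g ` cball 0 r"] gf sub by force
    ultimately have "f ` ?O \<subseteq> ball 0 r"
      using interior_maximal[of "f ` ?O" "cball 0 r"] by (simp add: interior_cball)
    then have "?O \<subseteq> S \<inter> f -` ball 0 r" using OS by (simp add: image_subset_iff_subset_vimage)
    then show "interior (closure D) \<subseteq> D"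
      unfolding clD by (simp only: Dp)
    show "D \<subseteq> interior (closure D)" using opD closure_subset interior_maximal by blast
  qed
  have fr: "frontier D = path_image \<gamma>"
  proof -
    have "frontier D = g ` cball 0 r - g ` ball 0 r"
      using clD opD by (simp add: frontier_def interior_open D_def)
    also have "\<dots> = g ` (cball 0 r - ball 0 r)"
      using inj_on_image_set_diff[OF inj, of "cball 0 r" "ball 0 r"] sub by auto
    also have "cball 0 r - ball 0 r = sphere (0::complex) r" by auto
    finally show ?thesis using r by (simp add: \<gamma>_def path_image_compose)
  qed
  have vp: "valid_path \<gamma>"
    unfolding \<gamma>_def by (rule valid_path_compose_holomorphic[OF _ g open_ball cimg]) simp
  have simple: "simple_path \<gamma>"
  proof -
    have "simple_path (circlepath 0 r)" using r by (simp add: simple_path_circlepath)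
    then have lf: "\<And>x y. \<lbrakk>x \<in> {0..1}; y \<in> {0..1}; circlepath 0 r x = circlepath 0 r y\<rbrakk> \<Longrightarrow> x = y \<or> x = 0 \<and> y = 1 \<or> x = 1 \<and> y = 0"
      by (auto simp: simple_path_def loop_free_def)
    have "loop_free \<gamma>"
      unfolding loop_free_def
    proof (intro ballI impI)
      fix x y :: real assume xy: "x \<in> {0..1}" "y \<in> {0..1}" "\<gamma> x = \<gamma> y"
      then have "circlepath 0 r x \<in> ball 0 1" "circlepath 0 r y \<in> ball 0 1"
        using cimg unfolding path_image_def by blast+
      then have "circlepath 0 r x = circlepath 0 r y"
        using inj xy(3) by (auto simp: \<gamma>_def inj_on_def)
      then show "x = y \<or> x = 0 \<and> y = 1 \<or> x = 1 \<and> y = 0" using lf xy by blast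
    qed
    then show ?thesis using vp valid_path_imp_path by (auto simp: simple_path_def)
  qed
  have speed: "bounded_speed \<gamma>"
  proof -
    have "continuous_on (sphere 0 r) (deriv g)"
      using holomorphic_deriv[OF g open_ball] holomorphic_on_imp_continuous_on continuous_on_subset cimg r
      by fastforce
    then have "bounded (deriv g ` sphere 0 r)"
      by (intro compact_imp_bounded compact_continuous_image) auto
    then obtain M where M: "\<And>w. w \<in> sphere 0 r \<Longrightarrow> norm (deriv g w) \<le> M" 
      unfolding bounded_iff by blast
    have "\<exists>D. (\<gamma> has_vector_derivative D) (at t) \<and> norm D \<le> 2 * pi * r * M" if "t \<in> {0..1}" for t
    proof -
      have "circlepath 0 r t \<in> path_image (circlepath 0 r)"
        unfolding path_image_def using that by (rule imageI)
      then have t: "circlepath 0 r t \<in> sphere 0 r" using r by simp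
      let ?d = "2 * pi * \<i> * r * exp (2 * of_real pi * \<i> * t)"
      have "(g has_field_derivative deriv g (circlepath 0 r t)) (at (circlepath 0 r t))"
        using t r by (intro holomorphic_derivI[OF g open_ball]) auto
      then have "(\<gamma> has_vector_derivative ?d * deriv g (circlepath 0 r t)) (at t)"
        unfolding \<gamma>_def by (intro field_vector_diff_chain_at has_vector_derivative_circlepath)
      moreover have "norm (?d * deriv g (circlepath 0 r t)) \<le> 2 * pi * r * M"
        using M[OF t] r by (simp add: norm_mult)
      ultimately show ?thesis by blast
    qed
    then show ?thesis unfolding bounded_speed_def by blast
  qed
  have "jordan_domain D \<gamma>"
    unfolding jordan_domain_def
  proof (intro conjI ballI allI impI)
    show "bounded D" using closure_subset cmp clD compact_imp_bounded bounded_subset by metis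
    show "pathfinish \<gamma> = pathstart \<gamma>" by (simp add: \<gamma>_def pathfinish_compose pathstart_compose)
    show "winding_number \<gamma> z = 1" if "z \<in> D" for z
      using that winding_number_injective_image_circlepath(1)[OF g inj r(1,2)] by (auto simp: D_def \<gamma>_def)
    show "winding_number \<gamma> z = 0" if "z \<notin> closure D" for z
      using that winding_number_injective_image_circlepath(2)[OF g inj r(1,2)] by (auto simp: clD \<gamma>_def)
  qed (fact opD int fr vp simple speed)+
  moreover have "H \<subseteq> D"
    using r(3) H(2) by (simp only: Dp image_subset_iff_subset_vimage Int_subset_iff)
  moreover have "closure D \<subseteq> S" unfolding clD preim[OF sub(1)] by (rule Int_lower1)
  ultimately show ?thesis by (rule that)
qed

section \<open>Domains bounded by cycles: cutting holes and disjoint unions\<close>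

definition smooth_domain :: "complex set \<Rightarrow> (real \<Rightarrow> complex) set \<Rightarrow> bool" where
  "smooth_domain \<Delta> \<Gamma> \<longleftrightarrow> open \<Delta> \<and> bounded \<Delta> \<and> positively_oriented_boundary \<Delta> \<Gamma> \<and> (\<forall>\<gamma>\<in>\<Gamma>. bounded_speed \<gamma>)"

lemma smooth_domain_empty: "smooth_domain {} {}"
  by (simp add: smooth_domain_def positively_oriented_boundary_def)

lemma smooth_domain_jordan:
  assumes "jordan_domain D \<gamma>"
  shows "smooth_domain D {\<gamma>}"
  using assms by (auto simp: smooth_domain_def positively_oriented_boundary_def jordan_domain_def)

text \<open>The reversed boundary of the hole has index -1 on \<open>D\<close>, where it cancels the
  total index 1 of \<open>\<Gamma>\<close>, and index 0 off \<open>closure D\<close>, where it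
  changes nothing.\<close>

lemma smooth_domain_Diff_closure:
  assumes \<Delta>: "smooth_domain \<Delta> \<Gamma>" and D: "jordan_domain D \<gamma>" and sub: "closure D \<subseteq> \<Delta>"
  shows "smooth_domain (\<Delta> - closure D) (insert (reversepath \<gamma>) \<Gamma>)"
proof -
  have op: "open \<Delta>" "open D" and bd: "bounded \<Delta>" and pob: "positively_oriented_boundary \<Delta> \<Gamma>"
    and frD: "frontier D = path_image \<gamma>" and intD: "interior (closure D) = D"
    and \<gamma>: "valid_path \<gamma>" "simple_path \<gamma>" "pathfinish \<gamma> = pathstart \<gamma>" "bounded_speed \<gamma>"
    using \<Delta> D by (auto simp: smooth_domain_def jordan_domain_def)
  have fin: "finite \<Gamma>" and images: "(\<Union>\<gamma>\<in>\<Gamma>. path_image \<gamma>) = frontier \<Delta>"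
    using pob by (auto simp: positively_oriented_boundary_def)
  have frDcl: "frontier D \<subseteq> closure D" by (simp add: frontier_def)
  have frdisj: "frontier \<Delta> \<inter> closure D = {}" using op(1) sub by (auto simp: frontier_def interior_open)
  have disj: "disjnt (path_image (reversepath \<gamma>)) (path_image \<delta>)" if "\<delta> \<in> \<Gamma>" for \<delta>
    using frdisj frDcl images that by (auto simp: frD disjnt_def)
  have new: "reversepath \<gamma> \<notin> \<Gamma>"
    using disj[of "reversepath \<gamma>"] by (auto simp: disjnt_def)
  have cl: "closure (\<Delta> - closure D) = closure \<Delta> - D"
  proof
    have "\<Delta> - closure D \<subseteq> closure \<Delta> \<inter> - D" using closure_subset by blast
    then have "closure (\<Delta> - closure D) \<subseteq> closure \<Delta> \<inter> - D"
      by (rule closure_minimal) (use op in \<open>auto intro: closed_Int\<close>)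
    then show "closure (\<Delta> - closure D) \<subseteq> closure \<Delta> - D" by blast
    \<comment> \<open>Regularity of \<open>D\<close> enters here: without it, points of the frontier
      of \<open>D\<close> could fail to be limits of points outside \<open>closure D\<close>, and
      the new curve would not be part of the new frontier.\<close>
    have "closure (- closure D) = - D" using intD by (simp add: closure_complement)
    then have "\<Delta> \<inter> - D \<subseteq> closure (\<Delta> \<inter> - closure D)"
      using open_Int_closure_subset[OF op(1), of "- closure D"] by simp
    moreover have "- closure D \<inter> closure \<Delta> \<subseteq> closure (- closure D \<inter> \<Delta>)"
      by (intro open_Int_closure_subset open_Compl closed_closure)
    ultimately show "closure \<Delta> - D \<subseteq> closure (\<Delta> - closure D)"
      using sub closure_subset[of D] by (auto simp: Diff_eq Int_commute)
  qed
  have wr: "winding_number (reversepath \<gamma>) z = - winding_number \<gamma> z" if "z \<notin> frontier D" for z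
    using that \<gamma>(1) valid_path_imp_path by (intro winding_number_reversepath) (auto simp: frD)
  have wD: "winding_number \<gamma> z = 1" if "z \<in> D" for z using that D by (auto simp: jordan_domain_def)
  have wnD: "winding_number \<gamma> z = 0" if "z \<notin> closure D" for z using that D by (auto simp: jordan_domain_def)
  have wr0: "winding_number (reversepath \<gamma>) z = 0" if "z \<notin> closure D" for z
    using that wr[of z] wnD[of z] frDcl by auto
  have w\<Delta>: "(\<Sum>\<gamma>\<in>\<Gamma>. winding_number \<gamma> z) = 1" if "z \<in> \<Delta>" for z
    using that pob by (auto simp: positively_oriented_boundary_def)
  have wn\<Delta>: "(\<Sum>\<gamma>\<in>\<Gamma>. winding_number \<gamma> z) = 0" if "z \<notin> closure \<Delta>" for z
    using that pob by (auto simp: positively_oriented_boundary_def)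
  have "positively_oriented_boundary (\<Delta> - closure D) (insert (reversepath \<gamma>) \<Gamma>)"
    unfolding positively_oriented_boundary_def
  proof (intro conjI)
    show "\<forall>\<delta>\<in>insert (reversepath \<gamma>) \<Gamma>. valid_path \<delta> \<and> simple_path \<delta> \<and> pathfinish \<delta> = pathstart \<delta>"
      using pob \<gamma> by (auto simp: positively_oriented_boundary_def simple_path_reversepath)
    show "pairwise (\<lambda>\<gamma> \<delta>. disjnt (path_image \<gamma>) (path_image \<delta>)) (insert (reversepath \<gamma>) \<Gamma>)"
      using pob disj disjnt_sym unfolding pairwise_insert by (auto simp: positively_oriented_boundary_def)
    have "frontier (\<Delta> - closure D) = (closure \<Delta> - D) - (\<Delta> - closure D)"
      using op cl by (simp add: frontier_def interior_open open_Diff)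
    also have "\<dots> = frontier \<Delta> \<union> frontier D"
      using op sub closure_subset[of \<Delta>] closure_subset[of D] by (auto simp: frontier_def interior_open)
    finally show "(\<Union>\<delta>\<in>insert (reversepath \<gamma>) \<Gamma>. path_image \<delta>) = frontier (\<Delta> - closure D)"
      using images by (auto simp: frD)
    show "\<forall>z\<in>\<Delta> - closure D. (\<Sum>\<delta>\<in>insert (reversepath \<gamma>) \<Gamma>. winding_number \<delta> z) = 1"
      using w\<Delta> wr0 fin new by auto
    show "\<forall>z. z \<notin> closure (\<Delta> - closure D) \<longrightarrow> (\<Sum>\<delta>\<in>insert (reversepath \<gamma>) \<Gamma>. winding_number \<delta> z) = 0"
    proof (intro allI impI)
      fix z assume "z \<notin> closure (\<Delta> - closure D)"
      then consider "z \<in> D" | "z \<notin> closure \<Delta>" unfolding cl by blast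
      then have "winding_number (reversepath \<gamma>) z + (\<Sum>\<delta>\<in>\<Gamma>. winding_number \<delta> z) = 0"
      proof cases
        case 1
        then have "z \<in> \<Delta>" "z \<notin> frontier D" using sub closure_subset[of D] op by (auto simp: frontier_def interior_open)
        then show ?thesis using 1 wr wD w\<Delta> by simp
      next
        case 2
        then have "z \<notin> closure D" using sub closure_subset[of \<Delta>] by blast
        then show ?thesis using 2 wr0 wn\<Delta> by simp
      qed
      then show "(\<Sum>\<delta>\<in>insert (reversepath \<gamma>) \<Gamma>. winding_number \<delta> z) = 0"
        using fin new by simp
    qed
  qed (use fin in auto)
  moreover have "open (\<Delta> - closure D)" "bounded (\<Delta> - closure D)"
    using op bd by (auto intro: bounded_subset)
  ultimately show ?thesis
    using \<Delta> bounded_speed_reversepath[OF \<gamma>(4)] by (auto simp: smooth_domain_def)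
qed

lemma smooth_domain_Diff_Union_closure:
  assumes "finite \<C>" and "smooth_domain \<Delta> \<Gamma>"
    and "\<And>C. C \<in> \<C> \<Longrightarrow> jordan_domain (D C) (\<gamma> C) \<and> closure (D C) \<subseteq> \<Delta>"
    and "\<And>B C. B \<in> \<C> \<Longrightarrow> C \<in> \<C> \<Longrightarrow> B \<noteq> C \<Longrightarrow> closure (D B) \<inter> closure (D C) = {}"
  shows "\<exists>\<Gamma>'. smooth_domain (\<Delta> - (\<Union>C\<in>\<C>. closure (D C))) \<Gamma>'"
  using assms(1,3,4)
proof (induction \<C>)
  case empty
  then show ?case using assms(2) by auto
next
  case (insert C \<C>)
  have "\<exists>\<Gamma>'. smooth_domain (\<Delta> - (\<Union>C\<in>\<C>. closure (D C))) \<Gamma>'"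
    by (rule insert.IH) (use insert.prems in auto)
  then obtain \<Gamma>' where \<Gamma>': "smooth_domain (\<Delta> - (\<Union>C\<in>\<C>. closure (D C))) \<Gamma>'" by blast
  have "closure (D C) \<inter> closure (D B) = {}" if "B \<in> \<C>" for B
    using insert.prems(2)[of C B] insert.hyps(2) that by auto
  then have "closure (D C) \<subseteq> \<Delta> - (\<Union>C\<in>\<C>. closure (D C))"
    using insert.prems(1)[of C] by blast
  then have "smooth_domain (\<Delta> - (\<Union>C\<in>\<C>. closure (D C)) - closure (D C)) (insert (reversepath (\<gamma> C)) \<Gamma>')"
    using insert.prems(1)[of C] by (intro smooth_domain_Diff_closure[OF \<Gamma>']) auto
  moreover have "\<Delta> - (\<Union>C\<in>\<C>. closure (D C)) - closure (D C) = \<Delta> - (\<Union>C\<in>insert C \<C>. closure (D C))" by blast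
  ultimately show ?case by metis
qed

lemma smooth_domain_Un:
  assumes A: "smooth_domain A \<Gamma>" and B: "smooth_domain B \<Theta>" and disj: "closure A \<inter> closure B = {}"
  shows "smooth_domain (A \<union> B) (\<Gamma> \<union> \<Theta>)"
proof -
  have pA: "positively_oriented_boundary A \<Gamma>" and pB: "positively_oriented_boundary B \<Theta>"
    and op: "open A" "open B" "bounded A" "bounded B"
    using A B by (auto simp: smooth_domain_def)
  have fin: "finite \<Gamma>" "finite \<Theta>" and img: "(\<Union>\<gamma>\<in>\<Gamma>. path_image \<gamma>) = frontier A" "(\<Union>\<gamma>\<in>\<Theta>. path_image \<gamma>) = frontier B"
    using pA pB by (auto simp: positively_oriented_boundary_def)
  have frsub: "frontier A \<subseteq> closure A" "frontier B \<subseteq> closure B" by (auto simp: frontier_def)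
  have dj: "disjnt (path_image \<gamma>) (path_image \<delta>)" if "\<gamma> \<in> \<Gamma>" "\<delta> \<in> \<Theta>" for \<gamma> \<delta>
    using that img frsub disj unfolding disjnt_def by blast
  have "\<Gamma> \<inter> \<Theta> = {}"
  proof (rule ccontr)
    assume "\<Gamma> \<inter> \<Theta> \<noteq> {}"
    then obtain \<gamma> where "\<gamma> \<in> \<Gamma>" "\<gamma> \<in> \<Theta>" by blast
    then show False using dj[of \<gamma> \<gamma>] by (simp add: disjnt_def)
  qed
  then have sum: "(\<Sum>\<gamma>\<in>\<Gamma> \<union> \<Theta>. winding_number \<gamma> z) = (\<Sum>\<gamma>\<in>\<Gamma>. winding_number \<gamma> z) + (\<Sum>\<gamma>\<in>\<Theta>. winding_number \<gamma> z)" for z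
    by (rule sum.union_disjoint[OF fin])
  have zA: "(\<Sum>\<gamma>\<in>\<Gamma>. winding_number \<gamma> z) = 0" if "z \<notin> closure A" for z
    using pA that by (auto simp: positively_oriented_boundary_def)
  have zB: "(\<Sum>\<gamma>\<in>\<Theta>. winding_number \<gamma> z) = 0" if "z \<notin> closure B" for z
    using pB that by (auto simp: positively_oriented_boundary_def)
  have oA: "(\<Sum>\<gamma>\<in>\<Gamma>. winding_number \<gamma> z) = 1" if "z \<in> A" for z
    using pA that by (auto simp: positively_oriented_boundary_def)
  have oB: "(\<Sum>\<gamma>\<in>\<Theta>. winding_number \<gamma> z) = 1" if "z \<in> B" for z
    using pB that by (auto simp: positively_oriented_boundary_def)
  have pw: "pairwise (\<lambda>\<gamma> \<delta>. disjnt (path_image \<gamma>) (path_image \<delta>)) (\<Gamma> \<union> \<Theta>)"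
  proof (rule pairwiseI)
    fix \<gamma> \<delta> assume *: "\<gamma> \<in> \<Gamma> \<union> \<Theta>" "\<delta> \<in> \<Gamma> \<union> \<Theta>" "\<gamma> \<noteq> \<delta>"
    have "pairwise (\<lambda>\<gamma> \<delta>. disjnt (path_image \<gamma>) (path_image \<delta>)) \<Gamma>" "pairwise (\<lambda>\<gamma> \<delta>. disjnt (path_image \<gamma>) (path_image \<delta>)) \<Theta>"
      using pA pB by (auto simp: positively_oriented_boundary_def)
    with * show "disjnt (path_image \<gamma>) (path_image \<delta>)"
      using dj[of \<gamma> \<delta>] dj[of \<delta> \<gamma>] disjnt_sym by (auto simp: pairwise_def)
  qed
  have fr: "frontier (A \<union> B) = frontier A \<union> frontier B"
    using disj op closure_subset[of A] closure_subset[of B]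
    by (auto simp: frontier_def interior_open open_Un)
  have "positively_oriented_boundary (A \<union> B) (\<Gamma> \<union> \<Theta>)"
    unfolding positively_oriented_boundary_def
  proof (intro conjI)
    show "\<forall>\<gamma>\<in>\<Gamma> \<union> \<Theta>. valid_path \<gamma> \<and> simple_path \<gamma> \<and> pathfinish \<gamma> = pathstart \<gamma>"
      using pA pB by (auto simp: positively_oriented_boundary_def)
    show "(\<Union>\<gamma>\<in>\<Gamma> \<union> \<Theta>. path_image \<gamma>) = frontier (A \<union> B)" using fr img by auto
    show "\<forall>z\<in>A \<union> B. (\<Sum>\<gamma>\<in>\<Gamma> \<union> \<Theta>. winding_number \<gamma> z) = 1"
    proof
      fix z assume "z \<in> A \<union> B"
      then consider "z \<in> A" "z \<notin> closure B" | "z \<in> B" "z \<notin> closure A"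
        using disj closure_subset[of A] closure_subset[of B] by blast
      then show "(\<Sum>\<gamma>\<in>\<Gamma> \<union> \<Theta>. winding_number \<gamma> z) = 1"
        by cases (simp_all add: sum oA oB zA zB)
    qed
    show "\<forall>z. z \<notin> closure (A \<union> B) \<longrightarrow> (\<Sum>\<gamma>\<in>\<Gamma> \<union> \<Theta>. winding_number \<gamma> z) = 0"
      by (simp add: sum zA zB)
  qed (use fin pw in auto)
  then show ?thesis using A B by (auto simp: smooth_domain_def)
qed

section \<open>Contours around compact sets\<close>

lemma compact_connected_superset:
  fixes W :: "'a::euclidean_space set"
  assumes W: "open W" "connected W" and K: "compact K" "K \<subseteq> W"
  obtains L where "compact L" "connected L" "K \<subseteq> L" "L \<subseteq> W"
proof (cases "K = {}")
  case True
  then show ?thesis using that[of "{}"] by simp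
next
  case False
  then obtain a where a: "a \<in> W" using K by blast
  have pc: "path_connected W" using W connected_open_path_connected by blast
  have "\<exists>e p. 0 < e \<and> cball x e \<subseteq> W \<and> path p \<and> path_image p \<subseteq> W \<and> pathstart p = a \<and> pathfinish p = x"
    if x: "x \<in> W" for x
  proof -
    obtain e where "0 < e" "cball x e \<subseteq> W" using W(1) x open_contains_cball by blast
    moreover obtain p where "path p" "path_image p \<subseteq> W" "pathstart p = a" "pathfinish p = x"
      using pc a x unfolding path_connected_def by blast
    ultimately show ?thesis by blast
  qed
  then obtain e p where e: "\<And>x. x \<in> W \<Longrightarrow> 0 < e x \<and> cball x (e x) \<subseteq> W"
    and p: "\<And>x. x \<in> W \<Longrightarrow> path (p x) \<and> path_image (p x) \<subseteq> W \<and> pathstart (p x) = a \<and> pathfinish (p x) = x"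
    by metis
  have "K \<subseteq> (\<Union>x\<in>K. ball x (e x))" using e K(2) by fastforce
  then obtain F where F: "F \<subseteq> K" "finite F" "K \<subseteq> (\<Union>x\<in>F. ball x (e x))"
    using compactE_image[OF K(1), of K "\<lambda>x. ball x (e x)"] by (metis open_ball)
  \<comment> \<open>Finitely many closed balls cover \<open>K\<close>; each is attached to the
    common point \<open>a\<close> by a path to its centre, so all pieces are connected and share
    \<open>a\<close>.\<close>
  define L where "L = (\<Union>x\<in>F. path_image (p x) \<union> cball x (e x))"
  have FW: "x \<in> W" if "x \<in> F" for x using that F K by blast
  have ends: "a \<in> path_image (p x)" "x \<in> path_image (p x)" if "x \<in> F" for x
    using p[OF FW[OF that]] pathstart_in_path_image pathfinish_in_path_image by metis+
  have con: "connected (path_image (p x) \<union> cball x (e x))" if "x \<in> F" for x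
  proof (rule connected_Un)
    show "connected (path_image (p x))" using p[OF FW[OF that]] connected_path_image by blast
    have "x \<in> cball x (e x)" using e[OF FW[OF that]] by auto
    then show "path_image (p x) \<inter> cball x (e x) \<noteq> {}" using ends[OF that] by blast
  qed auto
  show ?thesis
  proof (rule that[of L])
    show "compact L"
      unfolding L_def using F(2) p FW by (intro compact_UN compact_Un compact_path_image) auto
    show "connected L"
      unfolding L_def
    proof (rule connected_Union)
      show "\<Inter> ((\<lambda>x. path_image (p x) \<union> cball x (e x)) ` F) \<noteq> {}" using ends(1) by blast
    qed (use con in auto)
    have "ball x (e x) \<subseteq> cball x (e x)" for x by auto
    then show "K \<subseteq> L" using F(3) unfolding L_def by blast
    show "L \<subseteq> W" unfolding L_def using e p FW by blast
  qed
qed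


lemma closure_UNION_finite:
  assumes "finite I"
  shows "closure (\<Union>i\<in>I. A i) = (\<Union>i\<in>I. closure (A i))"
  using assms by (induction I) simp_all

text \<open>The domain is a Jordan domain \<open>D0\<close> around \<open>L\<close> and all its
  bounded complementary components, with holes cut out. Bounded components contained in
  \<open>W\<close> may stay; from each of the others a Jordan domain around its part outside
  \<open>W\<close> is removed. Connectedness of \<open>L\<close> makes these components simply
  connected, so that both kinds of curves come from \<open>jordan_domain_exists\<close>.\<close>

lemma smooth_domain_between_connected:
  assumes W: "open W" "connected W" "bounded W" and K: "compact K" "K \<subseteq> W"
  shows "\<exists>\<Delta> \<Gamma>. smooth_domain \<Delta> \<Gamma> \<and> K \<subseteq> \<Delta> \<and> closure \<Delta> \<subseteq> W"
proof (cases "K = {}")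
  case True
  then show ?thesis by (metis smooth_domain_empty empty_subsetI closure_empty)
next
  case False
  obtain L where L: "compact L" "connected L" "K \<subseteq> L" "L \<subseteq> W"
    by (rule compact_connected_superset[OF W(1,2) K])
  obtain l where l: "l \<in> L" using L(3) False by blast
  obtain R where R: "0 < R" "W \<subseteq> ball 0 R"
    using bounded_subset_ballD[OF W(3), of 0] by blast
  have clL: "closed L" and bdL: "bounded L" using L(1) by (auto intro: compact_imp_closed compact_imp_bounded)
  have Lball: "L \<subseteq> ball 0 R" using L(4) R(2) by blast
  have out: "- ball 0 R \<subseteq> outside L" by (rule outside_subset_convex[OF convex_ball Lball])
  have opO: "open (outside L)" and opI: "open (inside L)"
    using clL by (simp_all add: open_outside open_inside)
  have comp_out: "x \<in> outside L" if "C \<in> components (- L)" "\<not> bounded C" "x \<in> C" for C x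
    using that by (auto simp: outside components_def connected_component_eq)
  have comp_in: "C \<subseteq> inside L" if "C \<in> components (- L)" "bounded C" for C
    using that by (auto simp: inside_def components_def connected_component_eq dest: connected_component_in)

  define \<C> where "\<C> = {C \<in> components (- L). bounded C \<and> C - W \<noteq> {}}"
  have fin: "finite \<C>"
  proof -
    let ?X = "cball 0 R - W"
    have "compact ?X" using W(1) by (intro compact_diff) auto
    moreover have "open C" if "C \<in> components (- L)" for C
      using that clL open_components open_Compl by blast
    moreover have "?X \<subseteq> \<Union>(components (- L))" using L(4) by (auto simp: Union_components[symmetric])
    ultimately obtain F where F: "F \<subseteq> components (- L)" "finite F" "?X \<subseteq> \<Union>F"
      using compactE[of ?X "components (- L)"] by metis
    \<comment> \<open>Components are disjoint, so a component meeting \<open>?X\<close> must itself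
      occur in the finite subcover; a bounded one that leaves \<open>W\<close> does meet
      \<open>?X\<close>.\<close>
    have "\<C> \<subseteq> F"
    proof
      fix C assume C: "C \<in> \<C>"
      then obtain z where z: "z \<in> C" "z \<notin> W" by (auto simp: \<C>_def)
      have "z \<in> inside L" using C z comp_in by (auto simp: \<C>_def)
      then have "z \<in> ball 0 R" using out inside_Int_outside[of L] by blast
      then have "z \<in> cball 0 R" by simp
      then obtain B where "B \<in> F" "z \<in> B" using z F(3) by blast
      then have "B = C" using F(1) C z components_eq[of B "- L" C] by (auto simp: \<C>_def)
      then show "C \<in> F" using \<open>B \<in> F\<close> by simp
    qed
    then show ?thesis using F(2) finite_subset by blast
  qed
  have "\<exists>D \<gamma>. jordan_domain D \<gamma> \<and> C - W \<subseteq> D \<and> closure D \<subseteq> C" if C: "C \<in> \<C>" for C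
  proof -
    have C': "C \<in> components (- L)" "bounded C" "C - W \<noteq> {}" using C by (auto simp: \<C>_def)
    have opC: "open C" "connected C" using C'(1) clL open_components open_Compl in_components_connected by blast+
    \<comment> \<open>A component of the complement of a connected set has connected complement,
      which for bounded open connected plane sets is simple connectivity.\<close>
    have sc: "simply_connected C"
      using simply_connected_iff_simple[OF opC(1) C'(2)] opC(2) component_complement_connected[OF L(2) C'(1)] by blast
    have cmp: "compact (C - W)"
    proof -
      have "closed ((L \<union> C) - W)" using closed_Un_complement_component[OF clL C'(1)] W(1) by (rule closed_Diff)
      moreover have "(L \<union> C) - W = C - W" using L(4) by blast
      ultimately show ?thesis using C'(2) by (auto simp: compact_eq_bounded_closed intro: bounded_subset)
    qed
    have "C \<noteq> {}" using C'(3) by blast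
    then obtain D \<gamma> where "jordan_domain D \<gamma>" "C - W \<subseteq> D" "closure D \<subseteq> C"
      by (rule jordan_domain_exists[OF opC(1) C'(2) sc _ cmp Diff_subset])
    then show ?thesis by blast
  qed
  then obtain D \<gamma> where D: "\<And>C. C \<in> \<C> \<Longrightarrow> jordan_domain (D C) (\<gamma> C) \<and> C - W \<subseteq> D C \<and> closure (D C) \<subseteq> C"
    by metis

  \<comment> \<open>Aim: a closed connected set \<open>F0\<close> within \<open>outside L\<close>
    that contains every point of \<open>outside L\<close> not in \<open>W\<close>. Those in
    \<open>cball 0 R\<close> are joined inside \<open>outside L\<close> to the point
    \<open>R\<close> of the sphere, which links them to the complement of the ball.\<close>
  obtain M where M: "compact M" "connected M" "insert (of_real R) (outside L \<inter> cball 0 R - W) \<subseteq> M" "M \<subseteq> outside L"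
  proof (rule compact_connected_superset[of "outside L" "insert (of_real R) (outside L \<inter> cball 0 R - W)"])
    show "connected (outside L)" using bdL by (rule connected_outside) simp
    have "closed (L \<union> outside L)" unfolding union_with_outside using opI by (rule closed_Compl)
    then have "compact ((L \<union> outside L) \<inter> cball 0 R - W)" using W(1) by (intro compact_diff closed_Int_compact) auto
    moreover have "(L \<union> outside L) \<inter> cball 0 R - W = outside L \<inter> cball 0 R - W" using L(4) by blast
    ultimately show "compact (insert (of_real R) (outside L \<inter> cball 0 R - W))" by simp
    have "of_real R \<in> - ball (0::complex) R" using R(1) by simp
    then show "insert (of_real R) (outside L \<inter> cball 0 R - W) \<subseteq> outside L" using out by blast
  qed (use opO in auto)
  define F0 where "F0 = M \<union> - ball 0 R"
  have F0: "closed F0" "connected F0" "F0 \<subseteq> outside L" "outside L - W \<subseteq> F0"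
  proof -
    show "closed F0" unfolding F0_def using M(1) compact_imp_closed by (intro closed_Un closed_Compl open_ball) auto
    have "of_real R \<in> M \<inter> - ball (0::complex) R" using M(3) R(1) by simp
    moreover have "connected (- ball (0::complex) R)" by (rule connected_complement_bounded_convex) auto
    ultimately show "connected F0" unfolding F0_def using M(2) by (intro connected_Un) auto
    show "F0 \<subseteq> outside L" using M(4) out by (auto simp: F0_def)
    have "ball 0 R \<subseteq> cball (0::complex) R" by auto
    then show "outside L - W \<subseteq> F0" using M(3) by (auto simp: F0_def)
  qed
  \<comment> \<open>Connectedness of \<open>F0\<close> makes this component simply connected, and
    the complement of the ball contained in \<open>F0\<close> makes it bounded. It avoids everything
    in \<open>outside L\<close> that violates \<open>W\<close>.\<close>
  define V where "V = connected_component_set (- F0) l"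
  have lF0: "l \<in> - F0" using F0(3) l outside_no_overlap[of L] by blast
  have V: "open V" "bounded V" "simply_connected V" "V \<subseteq> - F0" "V \<noteq> {}"
  proof -
    show opV: "open V" unfolding V_def using F0(1) by (intro open_connected_component open_Compl)
    show sub: "V \<subseteq> - F0" unfolding V_def by (rule connected_component_subset)
    show bdV: "bounded V" using sub by (auto simp: F0_def intro: bounded_subset[OF bounded_ball[of 0 R]])
    have "V \<in> components (- F0)" using lF0 by (auto simp: V_def components_def)
    then have "connected (- V)" by (rule component_complement_connected[OF F0(2)])
    then show "simply_connected V" using simply_connected_iff_simple[OF opV bdV] by (simp add: V_def)
    show "V \<noteq> {}" unfolding V_def connected_component_eq_empty using lF0 by simp
  qed
  \<comment> \<open>Filling in the bounded complementary components keeps \<open>L\<close>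
    connected, so the filled set stays in the component \<open>V\<close>.\<close>
  define Q where "Q = L \<union> inside L"
  have Q: "compact Q" "Q \<subseteq> V"
  proof -
    have "closed Q" unfolding Q_def union_with_inside using opO by (rule closed_Compl)
    moreover have "bounded Q" unfolding Q_def using bdL bounded_inside by simp
    ultimately show "compact Q" by (simp add: compact_eq_bounded_closed)
    have "Q \<subseteq> - F0" unfolding Q_def union_with_inside using F0(3) by blast
    then show "Q \<subseteq> V"
      unfolding V_def using l connected_with_inside[OF clL L(2)]
      by (intro connected_component_maximal) (auto simp: Q_def)
  qed
  obtain D0 \<gamma>0 where D0: "jordan_domain D0 \<gamma>0" "Q \<subseteq> D0" "closure D0 \<subseteq> V"
    by (rule jordan_domain_exists[OF V(1,2,3,5) Q])
  define \<Delta> where "\<Delta> = D0 - (\<Union>C\<in>\<C>. closure (D C))"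
  have CI: "C \<subseteq> inside L" if "C \<in> \<C>" for C using that comp_in by (auto simp: \<C>_def)
  have "\<exists>\<Gamma>. smooth_domain \<Delta> \<Gamma>"
    unfolding \<Delta>_def
  proof (rule smooth_domain_Diff_Union_closure[OF fin smooth_domain_jordan[OF D0(1)]])
    show "jordan_domain (D C) (\<gamma> C) \<and> closure (D C) \<subseteq> D0" if "C \<in> \<C>" for C
      using D[OF that] CI[OF that] D0(2) by (auto simp: Q_def)
    show "closure (D B) \<inter> closure (D C) = {}" if "B \<in> \<C>" "C \<in> \<C>" "B \<noteq> C" for B C
    proof -
      have "B \<inter> C = {}" using that components_nonoverlap[of B "- L" C] by (auto simp: \<C>_def)
      then show ?thesis using D[OF that(1)] D[OF that(2)] by blast
    qed
  qed
  moreover have "K \<subseteq> \<Delta>"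
  proof -
    have "L \<inter> closure (D C) = {}" if "C \<in> \<C>" for C
      using D[OF that] CI[OF that] inside_no_overlap[of L] by blast
    then show ?thesis using L(3) D0(2) by (auto simp: \<Delta>_def Q_def)
  qed
  moreover have "closure \<Delta> \<subseteq> W"
  proof
    fix z assume z: "z \<in> closure \<Delta>"
    have zV: "z \<in> V" using z D0(3) closure_mono[of \<Delta> D0] by (auto simp: \<Delta>_def)
    have zD: "z \<notin> D C" if "C \<in> \<C>" for C
    proof
      assume "z \<in> D C"
      moreover have "open (D C)" using D[OF that] by (simp add: jordan_domain_def)
      ultimately have "D C \<inter> \<Delta> \<noteq> {}" using z closure_iff_nhds_not_empty[of z \<Delta>] by blast
      then show False using that closure_subset[of "D C"] by (auto simp: \<Delta>_def)
    qed
    show "z \<in> W"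
    proof (rule ccontr)
      assume zW: "z \<notin> W"
      \<comment> \<open>A bad point cannot lie in the unbounded part, which \<open>F0\<close>
        screens off from \<open>V\<close>. It then lies in a bounded component belonging to
        \<open>\<C>\<close>, hence in the removed \<open>D C\<close>, whose openness keeps it out of
        \<open>closure \<Delta>\<close>.\<close>
      then have "z \<notin> outside L" using zV V(4) F0(4) by blast
      moreover have zL: "z \<in> - L" using zW L(4) by blast
      moreover obtain C where C: "C \<in> components (- L)" "z \<in> C" using zL Union_components[of "- L"] by blast
      ultimately have "C \<in> \<C>" using comp_out zW by (auto simp: \<C>_def)
      then show False using D zD zW C(2) by blast
    qed
  qed
  ultimately show ?thesis by blast
qed

text \<open>Cutting \<open>U\<close> with a ball gives boundedness, and compactness leaves finitely
  many components that meet \<open>K\<close>. Each \<open>K \<inter> C\<close> is compact because it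
  is \<open>K\<close> minus the other, open, components of the cover; domains in different
  components have disjoint closures.\<close>

theorem smooth_domain_between:
  fixes U :: "complex set"
  assumes U: "open U" and K: "compact K" "K \<subseteq> U"
  shows "\<exists>\<Delta> \<Gamma>. smooth_domain \<Delta> \<Gamma> \<and> K \<subseteq> \<Delta> \<and> closure \<Delta> \<subseteq> U"
proof -
  obtain R where R: "K \<subseteq> ball 0 R" using compact_imp_bounded[OF K(1)] bounded_subset_ballD by blast
  define W where "W = U \<inter> ball 0 R"
  have W: "open W" "bounded W" "K \<subseteq> W" using U K R by (auto simp: W_def)
  have opC: "open C" if "C \<in> components W" for C using that W(1) open_components by blast
  moreover have "K \<subseteq> \<Union>(components W)" using W(3) by (simp add: Union_components[symmetric])
  ultimately obtain F where F: "F \<subseteq> components W" "finite F" "K \<subseteq> \<Union>F"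
    using compactE[OF K(1), of "components W"] by metis
  have "\<exists>\<Delta> \<Gamma>. smooth_domain \<Delta> \<Gamma> \<and> K \<inter> C \<subseteq> \<Delta> \<and> closure \<Delta> \<subseteq> C" if C: "C \<in> F" for C
  proof (rule smooth_domain_between_connected)
    have CW: "C \<in> components W" using C F(1) by blast
    show "open C" by (rule opC[OF CW])
    show "connected C" by (rule in_components_connected[OF CW])
    show "bounded C" using in_components_subset[OF CW] W(2) bounded_subset by blast
    have "B \<inter> C = {}" if "B \<in> F - {C}" for B
      using that F(1) CW components_nonoverlap[of B W C] by blast
    then have "K \<inter> C = K - \<Union>(F - {C})" using F(3) C by blast
    moreover have "open (\<Union>(F - {C}))" using F(1) opC by blast
    ultimately show "compact (K \<inter> C)" using K(1) by (simp add: compact_diff)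
  qed auto
  then obtain \<Delta> \<Gamma> where \<Delta>: "\<And>C. C \<in> F \<Longrightarrow> smooth_domain (\<Delta> C) (\<Gamma> C) \<and> K \<inter> C \<subseteq> \<Delta> C \<and> closure (\<Delta> C) \<subseteq> C"
    by metis
  have "smooth_domain (\<Union>C\<in>G. \<Delta> C) (\<Union>C\<in>G. \<Gamma> C)" if "finite G" "G \<subseteq> F" for G
    using that
  proof (induction G)
    case empty
    then show ?case by (simp add: smooth_domain_empty)
  next
    case (insert C G)
    have "closure (\<Delta> C) \<inter> closure (\<Delta> B) = {}" if "B \<in> G" for B
    proof -
      have "B \<in> F" "C \<in> F" "B \<noteq> C" using that insert by auto
      moreover from this have "C \<inter> B = {}" using F(1) components_nonoverlap[of C W B] by blast
      ultimately show ?thesis using \<Delta>[of B] \<Delta>[of C] by blast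
    qed
    moreover have "closure (\<Union>C\<in>G. \<Delta> C) = (\<Union>C\<in>G. closure (\<Delta> C))"
      using insert.hyps(1) by (rule closure_UNION_finite)
    ultimately have "closure (\<Delta> C) \<inter> closure (\<Union>C\<in>G. \<Delta> C) = {}" by auto
    then show ?case using insert \<Delta>[of C] by (simp add: smooth_domain_Un)
  qed
  then have "smooth_domain (\<Union>C\<in>F. \<Delta> C) (\<Union>C\<in>F. \<Gamma> C)" using F(2) by blast
  moreover have "K \<subseteq> (\<Union>C\<in>F. \<Delta> C)" using F(3) \<Delta> by blast
  moreover have "closure (\<Union>C\<in>F. \<Delta> C) \<subseteq> U"
  proof -
    have "closure (\<Union>C\<in>F. \<Delta> C) = (\<Union>C\<in>F. closure (\<Delta> C))" using F(2) by (rule closure_UNION_finite)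
    also have "\<dots> \<subseteq> \<Union>F" using \<Delta> by blast
    also have "\<dots> \<subseteq> U" using F(1) in_components_subset[of _ W] by (auto simp: W_def) 
    finally show ?thesis .
  qed
  ultimately show ?thesis by blast
qed


section \<open>Operator-valued contour integrals\<close>

text \<open>Hahn-Banach by Zorn's lemma. Partial functionals are represented by their graphs, as
  subspaces of the product with the reals, so that extension is inclusion and the upper bound of a
  chain is its union.\<close>

lemma norm_attaining_functional_exists:
  fixes x :: "'a::real_normed_vector"
  shows "\<exists>\<phi>::'a \<Rightarrow> real. bounded_linear \<phi> \<and> \<phi> x = norm x"
proof -
  define A where "A = {G::('a \<times> real) set. subspace G \<and> (\<forall>(u, r)\<in>G. r \<le> norm u) \<and> (x, norm x) \<in> G}"
  have "\<exists>M\<in>A. \<forall>X\<in>A. M \<subseteq> X \<longrightarrow> X = M"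
  proof (rule subset_Zorn_nonempty)
    have "r \<le> norm u" if "(u, r) \<in> span {(x, norm x)}" for u r
      using that by (clarsimp simp: span_singleton) (rule mult_right_mono, auto)
    then have "span {(x, norm x)} \<in> A"
      by (auto simp: A_def intro: span_base)
    then show "A \<noteq> {}" by blast
  next
    fix C assume C: "C \<noteq> {}" "subset.chain A C"
    have CA: "C \<subseteq> A" and lin: "\<And>X Y. X \<in> C \<Longrightarrow> Y \<in> C \<Longrightarrow> X \<subseteq> Y \<or> Y \<subseteq> X"
      using C(2) by (auto simp: subset.chain_def)
    have sub: "subspace (\<Union>C)"
      unfolding subspace_def
    proof (intro conjI ballI allI)
      show "0 \<in> \<Union>C"
        using C(1) CA by (auto simp: A_def subspace_def)
    next
      fix p q assume "p \<in> \<Union>C" "q \<in> \<Union>C"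
      then obtain X Y where "X \<in> C" "Y \<in> C" "p \<in> X" "q \<in> Y" by blast
      then obtain Z where "Z \<in> C" "p \<in> Z" "q \<in> Z"
        using lin[of X Y] by blast
      moreover have "subspace Z" using CA \<open>Z \<in> C\<close> by (auto simp: A_def)
      ultimately show "p + q \<in> \<Union>C" using subspace_add by blast
    next
      fix c p assume "p \<in> \<Union>C"
      then obtain Z where "Z \<in> C" "p \<in> Z" by blast
      moreover have "subspace Z" using CA \<open>Z \<in> C\<close> by (auto simp: A_def)
      ultimately show "c *\<^sub>R p \<in> \<Union>C" using subspace_scale by blast
    qed
    show "\<Union>C \<in> A"
      using sub CA C(1) by (fastforce simp: A_def)
  qed
  then obtain M where MA: "M \<in> A" and maxM: "\<And>X. X \<in> A \<Longrightarrow> M \<subseteq> X \<Longrightarrow> X = M"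
    by blast
  have sub: "subspace M" and le: "\<And>u r. (u, r) \<in> M \<Longrightarrow> r \<le> norm u" and xM: "(x, norm x) \<in> M"
    using MA by (auto simp: A_def)
  \<comment> \<open>Domination by the norm already makes the relation single-valued:
    \<open>(0, r - s)\<close> lies in \<open>M\<close>, so \<open>r - s\<close> is at most the norm
    of 0, and symmetrically.\<close>
  have "r - s \<le> 0" if "(u, r) \<in> M" "(u, s) \<in> M" for u r s
    using le[of 0 "r - s"] subspace_diff[OF sub that] by simp
  then have uniq: "r = s" if "(u, r) \<in> M" "(u, s) \<in> M" for u r s
    using that by (meson antisym diff_le_0_iff_le)
  have total: "\<exists>r. (y, r) \<in> M" for y
  proof (rule ccontr)
    assume neg: "\<nexists>r. (y, r) \<in> M"
    define S where "S = {norm (u + y) - r |u r. (u, r) \<in> M}"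
    \<comment> \<open>An extension to \<open>y\<close> with value \<open>c\<close> is dominated
      exactly if \<open>c\<close> lies between all numbers on the left and all on the right. This
      inequality says such a \<open>c\<close> exists, and the infimum of the right-hand sides is
      one.\<close>
    have lower: "r' - norm (u' - y) \<le> norm (u + y) - r"
      if "(u, r) \<in> M" "(u', r') \<in> M" for u r u' r'
      using le[OF subspace_add[OF sub that, simplified]] norm_triangle_ineq[of "u + y" "u' - y"]
      by (simp add: algebra_simps)
    have M0: "(0, 0) \<in> M" using subspace_0[OF sub] by (simp add: zero_prod_def)
    have bdd: "bdd_below S"
      using lower[OF _ M0] by (force simp: S_def intro!: bdd_belowI)
    have Sne: "S \<noteq> {}" using M0 by (auto simp: S_def)
    define c where "c = Inf S"
    have c_le: "c \<le> norm (u + y) - r" if "(u, r) \<in> M" for u r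
      unfolding c_def by (rule cInf_lower[OF _ bdd]) (use that in \<open>auto simp: S_def\<close>)
    have c_ge: "r - norm (u - y) \<le> c" if "(u, r) \<in> M" for u r
      unfolding c_def by (rule cInf_greatest[OF Sne]) (use lower that in \<open>auto simp: S_def\<close>)
    define N where "N = span (insert (y, c) M)"
    have "s \<le> norm v" if vs: "(v, s) \<in> N" for v s
    proof -
      obtain k where "(v, s) - k *\<^sub>R (y, c) \<in> span M"
        using vs unfolding N_def span_breakdown_eq by blast
      then obtain u r where ur: "(u, r) \<in> M" "v = u + k *\<^sub>R y" "s = r + k * c"
        using span_eq_iff[THEN iffD2, OF sub] by (auto simp: algebra_simps)
      \<comment> \<open>Dividing by the absolute value of \<open>k\<close> reduces positive
        \<open>k\<close> to the upper bound on \<open>c\<close> and negative \<open>k\<close> to the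
        lower one.\<close>
      consider "k = 0" | "k > 0" | "k < 0" by linarith
      then show ?thesis
      proof cases
        case 1
        then show ?thesis using ur le by simp
      next
        case 2
        have "c \<le> norm ((1/k) *\<^sub>R u + y) - r / k"
          using c_le[of "(1/k) *\<^sub>R u" "r / k"] subspace_scale[OF sub ur(1), of "1/k"] by simp
        then have "k * c \<le> k * norm ((1/k) *\<^sub>R u + y) - r"
          using 2 by (simp add: field_simps)
        also have "k * norm ((1/k) *\<^sub>R u + y) = norm v"
          using 2 norm_scaleR[of k "(1/k) *\<^sub>R u + y"] by (simp add: ur(2) algebra_simps)
        finally show ?thesis using ur(3) by simp
      next
        case 3
        define j where "j = - k"
        have j: "j > 0" using 3 by (simp add: j_def)
        have "r / j - norm ((1/j) *\<^sub>R u - y) \<le> c"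
          using c_ge[of "(1/j) *\<^sub>R u" "r / j"] subspace_scale[OF sub ur(1), of "1/j"] by simp
        then have "r - j * norm ((1/j) *\<^sub>R u - y) \<le> j * c"
          using j by (simp add: field_simps)
        moreover have "j * norm ((1/j) *\<^sub>R u - y) = norm v"
          using j norm_scaleR[of j "(1/j) *\<^sub>R u - y"] by (simp add: ur(2) algebra_simps j_def)
        ultimately show ?thesis using ur(3) by (simp add: j_def)
      qed
    qed
    moreover have "M \<subseteq> N" by (auto simp: N_def intro: span_base)
    ultimately have "N = M"
      using maxM[of N] xM by (auto simp: A_def N_def)
    moreover have "(y, c) \<in> N" by (simp add: N_def span_base)
    ultimately show False using neg by blast
  qed
  define \<phi> where "\<phi> u = (THE r. (u, r) \<in> M)" for u
  have \<phi>: "(u, \<phi> u) \<in> M" for u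
    unfolding \<phi>_def using total[of u] uniq by (metis theI)
  have eq: "\<phi> u = r" if "(u, r) \<in> M" for u r
    using uniq \<phi> that by blast
  have "bounded_linear \<phi>"
  proof (rule bounded_linear_intro[where K = 1])
    show "\<phi> (u + v) = \<phi> u + \<phi> v" for u v
      using subspace_add[OF sub \<phi> \<phi>] by (auto intro: eq)
    show "\<phi> (r *\<^sub>R u) = r *\<^sub>R \<phi> u" for r u
      using subspace_scale[OF sub \<phi>] by (auto intro: eq)
    have "\<phi> u \<le> norm u" "- \<phi> u \<le> norm u" for u
      using le[OF \<phi>] le[of "- u" "- \<phi> u"] subspace_neg[OF sub \<phi>, of u] by auto
    then show "norm (\<phi> u) \<le> norm u * 1" for u by (simp add: abs_le_iff)
  qed
  then show ?thesis using eq[OF xM] by blast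
qed

section \<open>Complex scalars as operators on the product space\<close>

lemma cscale_add: "cscale (a + b) = cscale a + cscale b"
  by (rule blinfun_eqI) (simp add: cscale_apply blinfun.bilinear_simps algebra_simps)

lemma cscale_mult: "cscale (a * b) = cscale a o\<^sub>L cscale b"
  by (rule blinfun_eqI) (simp add: cscale_apply algebra_simps)

lemma cscale_of_real: "cscale (of_real r) = r *\<^sub>R id_blinfun"
  by (rule blinfun_eqI) (auto simp: cscale_apply blinfun.bilinear_simps prod_eq_iff)

lemma cscale_one [simp]: "cscale 1 = id_blinfun"
  using cscale_of_real[of 1] by simp

lemma cscale_zero [simp]: "cscale 0 = 0"
  using cscale_of_real[of 0] by simp

lemma cscale_scaleR: "cscale (r *\<^sub>R a) = r *\<^sub>R cscale a"
  by (rule blinfun_eqI) (simp add: cscale_apply blinfun.bilinear_simps algebra_simps)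

lemma cscale_minus: "cscale (- a) = - cscale a"
  using cscale_scaleR[of "-1" a] by simp

lemma cscale_diff: "cscale (a - b) = cscale a - cscale b"
  using cscale_add[of a "- b"] by (simp add: cscale_minus)

lemma blinfun_compose_assoc: "(A o\<^sub>L B) o\<^sub>L C = A o\<^sub>L (B o\<^sub>L C)"
  by (rule blinfun_eqI) simp

lemma blinfun_compose_id [simp]: "id_blinfun o\<^sub>L A = A" "A o\<^sub>L id_blinfun = A"
  by (rule blinfun_eqI, simp)+

lemmas blinfun_compose_simps =
  bounded_bilinear.add_left[OF bounded_bilinear_blinfun_compose]
  bounded_bilinear.add_right[OF bounded_bilinear_blinfun_compose]
  bounded_bilinear.diff_left[OF bounded_bilinear_blinfun_compose]
  bounded_bilinear.diff_right[OF bounded_bilinear_blinfun_compose]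
  bounded_bilinear.minus_left[OF bounded_bilinear_blinfun_compose]
  bounded_bilinear.minus_right[OF bounded_bilinear_blinfun_compose]
  bounded_bilinear.scaleR_left[OF bounded_bilinear_blinfun_compose]
  bounded_bilinear.scaleR_right[OF bounded_bilinear_blinfun_compose]
  bounded_bilinear.sum_left[OF bounded_bilinear_blinfun_compose]
  bounded_bilinear.sum_right[OF bounded_bilinear_blinfun_compose]

text \<open>The product norm need not be homogeneous under complex scalars, only under real ones and
  the rotation by \<open>\<i>\<close>, which is an isometry. Treating real and imaginary part
  separately costs the factor 2 that recurs in the bounds for spectrum and resolvent.\<close>

lemma norm_cscale_apply: "norm (cscale c z) \<le> 2 * norm c * norm z"
proof -
  have re: "\<bar>Re c\<bar> \<le> norm c" and im: "\<bar>Im c\<bar> \<le> norm c" by (rule abs_Re_le_cmod abs_Im_le_cmod)+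
  have "cscale c z = Re c *\<^sub>R z + Im c *\<^sub>R (- snd z, fst z)"
    by (simp add: cscale_apply prod_eq_iff)
  then have "norm (cscale c z) = norm (Re c *\<^sub>R z + Im c *\<^sub>R (- snd z, fst z))" by simp
  also have " \<dots> \<le> \<bar>Re c\<bar> * norm z + \<bar>Im c\<bar> * norm (- snd z, fst z)"
    using norm_triangle_ineq[of "Re c *\<^sub>R z" "Im c *\<^sub>R (- snd z, fst z)"] by (simp only: norm_scaleR)
  also have "norm (- snd z, fst z) = norm z"
    by (simp add: norm_prod_def add.commute)
  also have "\<bar>Re c\<bar> * norm z + \<bar>Im c\<bar> * norm z \<le> norm c * norm z + norm c * norm z"
    using re im by (intro add_mono mult_right_mono) auto
  finally show ?thesis by simp
qed

lemma norm_cscale: "norm (cscale c) \<le> 2 * norm c"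
  by (rule norm_blinfun_bound) (use norm_cscale_apply in auto)

lemma bounded_linear_cscale: "bounded_linear cscale"
  by (rule bounded_linear_intro[where K = 2])
    (use norm_cscale in \<open>auto simp: cscale_add cscale_scaleR mult.commute\<close>)

lemma norm_cscale_compose: "norm (cscale c o\<^sub>L A) \<le> 2 * norm c * norm A"
  using norm_blinfun_compose[of "cscale c" A] mult_right_mono[OF norm_cscale[of c] norm_ge_zero[of A]]
  by (rule order_trans)

lemma bounded_linear_blinfun_compose_left: "bounded_linear (\<lambda>A. A o\<^sub>L B)"
  by (rule bounded_bilinear.bounded_linear_left[OF bounded_bilinear_blinfun_compose])

lemma bounded_linear_blinfun_compose_right: "bounded_linear (\<lambda>A. B o\<^sub>L A)"
  by (rule bounded_bilinear.bounded_linear_right[OF bounded_bilinear_blinfun_compose])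

section \<open>Complex functionals on the space of operators\<close>

definition complex_functional :: "((('v::banach \<times> 'v) \<Rightarrow>\<^sub>L ('v \<times> 'v)) \<Rightarrow> complex) \<Rightarrow> bool" where
  "complex_functional \<psi> \<longleftrightarrow> bounded_linear \<psi> \<and> (\<forall>c A. \<psi> (cscale c o\<^sub>L A) = c * \<psi> A)"

lemma complex_functionalD:
  assumes "complex_functional \<psi>"
  shows "bounded_linear \<psi>" "\<psi> (cscale c o\<^sub>L A) = c * \<psi> A" "\<psi> (A + B) = \<psi> A + \<psi> B" "\<psi> (A - B) = \<psi> A - \<psi> B"
    "\<psi> (- A) = - \<psi> A" "\<psi> (sum F I) = (\<Sum>i\<in>I. \<psi> (F i))" "\<psi> 0 = 0"
  using assms by (simp_all add: complex_functional_def linear_add linear_diff linear_sum linear_neg linear_0 bounded_linear.linear)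

text \<open>The operators form a complex vector space in which \<open>\<i>\<close> acts by
  composition with \<open>cscale \<i>\<close> on the left. A real functional \<open>\<phi>\<close>
  is the real part of the complex one \<open>B \<mapsto> \<phi> B - \<i> * \<phi> (\<i> B)\<close>,
  so the latter does not vanish where \<open>\<phi>\<close> attains the norm.\<close>

lemma complex_functional_nonzero:
  fixes A :: "('v::banach \<times> 'v) \<Rightarrow>\<^sub>L ('v \<times> 'v)"
  assumes "A \<noteq> 0"
  shows "\<exists>\<psi>. complex_functional \<psi> \<and> \<psi> A \<noteq> 0"
proof -
  obtain \<phi> :: "(('v \<times> 'v) \<Rightarrow>\<^sub>L ('v \<times> 'v)) \<Rightarrow> real" where \<phi>: "bounded_linear \<phi>" "\<phi> A = norm A"
    using norm_attaining_functional_exists by blast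
  define \<psi> where "\<psi> B = complex_of_real (\<phi> B) - \<i> * complex_of_real (\<phi> (cscale \<i> o\<^sub>L B))" for B
  have lin: "\<phi> (B + C) = \<phi> B + \<phi> C" "\<phi> (r *\<^sub>R B) = r * \<phi> B" "\<phi> (B - C) = \<phi> B - \<phi> C" for B C r
    using \<phi>(1) by (simp_all add: linear_add linear_scale linear_diff bounded_linear.linear)
  have "bounded_linear (\<lambda>B. \<phi> (cscale \<i> o\<^sub>L B))"
    by (rule bounded_linear_compose[OF \<phi>(1) bounded_linear_blinfun_compose_right])
  then have "bounded_linear \<psi>"
    unfolding \<psi>_def using \<phi>(1)
    by (intro bounded_linear_sub bounded_linear_const_mult bounded_linear_compose[OF bounded_linear_of_real])
  moreover have "\<psi> (cscale c o\<^sub>L B) = c * \<psi> B" for c B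
  proof -
    have c: "cscale c = Re c *\<^sub>R id_blinfun + Im c *\<^sub>R cscale \<i>"
    proof -
      have "c = of_real (Re c) + Im c *\<^sub>R \<i>" by (simp add: complex_eq_iff)
      then have "cscale c = cscale (of_real (Re c) + Im c *\<^sub>R \<i>)" by (rule arg_cong)
      then show ?thesis by (simp only: cscale_add cscale_of_real cscale_scaleR)
    qed
    have ii: "cscale \<i> o\<^sub>L (cscale \<i> o\<^sub>L B) = - B"
    proof -
      have "cscale \<i> o\<^sub>L cscale \<i> = (- id_blinfun :: ('v \<times> 'v) \<Rightarrow>\<^sub>L ('v \<times> 'v))"
        by (rule blinfun_eqI) (simp add: cscale_apply blinfun.bilinear_simps prod_eq_iff)
      then show ?thesis by (simp add: blinfun_compose_assoc[symmetric] blinfun_compose_simps)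
    qed
    have "\<phi> (cscale c o\<^sub>L B) = Re c * \<phi> B + Im c * \<phi> (cscale \<i> o\<^sub>L B)"
      by (simp add: c blinfun_compose_simps lin)
    moreover have "\<phi> (cscale \<i> o\<^sub>L (cscale c o\<^sub>L B)) = Re c * \<phi> (cscale \<i> o\<^sub>L B) - Im c * \<phi> B"
      by (simp add: c blinfun_compose_simps lin ii)
    ultimately show ?thesis
      by (simp add: \<psi>_def complex_eq_iff algebra_simps)
  qed
  moreover have "\<psi> A \<noteq> 0"
  proof
    assume "\<psi> A = 0"
    then have "Re (\<psi> A) = 0" by simp
    then show False using \<phi>(2) assms by (simp add: \<psi>_def)
  qed
  ultimately show ?thesis unfolding complex_functional_def by blast
qed

lemma complex_functional_eqI:
  assumes "\<And>\<psi>. complex_functional \<psi> \<Longrightarrow> \<psi> A = \<psi> B"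
  shows "A = B"
  using complex_functional_nonzero[of "A - B"] assms complex_functionalD(4) by fastforce

text \<open>Norm continuity provides integrals along segments in the Banach space of operators;
  holomorphy after each functional supplies Cauchy's theorem for them.\<close>

definition weakly_holomorphic_on ::
    "(complex \<Rightarrow> ('v::banach \<times> 'v) \<Rightarrow>\<^sub>L ('v \<times> 'v)) \<Rightarrow> complex set \<Rightarrow> bool" where
  "weakly_holomorphic_on F S \<longleftrightarrow> continuous_on S F \<and>
     (\<forall>\<psi>. complex_functional \<psi> \<longrightarrow> (\<lambda>z. \<psi> (F z)) holomorphic_on S)"

lemma weakly_holomorphic_on_subset:
  "weakly_holomorphic_on F S \<Longrightarrow> T \<subseteq> S \<Longrightarrow> weakly_holomorphic_on F T"
  unfolding weakly_holomorphic_on_def using continuous_on_subset holomorphic_on_subset by blast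

lemma weakly_holomorphic_on_cscale:
  assumes "g holomorphic_on S" "weakly_holomorphic_on F S"
  shows "weakly_holomorphic_on (\<lambda>z. cscale (g z) o\<^sub>L F z) S"
proof -
  have "continuous_on S (\<lambda>z. cscale (g z))"
    using assms(1) holomorphic_on_imp_continuous_on bounded_linear.continuous_on[OF bounded_linear_cscale] by blast
  then have "continuous_on S (\<lambda>z. cscale (g z) o\<^sub>L F z)"
    using assms(2) bounded_bilinear.continuous_on[OF bounded_bilinear_blinfun_compose]
    unfolding weakly_holomorphic_on_def by blast
  then show ?thesis
    using assms unfolding weakly_holomorphic_on_def
    by (auto simp: complex_functionalD intro!: holomorphic_intros)
qed

lemma complex_functional_segment_integral:
  assumes F: "weakly_holomorphic_on F S" and S: "closed_segment w z \<subseteq> S" and \<psi>: "complex_functional \<psi>"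
  shows "\<psi> (cscale (z - w) o\<^sub>L integral {0..1} (\<lambda>t. F (linepath w z t))) = contour_integral (linepath w z) (\<lambda>z. \<psi> (F z))"
proof -
  have "continuous_on S F" using F by (simp add: weakly_holomorphic_on_def)
  then have "continuous_on {0..1} (\<lambda>t. F (linepath w z t))"
    by (rule continuous_on_compose2[OF _ continuous_on_linepath]) (use S in \<open>auto simp: linepath_in_path\<close>)
  then have int: "((\<lambda>t. F (linepath w z t)) has_integral integral {0..1} (\<lambda>t. F (linepath w z t))) {0..1}"
    using integrable_continuous_interval integrable_integral by blast
  have "((\<lambda>t. \<psi> (F (linepath w z t)) * (z - w)) has_integral \<psi> (integral {0..1} (\<lambda>t. F (linepath w z t))) * (z - w)) {0..1}"
    using has_integral_linear[OF int complex_functionalD(1)[OF \<psi>]] by (intro has_integral_mult_left) (simp add: o_def)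
  then have "((\<lambda>z. \<psi> (F z)) has_contour_integral \<psi> (integral {0..1} (\<lambda>t. F (linepath w z t))) * (z - w)) (linepath w z)"
    by (simp add: has_contour_integral_linepath)
  then show ?thesis
    using contour_integral_unique complex_functionalD(2)[OF \<psi>] by (simp add: mult.commute)
qed

text \<open>
  A continuous integrand need not be integrable along a \<open>valid_path\<close>, whose speed may be unbounded;
  integrability in the Banach space of operators comes from local primitives.
\<close>

lemma weakly_holomorphic_primitive:
  assumes F: "weakly_holomorphic_on F (ball a r)"
  obtains P where "\<And>z. z \<in> ball a r \<Longrightarrow> (P has_derivative (\<lambda>h. cscale h o\<^sub>L F z)) (at z)"
proof -
  define I where "I w z = integral {0..1} (\<lambda>t. F (linepath w z t))" for w z
  define P where "P z = cscale (z - a) o\<^sub>L I a z" for z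
  have seg: "closed_segment w z \<subseteq> ball a r" if "w \<in> ball a r" "z \<in> ball a r" for w z
    using that by (simp add: closed_segment_subset)
  \<comment> \<open>The scalar primitive \<open>G\<close> depends on the functional, but the
    identity obtained from it does not mention \<open>G\<close>, so it passes to operators by
    separation.\<close>
  have diff: "P z - P w = cscale (z - w) o\<^sub>L I w z" if w: "w \<in> ball a r" and z: "z \<in> ball a r" for w z
  proof (rule complex_functional_eqI)
    fix \<psi> :: "(('a \<times> 'a) \<Rightarrow>\<^sub>L ('a \<times> 'a)) \<Rightarrow> complex" assume \<psi>: "complex_functional \<psi>"
    have "(\<lambda>z. \<psi> (F z)) holomorphic_on ball a r" using F \<psi> by (simp add: weakly_holomorphic_on_def)
    then obtain G where G: "\<And>z. z \<in> ball a r \<Longrightarrow> (G has_field_derivative \<psi> (F z)) (at z within ball a r)"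
      using holomorphic_convex_primitive'[of "ball a r"] by auto
    have a: "a \<in> ball a r" using w by (auto intro: le_less_trans[OF zero_le_dist])
    have prim: "contour_integral (linepath x y) (\<lambda>z. \<psi> (F z)) = G y - G x" if "x \<in> ball a r" "y \<in> ball a r" for x y
    proof -
      have "((\<lambda>z. \<psi> (F z)) has_contour_integral (G (pathfinish (linepath x y)) - G (pathstart (linepath x y)))) (linepath x y)"
        using seg[OF that] by (intro contour_integral_primitive[OF G]) auto
      then show ?thesis using contour_integral_unique by fastforce
    qed
    have "\<psi> (P z - P w) = \<psi> (P z) - \<psi> (P w)" by (rule complex_functionalD(4)[OF \<psi>])
    also have "\<dots> = (G z - G a) - (G w - G a)"
      using complex_functional_segment_integral[OF F seg[OF a z] \<psi>] complex_functional_segment_integral[OF F seg[OF a w] \<psi>]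
        prim[OF a z] prim[OF a w] by (simp add: P_def I_def)
    also have "\<dots> = \<psi> (cscale (z - w) o\<^sub>L I w z)"
      using complex_functional_segment_integral[OF F seg[OF w z] \<psi>] prim[OF w z] by (simp add: I_def)
    finally show "\<psi> (P z - P w) = \<psi> (cscale (z - w) o\<^sub>L I w z)" .
  qed
  have "(P has_derivative (\<lambda>h. cscale h o\<^sub>L F w)) (at w)" if w: "w \<in> ball a r" for w
    unfolding has_derivative_at_alt
  proof (intro conjI allI impI)
    show "bounded_linear (\<lambda>h. cscale h o\<^sub>L F w)"
      by (rule bounded_linear_compose[OF bounded_linear_blinfun_compose_left bounded_linear_cscale])
    fix e :: real assume e: "e > 0"
    have "continuous_on (ball a r) F" using F by (simp add: weakly_holomorphic_on_def)
    then have "isCont F w" using w continuous_on_eq_continuous_at by blast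
    \<comment> \<open>The half compensates for the factor 2 in
      \<open>norm_cscale_compose\<close>.\<close>
    then obtain d1 where d1: "d1 > 0" "\<And>z. dist z w < d1 \<Longrightarrow> dist (F z) (F w) < e / 2"
      using e continuous_at_eps_delta[of w F] by (metis half_gt_zero)
    obtain d2 where d2: "d2 > 0" "ball w d2 \<subseteq> ball a r" using w open_ball openE by blast
    show "\<exists>d>0. \<forall>z. norm (z - w) < d \<longrightarrow> norm (P z - P w - (cscale (z - w) o\<^sub>L F w)) \<le> e * norm (z - w)"
    proof (intro exI[of _ "min d1 d2"] conjI allI impI)
      fix z assume z: "norm (z - w) < min d1 d2"
      then have "z \<in> ball w d2" by (simp add: dist_norm norm_minus_commute)
      then have zb: "z \<in> ball a r" using d2 by blast
      have cont: "continuous_on {0..1} (\<lambda>t. F (linepath w z t))"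
        by (rule continuous_on_compose2[OF \<open>continuous_on (ball a r) F\<close> continuous_on_linepath])
          (use seg[OF w zb] linepath_in_path in blast)
      have "integral {0..1} (\<lambda>t. F (linepath w z t) - F w) = I w z - F w"
        unfolding I_def using cont by (subst integral_diff) (auto intro: integrable_continuous_interval)
      moreover have "norm (integral {0..1} (\<lambda>t. F (linepath w z t) - F w)) \<le> e / 2 * (1 - 0)"
      proof (rule integral_bound)
        show "continuous_on {0..1} (\<lambda>t. F (linepath w z t) - F w)" using cont by (intro continuous_intros)
        fix t :: real assume t: "t \<in> {0..1}"
        have "linepath w z t - w = t *\<^sub>R (z - w)" by (simp add: linepath_def algebra_simps)
        then have "dist (linepath w z t) w \<le> norm (z - w)"
          using t by (simp add: dist_norm mult_left_le_one_le)
        then show "norm (F (linepath w z t) - F w) \<le> e / 2"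
          using d1(2)[of "linepath w z t"] z by (simp add: dist_norm)
      qed simp
      ultimately have le: "norm (I w z - F w) \<le> e / 2" by simp
      have "norm (P z - P w - (cscale (z - w) o\<^sub>L F w)) = norm (cscale (z - w) o\<^sub>L (I w z - F w))"
        by (simp add: diff[OF w zb] blinfun_compose_simps)
      also have "\<dots> \<le> 2 * norm (z - w) * norm (I w z - F w)" by (rule norm_cscale_compose)
      also have "\<dots> \<le> 2 * norm (z - w) * (e / 2)" using le by (intro mult_left_mono) auto
      finally show "norm (P z - P w - (cscale (z - w) o\<^sub>L F w)) \<le> e * norm (z - w)" by (simp add: mult.commute)
    qed (use d1 d2 in auto)
  qed
  then show ?thesis by (rule that)
qed

definition operator_contour_integral ::
    "(real \<Rightarrow> complex) \<Rightarrow> (complex \<Rightarrow> ('v::banach \<times> 'v) \<Rightarrow>\<^sub>L ('v \<times> 'v)) \<Rightarrow> ('v \<times> 'v) \<Rightarrow>\<^sub>L ('v \<times> 'v)" where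
  "operator_contour_integral \<gamma> F = integral {0..1} (\<lambda>t. cscale (vector_derivative \<gamma> (at t within {0..1})) o\<^sub>L F (\<gamma> t))"

text \<open>Off the finite exceptional set the integrand is locally the derivative of the continuous
  function \<open>P (\<gamma> t)\<close>, and the fundamental theorem of calculus makes it
  integrable however fast the path runs.\<close>

lemma operator_contour_integrable:
  assumes F: "weakly_holomorphic_on F S" and S: "open S" and \<gamma>: "valid_path \<gamma>" "path_image \<gamma> \<subseteq> S"
  shows "(\<lambda>t. cscale (vector_derivative \<gamma> (at t within {0..1})) o\<^sub>L F (\<gamma> t)) integrable_on {0..1}"
    (is "?f integrable_on _")
proof -
  obtain X where X: "finite X" "\<gamma> C1_differentiable_on {0..1} - X"
    using \<gamma>(1) unfolding valid_path_def piecewise_C1_differentiable_on_def by auto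
  have cont: "continuous_on {0..1} \<gamma>" using \<gamma>(1) valid_path_imp_path path_def by blast
  have "?f integrable_on cbox 0 1"
  proof (rule integrable_on_little_subintervals, rule ballI)
    fix x :: real assume x: "x \<in> cbox 0 1"
    then have "\<gamma> x \<in> S" using \<gamma>(2) by (auto simp: path_image_def)
    then obtain e where e: "e > 0" "ball (\<gamma> x) e \<subseteq> S" using S open_contains_ball by blast
    obtain P where P: "\<And>z. z \<in> ball (\<gamma> x) e \<Longrightarrow> (P has_derivative (\<lambda>h. cscale h o\<^sub>L F z)) (at z)"
      using weakly_holomorphic_primitive[OF weakly_holomorphic_on_subset[OF F e(2)]] by blast
    obtain d where d: "d > 0" "\<And>t. t \<in> {0..1} \<Longrightarrow> dist t x < d \<Longrightarrow> dist (\<gamma> t) (\<gamma> x) < e"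
      using cont x e(1) unfolding continuous_on_iff by (metis cbox_interval)
    show "\<exists>d>0. \<forall>u v. x \<in> cbox u v \<and> cbox u v \<subseteq> ball x d \<and> cbox u v \<subseteq> cbox 0 1 \<longrightarrow> ?f integrable_on cbox u v"
    proof (intro exI[of _ d] conjI allI impI d(1))
      fix u v assume uv: "x \<in> cbox u v \<and> cbox u v \<subseteq> ball x d \<and> cbox u v \<subseteq> cbox 0 1"
      then have le: "u \<le> v" by auto
      have t: "t \<in> {0..1}" "\<gamma> t \<in> ball (\<gamma> x) e" if "t \<in> {u..v}" for t
      proof -
        show "t \<in> {0..1}" using uv that by auto
        then show "\<gamma> t \<in> ball (\<gamma> x) e"
          using d(2)[of t] uv that by (auto simp: dist_commute subset_iff)
      qed
      have "(?f has_integral (P (\<gamma> v) - P (\<gamma> u))) {u..v}"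
      proof (rule fundamental_theorem_of_calculus_interior_strong[OF X(1) le])
        fix s assume s: "s \<in> {u<..<v} - X"
        then have s01: "s \<in> {0<..<1}" using uv le t(1)[of u] t(1)[of v] by auto
        have "\<gamma> differentiable at s"
          using X(2) s s01 unfolding C1_differentiable_on_eq by auto
        then have "(\<gamma> has_vector_derivative vector_derivative \<gamma> (at s)) (at s)"
          by (simp add: vector_derivative_works)
        moreover have "vector_derivative \<gamma> (at s within {0..1}) = vector_derivative \<gamma> (at s)"
          using s01 by (simp add: at_within_Icc_at)
        ultimately have g: "(\<gamma> has_derivative (\<lambda>h. h *\<^sub>R vector_derivative \<gamma> (at s within {0..1}))) (at s)"
          by (simp add: has_vector_derivative_def)
        have "\<gamma> s \<in> ball (\<gamma> x) e" using t s by auto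
        from diff_chain_at[OF g P[OF this]]
        show "((\<lambda>t. P (\<gamma> t)) has_vector_derivative ?f s) (at s)"
          by (simp add: has_vector_derivative_def o_def cscale_scaleR blinfun_compose_simps)
      next
        have "continuous_on (ball (\<gamma> x) e) P"
          using P has_derivative_continuous continuous_at_imp_continuous_on by blast
        moreover have "continuous_on {u..v} \<gamma>" using cont t(1) continuous_on_subset by blast
        ultimately show "continuous_on {u..v} (\<lambda>t. P (\<gamma> t))"
          by (rule continuous_on_compose2) (use t in auto)
      qed
      then show "?f integrable_on cbox u v" by auto
    qed
  qed
  then show ?thesis by simp
qed

lemma complex_functional_contour_integral:
  assumes F: "weakly_holomorphic_on F S" and S: "open S" and \<gamma>: "valid_path \<gamma>" "path_image \<gamma> \<subseteq> S"
    and \<psi>: "complex_functional \<psi>"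
  shows "\<psi> (operator_contour_integral \<gamma> F) = contour_integral \<gamma> (\<lambda>z. \<psi> (F z))"
proof -
  have "((\<lambda>t. cscale (vector_derivative \<gamma> (at t within {0..1})) o\<^sub>L F (\<gamma> t)) has_integral operator_contour_integral \<gamma> F) {0..1}"
    using operator_contour_integrable[OF F S \<gamma>] by (simp add: operator_contour_integral_def integrable_integral)
  from has_integral_linear[OF this complex_functionalD(1)[OF \<psi>]]
  have "((\<lambda>z. \<psi> (F z)) has_contour_integral \<psi> (operator_contour_integral \<gamma> F)) \<gamma>"
    by (simp add: has_contour_integral_def o_def complex_functionalD(2)[OF \<psi>] mult.commute)
  then show ?thesis by (simp add: contour_integral_unique)
qed


section \<open>The resolvent\<close>

lemma op_inverse_of_apply:
  assumes "op_inverse_of A B"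
  shows "A (B x) = x" "B (A x) = x"
  using assms unfolding op_inverse_of_def
  by (metis blinfun_apply_blinfun_compose blinfun_apply_id_blinfun id_apply)+

lemma op_inverse_of_unique:
  assumes "op_inverse_of A B" "op_inverse_of A B'"
  shows "B = B'"
  by (rule blinfun_eqI) (metis op_inverse_of_apply assms)

lemma op_inverse_of_compose:
  assumes "op_inverse_of A B" "op_inverse_of A' B'"
  shows "op_inverse_of (A o\<^sub>L A') (B' o\<^sub>L B)"
  unfolding op_inverse_of_def
  by (intro conjI blinfun_eqI) (simp_all add: op_inverse_of_apply[OF assms(1)] op_inverse_of_apply[OF assms(2)])

lemma op_inverse_of_commute:
  assumes "op_inverse_of A B" "A o\<^sub>L C = C o\<^sub>L A"
  shows "B o\<^sub>L C = C o\<^sub>L B"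
proof (rule blinfun_eqI)
  fix x
  have "A (C (B x)) = C (A (B x))" using assms(2) by (metis blinfun_apply_blinfun_compose)
  then show "blinfun_apply (B o\<^sub>L C) x = blinfun_apply (C o\<^sub>L B) x"
    by (metis op_inverse_of_apply[OF assms(1)] blinfun_apply_blinfun_compose)
qed

text \<open>\<open>B C\<close> is a right inverse of \<open>A\<close> and, as the factors commute,
  \<open>C B\<close> is a left inverse; a left and a right inverse coincide.\<close>

lemma op_invertible_factor:
  assumes "op_inverse_of (A o\<^sub>L B) C" "A o\<^sub>L B = B o\<^sub>L A"
  shows "\<exists>D. op_inverse_of A D"
proof -
  have "A o\<^sub>L (B o\<^sub>L C) = id_blinfun" and CBA: "(C o\<^sub>L B) o\<^sub>L A = id_blinfun"
    using assms unfolding op_inverse_of_def by (metis blinfun_compose_assoc)+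
  moreover have "C o\<^sub>L B = ((C o\<^sub>L B) o\<^sub>L A) o\<^sub>L (B o\<^sub>L C)"
    using assms(1) by (simp add: op_inverse_of_def blinfun_compose_assoc)
  then have "C o\<^sub>L B = B o\<^sub>L C" using CBA by simp
  ultimately show ?thesis by (auto simp: op_inverse_of_def)
qed

text \<open>Instead of summing the Neumann series, the preimage of \<open>y\<close> is taken as the
  fixed point of the contraction \<open>x \<mapsto> y + N x\<close>. Uniqueness of fixed points
  gives linearity.\<close>

lemma op_invertible_id_minus:
  fixes N :: "'w::banach \<Rightarrow>\<^sub>L 'w"
  assumes N: "norm N < 1"
  shows "\<exists>B. op_inverse_of (id_blinfun - N) B"
proof -
  have ex1: "\<exists>!x. y + N x = x" for y
  proof -
    have "dist (y + N x) (y + N z) \<le> norm N * dist x z" for x z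
      using norm_blinfun[of N "x - z"] by (simp add: dist_norm blinfun.diff_right)
    then have "\<exists>!x\<in>UNIV. y + N x = x"
      using N by (intro Banach_fix[of UNIV "norm N"]) (auto simp: complete_UNIV)
    then show ?thesis by simp
  qed
  define g where "g y = (THE x. y + N x = x)" for y
  have g: "y + N (g y) = g y" for y unfolding g_def by (rule theI'[OF ex1])
  have uniq: "x = g y" if "y + N x = x" for x y using ex1 g that by blast
  have bl: "bounded_linear g"
  proof (rule bounded_linear_intro[where K = "1 / (1 - norm N)"])
    show "g (x + y) = g x + g y" for x y
    proof (rule uniq[symmetric])
      have "(x + N (g x)) + (y + N (g y)) = g x + g y" using g by simp
      then show "(x + y) + N (g x + g y) = g x + g y" by (simp add: blinfun.add_right algebra_simps)
    qed
    show "g (r *\<^sub>R x) = r *\<^sub>R g x" for r x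
    proof (rule uniq[symmetric])
      have "r *\<^sub>R (x + N (g x)) = r *\<^sub>R g x" using g by simp
      then show "r *\<^sub>R x + N (r *\<^sub>R g x) = r *\<^sub>R g x" by (simp add: blinfun.scaleR_right scaleR_add_right)
    qed
    show "norm (g x) \<le> norm x * (1 / (1 - norm N))" for x
    proof -
      have "norm (g x) = norm (x + N (g x))" using g by simp
      also have "\<dots> \<le> norm x + norm N * norm (g x)"
        using norm_triangle_ineq[of x "N (g x)"] norm_blinfun[of N "g x"] by linarith
      finally have "(1 - norm N) * norm (g x) \<le> norm x" by (simp add: algebra_simps)
      then show ?thesis using N by (simp add: field_simps)
    qed
  qed
  have "op_inverse_of (id_blinfun - N) (Blinfun g)"
    unfolding op_inverse_of_def
  proof (intro conjI blinfun_eqI)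
    fix x
    show "blinfun_apply ((id_blinfun - N) o\<^sub>L Blinfun g) x = id_blinfun x"
      using g[of x] by (simp add: bounded_linear_Blinfun_apply[OF bl] blinfun.diff_left algebra_simps)
    show "blinfun_apply (Blinfun g o\<^sub>L (id_blinfun - N)) x = id_blinfun x"
      using uniq[of "x - N x" x] by (simp add: bounded_linear_Blinfun_apply[OF bl] blinfun.diff_left)
  qed
  then show ?thesis by blast
qed

lemma op_invertible_perturb:
  fixes A :: "'w::banach \<Rightarrow>\<^sub>L 'w"
  assumes A: "op_inverse_of A B" and small: "norm (A - A') * norm B < 1"
  shows "\<exists>B'. op_inverse_of A' B'"
proof -
  have "norm ((A - A') o\<^sub>L B) < 1"
    using norm_blinfun_compose[of "A - A'" B] small by linarith
  then obtain C where C: "op_inverse_of (id_blinfun - ((A - A') o\<^sub>L B)) C"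
    using op_invertible_id_minus by blast
  have "A' = (id_blinfun - ((A - A') o\<^sub>L B)) o\<^sub>L A"
    by (rule blinfun_eqI) (simp add: blinfun.bilinear_simps op_inverse_of_apply[OF A])
  then show ?thesis using op_inverse_of_compose[OF C A] by metis
qed

section \<open>The resolvent set and the resolvent\<close>

lemma complexify_commute_cscale: "complexify T o\<^sub>L cscale c = cscale c o\<^sub>L complexify T"
  by (rule blinfun_eqI) (simp add: cscale_apply complexify_apply blinfun.bilinear_simps)

lemma complexify_inject: "complexify S = complexify T \<longleftrightarrow> S = T"
proof
  assume eq: "complexify S = complexify T"
  show "S = T"
  proof (rule blinfun_eqI)
    fix x
    show "S x = T x" using arg_cong[OF eq, of "\<lambda>A. fst (blinfun_apply A (x, 0))"] by (simp add: complexify_apply)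
  qed
qed simp

lemma cresolvent_inverse:
  assumes "\<zeta> \<notin> cspectrum T"
  shows "op_inverse_of (cscale \<zeta> - complexify T) (cresolvent T \<zeta>)"
proof -
  obtain B where B: "op_inverse_of (cscale \<zeta> - complexify T) B"
    using assms by (auto simp: cspectrum_def)
  then show ?thesis unfolding cresolvent_def by (metis op_inverse_of_unique theI)
qed

lemma cresolvent_eqI:
  assumes "op_inverse_of (cscale \<zeta> - complexify T) B"
  shows "\<zeta> \<notin> cspectrum T" "cresolvent T \<zeta> = B"
proof -
  show "\<zeta> \<notin> cspectrum T" using assms by (auto simp: cspectrum_def)
  then show "cresolvent T \<zeta> = B" using cresolvent_inverse op_inverse_of_unique assms by blast
qed

lemma cresolvent_commute:
  assumes "\<zeta> \<notin> cspectrum T" "C o\<^sub>L complexify T = complexify T o\<^sub>L C" "C o\<^sub>L cscale \<zeta> = cscale \<zeta> o\<^sub>L C"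
  shows "cresolvent T \<zeta> o\<^sub>L C = C o\<^sub>L cresolvent T \<zeta>"
  by (rule op_inverse_of_commute[OF cresolvent_inverse[OF assms(1)]]) (simp add: blinfun_compose_simps assms)

lemma cresolvent_commute_cscale:
  assumes "\<zeta> \<notin> cspectrum T"
  shows "cresolvent T \<zeta> o\<^sub>L cscale c = cscale c o\<^sub>L cresolvent T \<zeta>"
  by (rule cresolvent_commute[OF assms])
    (simp_all add: complexify_commute_cscale cscale_mult[symmetric] mult.commute)

lemma cspectrum_nhd:
  assumes \<zeta>: "\<zeta> \<notin> cspectrum T" and small: "2 * norm (w - \<zeta>) * norm (cresolvent T \<zeta>) < 1"
  shows "w \<notin> cspectrum T"
proof -
  have "(cscale \<zeta> - complexify T) - (cscale w - complexify T) = cscale (\<zeta> - w)"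
    by (simp add: cscale_diff)
  then have "norm ((cscale \<zeta> - complexify T) - (cscale w - complexify T)) * norm (cresolvent T \<zeta>)
      \<le> (2 * norm (w - \<zeta>)) * norm (cresolvent T \<zeta>)"
    using mult_right_mono[OF norm_cscale[of "\<zeta> - w"] norm_ge_zero[of "cresolvent T \<zeta>"]]
    by (simp add: norm_minus_commute)
  then show ?thesis
    using op_invertible_perturb[OF cresolvent_inverse[OF \<zeta>], of "cscale w - complexify T"] small
    by (auto simp: cspectrum_def)
qed

lemma open_resolvent_set: "open (- cspectrum T)"
  unfolding open_dist
proof (intro ballI)
  fix \<zeta> assume "\<zeta> \<in> - cspectrum T"
  then have \<zeta>: "\<zeta> \<notin> cspectrum T" by simp
  define r where "r = norm (cresolvent T \<zeta>)"
  have r: "r \<ge> 0" by (simp add: r_def)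
  have "w \<in> - cspectrum T" if "dist w \<zeta> < 1 / (2 * (r + 1))" for w
  proof -
    have "2 * norm (w - \<zeta>) * r \<le> 2 * norm (w - \<zeta>) * (r + 1)" by (intro mult_left_mono) auto
    also have "\<dots> < 1" using that r by (simp add: dist_norm field_simps)
    finally show ?thesis using cspectrum_nhd[OF \<zeta>] by (simp add: r_def)
  qed
  then show "\<exists>e>0. \<forall>y. dist y \<zeta> < e \<longrightarrow> y \<in> - cspectrum T"
    using r by (intro exI[of _ "1 / (2 * (r + 1))"]) auto
qed

lemma cspectrum_bound:
  assumes "2 * norm (complexify T) < norm \<zeta>"
  shows "\<zeta> \<notin> cspectrum T"
proof -
  have "norm \<zeta> > 0" using assms norm_ge_zero[of "complexify T"] by linarith
  then have nz: "\<zeta> \<noteq> 0" by simp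
  have "norm (cscale (1 / \<zeta>) o\<^sub>L complexify T) \<le> 2 * norm (1 / \<zeta>) * norm (complexify T)"
    by (rule norm_cscale_compose)
  also have "\<dots> < 1" using assms nz by (simp add: norm_divide field_simps)
  finally obtain B where B: "op_inverse_of (id_blinfun - (cscale (1 / \<zeta>) o\<^sub>L complexify T)) B"
    using op_invertible_id_minus by blast
  have "op_inverse_of (cscale \<zeta>) (cscale (1 / \<zeta>))"
    using nz by (simp add: op_inverse_of_def cscale_mult[symmetric])
  from op_inverse_of_compose[OF this B]
  have "\<exists>B. op_inverse_of (cscale \<zeta> - complexify T) B"
    using nz by (auto simp: blinfun_compose_simps blinfun_compose_assoc[symmetric] cscale_mult[symmetric])
  then show ?thesis by (simp add: cspectrum_def)
qed

lemma compact_cspectrum: "compact (cspectrum T)"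
  unfolding compact_eq_bounded_closed
proof
  show "bounded (cspectrum T)"
    unfolding bounded_iff using cspectrum_bound by (intro exI[of _ "2 * norm (complexify T)"]) (force simp: not_less[symmetric])
  show "closed (cspectrum T)" using open_resolvent_set by (simp add: closed_def)
qed

lemma resolvent_identity:
  assumes "\<zeta> \<notin> cspectrum T" "w \<notin> cspectrum T"
  shows "cresolvent T w - cresolvent T \<zeta> = cscale (\<zeta> - w) o\<^sub>L (cresolvent T w o\<^sub>L cresolvent T \<zeta>)"
proof (rule blinfun_eqI)
  fix z
  note Z = op_inverse_of_apply[OF cresolvent_inverse[OF assms(1)]]
    and W = op_inverse_of_apply[OF cresolvent_inverse[OF assms(2)]]
  have com: "cscale c (cresolvent T w y) = cresolvent T w (cscale c y)" for c y
    using arg_cong[OF cresolvent_commute_cscale[OF assms(2), of c], of "\<lambda>A. blinfun_apply A y"] by simp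
  have "cscale (\<zeta> - w) (cresolvent T w (cresolvent T \<zeta> z))
      = cresolvent T w ((cscale \<zeta> - complexify T) (cresolvent T \<zeta> z) - (cscale w - complexify T) (cresolvent T \<zeta> z))"
    by (simp add: com cscale_diff blinfun.bilinear_simps)
  also have "\<dots> = cresolvent T w z - cresolvent T \<zeta> z"
    by (simp only: Z blinfun.diff_right W)
  finally show "blinfun_apply (cresolvent T w - cresolvent T \<zeta>) z
      = blinfun_apply (cscale (\<zeta> - w) o\<^sub>L (cresolvent T w o\<^sub>L cresolvent T \<zeta>)) z"
    by (simp add: blinfun.bilinear_simps)
qed

lemma isCont_cresolvent:
  assumes \<zeta>: "\<zeta> \<notin> cspectrum T"
  shows "isCont (cresolvent T) \<zeta>"
proof -
  define r where "r = norm (cresolvent T \<zeta>)"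
  have r: "r \<ge> 0" by (simp add: r_def)
  \<comment> \<open>The radius is chosen so that \<open>2 * norm (w - \<zeta>) * r\<close> is at
    most 1/2: the unknown norm \<open>s\<close> of the resolvent at \<open>w\<close> can then be
    absorbed, giving \<open>s \<le> 2 * r\<close>. Adding 1 to \<open>r\<close> also covers
    \<open>r = 0\<close>.\<close>
  have bound: "norm (cresolvent T w - cresolvent T \<zeta>) \<le> norm (w - \<zeta>) * (4 * r * r)"
    if "norm (w - \<zeta>) < 1 / (4 * (r + 1))" for w
  proof -
    have "4 * norm (w - \<zeta>) * (r + 1) < 1" using that r by (simp add: field_simps)
    moreover have "4 * norm (w - \<zeta>) * r \<le> 4 * norm (w - \<zeta>) * (r + 1)" by (intro mult_left_mono) auto
    ultimately have small: "4 * norm (w - \<zeta>) * r < 1" by linarith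
    have "0 \<le> norm (w - \<zeta>) * r" using r by simp
    then have w: "w \<notin> cspectrum T" using cspectrum_nhd[OF \<zeta>, of w] small by (simp add: r_def)
    define s where "s = norm (cresolvent T w)"
    have "norm (cresolvent T w - cresolvent T \<zeta>) \<le> 2 * norm (\<zeta> - w) * norm (cresolvent T w o\<^sub>L cresolvent T \<zeta>)"
      unfolding resolvent_identity[OF \<zeta> w] by (rule norm_cscale_compose)
    also have "\<dots> \<le> 2 * norm (\<zeta> - w) * (s * r)"
      unfolding s_def r_def by (intro mult_left_mono norm_blinfun_compose) auto
    finally have le: "norm (cresolvent T w - cresolvent T \<zeta>) \<le> norm (w - \<zeta>) * (2 * s * r)"
      by (simp add: norm_minus_commute mult_ac)
    have "s \<le> r + norm (cresolvent T w - cresolvent T \<zeta>)"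
      unfolding s_def r_def by (metis add.commute norm_triangle_sub)
    also have "\<dots> \<le> r + (2 * norm (w - \<zeta>) * r) * s" using le by (simp add: mult_ac)
    also have "(2 * norm (w - \<zeta>) * r) * s \<le> (1/2) * s"
      using small by (intro mult_right_mono) (auto simp: s_def)
    finally have "s \<le> 2 * r" by simp
    then have "2 * s * r \<le> 4 * r * r" using r by (intro mult_right_mono) auto
    then have "norm (w - \<zeta>) * (2 * s * r) \<le> norm (w - \<zeta>) * (4 * r * r)"
      by (rule mult_left_mono) simp
    then show ?thesis using le by linarith
  qed
  have "((\<lambda>w. cresolvent T w - cresolvent T \<zeta>) \<longlongrightarrow> 0) (at \<zeta>)"
  proof (rule Lim_null_comparison)
    show "eventually (\<lambda>w. norm (cresolvent T w - cresolvent T \<zeta>) \<le> norm (w - \<zeta>) * (4 * r * r)) (at \<zeta>)"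
      unfolding eventually_at using bound r
      by (intro exI[of _ "1 / (4 * (r + 1))"]) (auto simp: dist_norm)
    have "((\<lambda>w. norm (w - \<zeta>) * (4 * r * r)) \<longlongrightarrow> norm (\<zeta> - \<zeta>) * (4 * r * r)) (at \<zeta>)"
      by (intro tendsto_intros)
    then show "((\<lambda>w. norm (w - \<zeta>) * (4 * r * r)) \<longlongrightarrow> 0) (at \<zeta>)" by simp
  qed
  then show ?thesis unfolding isCont_def by (rule Lim_null[THEN iffD2])
qed

text \<open>By the resolvent identity the difference quotients are values of minus the product of
  the resolvents at \<open>w\<close> and \<open>\<zeta>\<close>, so continuity of the resolvent
  already yields the derivative.\<close>

lemma weakly_holomorphic_cresolvent: "weakly_holomorphic_on (cresolvent T) (- cspectrum T)"
  unfolding weakly_holomorphic_on_def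
proof (intro conjI allI impI)
  show "continuous_on (- cspectrum T) (cresolvent T)"
    using isCont_cresolvent by (intro continuous_at_imp_continuous_on) auto
  fix \<psi> :: "(('a \<times> 'a) \<Rightarrow>\<^sub>L ('a \<times> 'a)) \<Rightarrow> complex" assume \<psi>: "complex_functional \<psi>"
  show "(\<lambda>z. \<psi> (cresolvent T z)) holomorphic_on - cspectrum T"
  proof (rule holomorphic_onI)
    fix \<zeta> assume "\<zeta> \<in> - cspectrum T"
    then have \<zeta>: "\<zeta> \<notin> cspectrum T" by simp
    have "isCont (\<lambda>w. - \<psi> (cresolvent T w o\<^sub>L cresolvent T \<zeta>)) \<zeta>"
      by (intro continuous_minus bounded_linear.continuous[OF complex_functionalD(1)[OF \<psi>]]
          bounded_linear.continuous[OF bounded_linear_blinfun_compose_left] isCont_cresolvent \<zeta>)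
    then have lim: "((\<lambda>w. - \<psi> (cresolvent T w o\<^sub>L cresolvent T \<zeta>)) \<longlongrightarrow> - \<psi> (cresolvent T \<zeta> o\<^sub>L cresolvent T \<zeta>)) (at \<zeta>)"
      by (simp add: isCont_def)
    have "eventually (\<lambda>w. w \<in> - cspectrum T - {\<zeta>}) (at \<zeta>)"
      using \<zeta> by (intro eventually_at_in_open open_resolvent_set) auto
    then have "eventually (\<lambda>w. - \<psi> (cresolvent T w o\<^sub>L cresolvent T \<zeta>)
        = (\<psi> (cresolvent T w) - \<psi> (cresolvent T \<zeta>)) / (w - \<zeta>)) (at \<zeta>)"
    proof eventually_elim
      case (elim w)
      then have "\<psi> (cresolvent T w) - \<psi> (cresolvent T \<zeta>) = (\<zeta> - w) * \<psi> (cresolvent T w o\<^sub>L cresolvent T \<zeta>)"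
        using resolvent_identity[OF \<zeta>, of w] complex_functionalD(2,4)[OF \<psi>] by (metis Compl_iff DiffD1)
      then show ?case using elim by (simp add: field_simps)
    qed
    then have "((\<lambda>w. (\<psi> (cresolvent T w) - \<psi> (cresolvent T \<zeta>)) / (w - \<zeta>)) \<longlongrightarrow> - \<psi> (cresolvent T \<zeta> o\<^sub>L cresolvent T \<zeta>)) (at \<zeta>)"
      using lim by (rule Lim_transform_eventually[rotated])
    then have "((\<lambda>z. \<psi> (cresolvent T z)) has_field_derivative - \<psi> (cresolvent T \<zeta> o\<^sub>L cresolvent T \<zeta>)) (at \<zeta>)"
      by (simp add: has_field_derivative_iff)
    then show "(\<lambda>z. \<psi> (cresolvent T z)) field_differentiable at \<zeta> within - cspectrum T"
      using field_differentiable_at_within field_differentiable_def by blast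
  qed
qed


section \<open>The Riesz integral and the spectral mapping theorem\<close>

text \<open>The homological content of an admissible contour, with the domain
  \<open>\<Delta>\<close> forgotten. Contours around different domains become comparable, and
  \<open>U\<close> can be enlarged, even to the whole plane.\<close>

definition spectral_cycle :: "complex set \<Rightarrow> complex set \<Rightarrow> (real \<Rightarrow> complex) set \<Rightarrow> bool" where
  "spectral_cycle \<sigma> U \<Gamma> \<longleftrightarrow> finite \<Gamma> \<and>
     (\<forall>\<gamma>\<in>\<Gamma>. valid_path \<gamma> \<and> pathfinish \<gamma> = pathstart \<gamma> \<and> path_image \<gamma> \<subseteq> U - \<sigma>) \<and>
     (\<forall>z\<in>\<sigma>. (\<Sum>\<gamma>\<in>\<Gamma>. winding_number \<gamma> z) = 1) \<and> (\<forall>z. z \<notin> U \<longrightarrow> (\<Sum>\<gamma>\<in>\<Gamma>. winding_number \<gamma> z) = 0)"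

lemma spectral_cycleD:
  assumes "spectral_cycle \<sigma> U \<Gamma>"
  shows "finite \<Gamma>" "\<gamma> \<in> \<Gamma> \<Longrightarrow> valid_path \<gamma>" "\<gamma> \<in> \<Gamma> \<Longrightarrow> pathfinish \<gamma> = pathstart \<gamma>"
    "\<gamma> \<in> \<Gamma> \<Longrightarrow> path_image \<gamma> \<subseteq> U - \<sigma>" "z \<in> \<sigma> \<Longrightarrow> (\<Sum>\<gamma>\<in>\<Gamma>. winding_number \<gamma> z) = 1"
    "z \<notin> U \<Longrightarrow> (\<Sum>\<gamma>\<in>\<Gamma>. winding_number \<gamma> z) = 0"
  using assms unfolding spectral_cycle_def by blast+

lemma spectral_cycle_admissible:
  assumes "admissible_contour \<sigma> U \<Delta> \<Gamma>"
  shows "spectral_cycle \<sigma> U \<Gamma>"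
proof -
  have a: "open \<Delta>" "\<sigma> \<subseteq> \<Delta>" "closure \<Delta> \<subseteq> U" "positively_oriented_boundary \<Delta> \<Gamma>"
    using assms by (auto simp: admissible_contour_def)
  have fr: "frontier \<Delta> \<subseteq> U - \<sigma>" using a(1,2,3) by (auto simp: frontier_def interior_open)
  have img: "path_image \<gamma> \<subseteq> frontier \<Delta>" if "\<gamma> \<in> \<Gamma>" for \<gamma>
    using a(4) that unfolding positively_oriented_boundary_def by blast
  have "\<forall>z\<in>\<sigma>. (\<Sum>\<gamma>\<in>\<Gamma>. winding_number \<gamma> z) = 1" "\<forall>z. z \<notin> U \<longrightarrow> (\<Sum>\<gamma>\<in>\<Gamma>. winding_number \<gamma> z) = 0"
    using a(2,3,4) unfolding positively_oriented_boundary_def by blast+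
  moreover have "finite \<Gamma>" "\<forall>\<gamma>\<in>\<Gamma>. valid_path \<gamma> \<and> pathfinish \<gamma> = pathstart \<gamma>"
    using a(4) unfolding positively_oriented_boundary_def by blast+
  ultimately show ?thesis using img fr unfolding spectral_cycle_def by blast
qed

lemma spectral_cycle_mono: "spectral_cycle \<sigma> U \<Gamma> \<Longrightarrow> U \<subseteq> V \<Longrightarrow> spectral_cycle \<sigma> V \<Gamma>"
  unfolding spectral_cycle_def by blast

lemma spectral_cycle_circlepath:
  assumes "\<sigma> \<subseteq> ball 0 r" "0 < r"
  shows "spectral_cycle \<sigma> UNIV {circlepath 0 r}"
proof -
  have "winding_number (circlepath 0 r) z = 1" if "z \<in> \<sigma>" for z
    using assms(1) that by (intro winding_number_circlepath) (auto simp: norm_minus_commute)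
  moreover have "path_image (circlepath 0 r) \<inter> \<sigma> = {}" using assms by force
  ultimately show ?thesis by (simp add: spectral_cycle_def) blast
qed

lemma spectral_cycle_integral_zero:
  assumes "spectral_cycle \<sigma> U \<Gamma>" "open U" "k holomorphic_on U"
  shows "(\<Sum>\<gamma>\<in>\<Gamma>. contour_integral \<gamma> k) = 0"
  using spectral_cycleD[OF assms(1)] by (intro Cauchy_theorem_homology[OF assms(2,3), of \<Gamma> "\<lambda>\<gamma>. \<gamma>"]) blast+

text \<open>In the difference of the cycles the indices cancel on \<open>\<sigma>\<close> (1 - 1)
  and off \<open>U\<close> (0 - 0). The two families are indexed by a disjoint sum because they may
  share paths, which a union would count once.\<close>

lemma spectral_cycle_integral_eq:
  assumes \<Gamma>: "spectral_cycle \<sigma> U \<Gamma>" and \<Theta>: "spectral_cycle \<sigma> U \<Theta>"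
    and U: "open U" "closed \<sigma>" and k: "k holomorphic_on U - \<sigma>"
  shows "(\<Sum>\<gamma>\<in>\<Gamma>. contour_integral \<gamma> k) = (\<Sum>\<gamma>\<in>\<Theta>. contour_integral \<gamma> k)"
proof -
  let ?p = "case_sum (\<lambda>\<gamma>. \<gamma>) reversepath"
  note G = spectral_cycleD[OF \<Gamma>] and T = spectral_cycleD[OF \<Theta>]
  have op: "open (U - \<sigma>)" using U by (rule open_Diff)
  have "(\<Sum>i\<in>\<Gamma> <+> \<Theta>. contour_integral (?p i) k) = 0"
  proof (rule Cauchy_theorem_homology[OF op k])
    show "finite (\<Gamma> <+> \<Theta>)" using G(1) T(1) by simp
    show "valid_path (?p i) \<and> pathfinish (?p i) = pathstart (?p i) \<and> path_image (?p i) \<subseteq> U - \<sigma>"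
      if "i \<in> \<Gamma> <+> \<Theta>" for i
    proof -
      from that consider \<gamma> where "\<gamma> \<in> \<Gamma>" "i = Inl \<gamma>" | \<gamma> where "\<gamma> \<in> \<Theta>" "i = Inr \<gamma>" by blast
      then show ?thesis
      proof cases
        case (1 \<gamma>)
        then show ?thesis using G(2,3,4)[of \<gamma>] by simp
      next
        case (2 \<gamma>)
        then show ?thesis using T(2,3,4)[of \<gamma>] by (simp add: valid_path_imp_reverse)
      qed
    qed
    fix z assume z: "z \<notin> U - \<sigma>"
    have "winding_number (reversepath \<gamma>) z = - winding_number \<gamma> z" if "\<gamma> \<in> \<Theta>" for \<gamma>
      using T(2,4)[OF that] z by (intro winding_number_reversepath valid_path_imp_path) auto
    then have "(\<Sum>i\<in>\<Gamma> <+> \<Theta>. winding_number (?p i) z) = (\<Sum>\<gamma>\<in>\<Gamma>. winding_number \<gamma> z) - (\<Sum>\<gamma>\<in>\<Theta>. winding_number \<gamma> z)"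
      using G(1) T(1) by (simp add: sum.Plus sum_negf)
    then show "(\<Sum>i\<in>\<Gamma> <+> \<Theta>. winding_number (?p i) z) = 0"
      using z G(5,6)[of z] T(5,6)[of z] by (cases "z \<in> \<sigma>") auto
  qed
  moreover have "contour_integral (reversepath \<gamma>) k = - contour_integral \<gamma> k" if "\<gamma> \<in> \<Theta>" for \<gamma>
    using T(2)[OF that] by (rule contour_integral_reversepath)
  ultimately show ?thesis using G(1) T(1) by (simp add: sum.Plus sum_negf)
qed

section \<open>The Riesz integral: independence of the cycle and commutation\<close>

lemma riesz_integral_eq:
  "riesz_integral T f \<Gamma> = cscale (1 / (2 * of_real pi * \<i>)) o\<^sub>L
     (\<Sum>\<gamma>\<in>\<Gamma>. operator_contour_integral \<gamma> (\<lambda>z. cscale (f z) o\<^sub>L cresolvent T z))"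
  unfolding riesz_integral_def operator_contour_integral_def
  by (simp only: mult.commute[of "f _"] cscale_mult blinfun_compose_assoc)

lemma weakly_holomorphic_integrand:
  assumes "f holomorphic_on U"
  shows "weakly_holomorphic_on (\<lambda>z. cscale (f z) o\<^sub>L cresolvent T z) (U - cspectrum T)"
  using assms weakly_holomorphic_cresolvent
  by (intro weakly_holomorphic_on_cscale) (auto intro: weakly_holomorphic_on_subset)

lemma holomorphic_functional_cresolvent:
  "complex_functional \<psi> \<Longrightarrow> (\<lambda>z. \<psi> (cresolvent T z)) holomorphic_on (U - cspectrum T)"
  using weakly_holomorphic_cresolvent[of T] unfolding weakly_holomorphic_on_def
  by (auto intro: holomorphic_on_subset)

lemma open_Diff_cspectrum: "open U \<Longrightarrow> open (U - cspectrum T)"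
  using compact_cspectrum compact_imp_closed by (intro open_Diff) blast+

lemma complex_functional_riesz_integral:
  assumes \<Gamma>: "spectral_cycle (cspectrum T) U \<Gamma>" and U: "open U" and f: "f holomorphic_on U"
    and \<psi>: "complex_functional \<psi>"
  shows "\<psi> (riesz_integral T f \<Gamma>) =
    1 / (2 * of_real pi * \<i>) * (\<Sum>\<gamma>\<in>\<Gamma>. contour_integral \<gamma> (\<lambda>z. f z * \<psi> (cresolvent T z)))"
proof -
  have "\<psi> (operator_contour_integral \<gamma> (\<lambda>z. cscale (f z) o\<^sub>L cresolvent T z))
      = contour_integral \<gamma> (\<lambda>z. f z * \<psi> (cresolvent T z))" if "\<gamma> \<in> \<Gamma>" for \<gamma>
    using complex_functional_contour_integral[OF weakly_holomorphic_integrand[OF f] open_Diff_cspectrum[OF U]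
        spectral_cycleD(2,4)[OF \<Gamma> that] \<psi>] by (simp add: complex_functionalD(2)[OF \<psi>])
  then show ?thesis
    by (simp add: riesz_integral_eq complex_functionalD(2,6)[OF \<psi>])
qed

lemma riesz_integral_cycle_independent:
  assumes "spectral_cycle (cspectrum T) U \<Gamma>" "spectral_cycle (cspectrum T) U \<Theta>" "open U" "f holomorphic_on U"
  shows "riesz_integral T f \<Gamma> = riesz_integral T f \<Theta>"
proof (rule complex_functional_eqI)
  fix \<psi> :: "(('a \<times> 'a) \<Rightarrow>\<^sub>L ('a \<times> 'a)) \<Rightarrow> complex" assume \<psi>: "complex_functional \<psi>"
  have "(\<lambda>z. f z * \<psi> (cresolvent T z)) holomorphic_on U - cspectrum T"
    using assms(4) holomorphic_functional_cresolvent[OF \<psi>]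
    by (intro holomorphic_intros) (auto intro: holomorphic_on_subset)
  then show "\<psi> (riesz_integral T f \<Gamma>) = \<psi> (riesz_integral T f \<Theta>)"
    using spectral_cycle_integral_eq[OF assms(1,2,3) compact_imp_closed[OF compact_cspectrum]]
    by (simp add: complex_functional_riesz_integral[OF assms(1,3,4) \<psi>]
        complex_functional_riesz_integral[OF assms(2,3,4) \<psi>])
qed

definition complex_linear_op :: "(('v::banach \<times> 'v) \<Rightarrow>\<^sub>L ('v \<times> 'v)) \<Rightarrow> bool" where
  "complex_linear_op A \<longleftrightarrow> (\<forall>c. A o\<^sub>L cscale c = cscale c o\<^sub>L A)"

lemma complex_linear_op_cscale: "complex_linear_op (cscale c)"
  by (simp add: complex_linear_op_def cscale_mult[symmetric] mult.commute)

lemma complex_linear_op_complexify: "complex_linear_op (complexify T)"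
  by (simp add: complex_linear_op_def complexify_commute_cscale)

lemma complex_linear_op_diff: "complex_linear_op A \<Longrightarrow> complex_linear_op B \<Longrightarrow> complex_linear_op (A - B)"
  by (simp add: complex_linear_op_def blinfun_compose_simps)

lemma complex_functional_compose_left:
  assumes \<psi>: "complex_functional \<psi>" and A: "complex_linear_op A"
  shows "complex_functional (\<lambda>X. \<psi> (A o\<^sub>L X))"
proof -
  have "bounded_linear (\<lambda>X. \<psi> (A o\<^sub>L X))"
    by (rule bounded_linear_compose[OF complex_functionalD(1)[OF \<psi>] bounded_linear_blinfun_compose_right])
  moreover have "\<psi> (A o\<^sub>L (cscale c o\<^sub>L X)) = c * \<psi> (A o\<^sub>L X)" for c X
  proof -
    have "A o\<^sub>L (cscale c o\<^sub>L X) = cscale c o\<^sub>L (A o\<^sub>L X)"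
      using A by (simp add: complex_linear_op_def blinfun_compose_assoc[symmetric])
    then show ?thesis by (simp add: complex_functionalD(2)[OF \<psi>])
  qed
  ultimately show ?thesis by (simp add: complex_functional_def)
qed

lemma complex_functional_compose_right:
  assumes \<psi>: "complex_functional \<psi>"
  shows "complex_functional (\<lambda>X. \<psi> (X o\<^sub>L A))"
  unfolding complex_functional_def
  using bounded_linear_compose[OF complex_functionalD(1)[OF \<psi>] bounded_linear_blinfun_compose_left]
  by (simp add: blinfun_compose_assoc complex_functionalD(2)[OF \<psi>])

text \<open>Composing a complex functional with multiplication by \<open>C\<close> on either side
  gives a complex functional again, on the left thanks to complex linearity of \<open>C\<close>. So
  \<open>C\<close> moves under the integral without operator-valued estimates.\<close>

lemma riesz_integral_commute:
  assumes \<Gamma>: "spectral_cycle (cspectrum T) U \<Gamma>" and U: "open U" and f: "f holomorphic_on U"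
    and C: "complex_linear_op C" "C o\<^sub>L complexify T = complexify T o\<^sub>L C"
  shows "C o\<^sub>L riesz_integral T f \<Gamma> = riesz_integral T f \<Gamma> o\<^sub>L C"
proof (rule complex_functional_eqI)
  fix \<psi> :: "(('a \<times> 'a) \<Rightarrow>\<^sub>L ('a \<times> 'a)) \<Rightarrow> complex" assume \<psi>: "complex_functional \<psi>"
  have "contour_integral \<gamma> (\<lambda>z. f z * \<psi> (C o\<^sub>L cresolvent T z)) = contour_integral \<gamma> (\<lambda>z. f z * \<psi> (cresolvent T z o\<^sub>L C))"
    if "\<gamma> \<in> \<Gamma>" for \<gamma>
  proof (rule contour_integral_cong)
    fix z assume "z \<in> path_image \<gamma>"
    then have "z \<notin> cspectrum T" using spectral_cycleD(4)[OF \<Gamma> that] by blast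
    then show "f z * \<psi> (C o\<^sub>L cresolvent T z) = f z * \<psi> (cresolvent T z o\<^sub>L C)"
      using cresolvent_commute[of z T C] C by (simp add: complex_linear_op_def)
  qed simp
  then show "\<psi> (C o\<^sub>L riesz_integral T f \<Gamma>) = \<psi> (riesz_integral T f \<Gamma> o\<^sub>L C)"
    by (simp add: complex_functional_riesz_integral[OF \<Gamma> U f complex_functional_compose_left[OF \<psi> C(1)]]
        complex_functional_riesz_integral[OF \<Gamma> U f complex_functional_compose_right[OF \<psi>]])
qed

lemma complex_linear_op_riesz_integral:
  assumes "spectral_cycle (cspectrum T) U \<Gamma>" "open U" "f holomorphic_on U"
  shows "complex_linear_op (riesz_integral T f \<Gamma>)"
  using riesz_integral_commute[OF assms complex_linear_op_cscale complexify_commute_cscale[symmetric]]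
  by (simp add: complex_linear_op_def)

section \<open>Normalisation: the constant function 1 gives the identity\<close>

lemma cresolvent_expand:
  assumes "z \<notin> cspectrum T"
  shows "cscale z o\<^sub>L cresolvent T z = id_blinfun + (complexify T o\<^sub>L cresolvent T z)"
  using cresolvent_inverse[OF assms] by (simp add: op_inverse_of_def blinfun_compose_simps algebra_simps)

lemma norm_id_blinfun_le: "norm (id_blinfun :: 'a::real_normed_vector \<Rightarrow>\<^sub>L 'a) \<le> 1"
  by (rule norm_blinfun_bound) auto

text \<open>With \<open>R\<close> the resolvent at \<open>z\<close>, expanding
  \<open>z R = I + T R\<close> bounds \<open>norm z * norm R\<close> by
  \<open>2 + 2 * norm T * norm R\<close>; the hypothesis lets the last term be absorbed in half of
  the left-hand side.\<close>

lemma norm_cresolvent_le: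
  assumes z: "4 * norm (complexify T) < norm z"
  shows "norm (cresolvent T z) \<le> 4 / norm z"
proof -
  have nz: "z \<noteq> 0" and pos: "norm z > 0"
    using assms norm_ge_zero[of "complexify T"] by (auto intro: le_less_trans)
  have "z \<notin> cspectrum T" using assms by (intro cspectrum_bound) (use norm_ge_zero[of "complexify T"] in linarith)
  let ?R = "cresolvent T z"
  have "?R = cscale (1 / z) o\<^sub>L (id_blinfun + (complexify T o\<^sub>L ?R))"
    using nz by (simp add: cresolvent_expand[OF \<open>z \<notin> cspectrum T\<close>, symmetric] blinfun_compose_assoc[symmetric] cscale_mult[symmetric])
  then have "norm ?R \<le> 2 * norm (1 / z) * norm (id_blinfun + (complexify T o\<^sub>L ?R))"
    using norm_cscale_compose by metis
  also have "norm (id_blinfun + (complexify T o\<^sub>L ?R)) \<le> 1 + norm (complexify T) * norm ?R"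
    by (intro norm_triangle_mono norm_id_blinfun_le norm_blinfun_compose)
  finally have "norm ?R \<le> 2 * norm (1 / z) * (1 + norm (complexify T) * norm ?R)"
    by (simp add: mult_left_mono)
  then have "norm ?R \<le> 2 / norm z * (1 + norm (complexify T) * norm ?R)" by (simp add: norm_divide)
  then have "norm z * norm ?R \<le> 2 + 2 * norm (complexify T) * norm ?R"
    using pos by (simp add: field_simps)
  also have "2 * norm (complexify T) * norm ?R \<le> (norm z / 2) * norm ?R"
    using z by (intro mult_right_mono) auto
  finally show ?thesis using pos by (simp add: field_simps)
qed

text \<open>The constant is entire, so the cycle may be exchanged for a large circle of radius
  \<open>r\<close>. There the resolvent differs from \<open>I / z\<close> by
  \<open>T R(z) / z\<close>, of order \<open>1 / r\<^sup>2\<close>, against a length of order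
  \<open>r\<close>; the error tends to 0.\<close>

lemma riesz_integral_one:
  fixes T :: "'v::banach \<Rightarrow>\<^sub>L 'v"
  assumes \<Gamma>: "spectral_cycle (cspectrum T) U \<Gamma>"
  shows "riesz_integral T (\<lambda>_. 1) \<Gamma> = id_blinfun"
proof (rule complex_functional_eqI)
  fix \<psi> :: "(('v \<times> 'v) \<Rightarrow>\<^sub>L ('v \<times> 'v)) \<Rightarrow> complex" assume \<psi>: "complex_functional \<psi>"
  let ?I = "id_blinfun :: ('v \<times> 'v) \<Rightarrow>\<^sub>L ('v \<times> 'v)"
  obtain M where M: "M \<ge> 0" "\<And>A. norm (\<psi> A) \<le> M * norm A"
    using bounded_linear.nonneg_bounded[OF complex_functionalD(1)[OF \<psi>]] by (auto simp: mult.commute)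
  define t where "t = norm (complexify T)"
  have t: "t \<ge> 0" by (simp add: t_def)
  define E where "E = \<psi> (riesz_integral T (\<lambda>_. 1) \<Gamma>) - \<psi> ?I"
  have bound: "norm E \<le> 4 * M * t / r" if r: "r > 4 * t" for r
  proof -
    have rpos: "r > 0" using r t by linarith
    have sub: "cspectrum T \<subseteq> ball 0 r"
    proof
      fix z assume "z \<in> cspectrum T"
      then have "norm z \<le> 2 * t" using cspectrum_bound[of T z] by (force simp: t_def)
      then show "z \<in> ball 0 r" using r t by simp
    qed
    note cyc = spectral_cycle_circlepath[OF sub rpos]
    have h1: "(\<lambda>_. 1) holomorphic_on (UNIV :: complex set)" by (rule holomorphic_on_const)
    have "riesz_integral T (\<lambda>_. 1) \<Gamma> = riesz_integral T (\<lambda>_. 1) {circlepath 0 r}"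
      by (rule riesz_integral_cycle_independent[OF spectral_cycle_mono[OF \<Gamma>] cyc open_UNIV h1]) simp
    then have eq: "\<psi> (riesz_integral T (\<lambda>_. 1) \<Gamma>) = 1 / (2 * of_real pi * \<i>) * contour_integral (circlepath 0 r) (\<lambda>z. \<psi> (cresolvent T z))"
      using complex_functional_riesz_integral[OF cyc open_UNIV h1 \<psi>] by simp
    have img: "path_image (circlepath 0 r) \<subseteq> UNIV - cspectrum T"
      using spectral_cycleD(4)[OF cyc] by simp
    have "(\<lambda>z. \<psi> (cresolvent T z)) contour_integrable_on circlepath 0 r"
      using contour_integrable_holomorphic_simple[OF holomorphic_functional_cresolvent[OF \<psi>] open_Diff_cspectrum[OF open_UNIV] _ img] by simp
    then have i1: "((\<lambda>z. \<psi> (cresolvent T z)) has_contour_integral (2 * of_real pi * \<i> * \<psi> (riesz_integral T (\<lambda>_. 1) \<Gamma>))) (circlepath 0 r)"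
      using has_contour_integral_integral unfolding eq by fastforce
    have i2: "((\<lambda>z. \<psi> ?I / (z - 0)) has_contour_integral (2 * of_real pi * \<i> * \<psi> ?I)) (circlepath 0 r)"
      using Cauchy_integral_circlepath_simple[of "\<lambda>_. \<psi> ?I" 0 r 0] rpos by simp
    have "((\<lambda>z. \<psi> (cresolvent T z) - \<psi> ?I / (z - 0)) has_contour_integral (2 * of_real pi * \<i> * E)) (circlepath 0 r)"
      using has_contour_integral_diff[OF i1 i2] by (simp add: E_def algebra_simps)
    then have "norm (2 * of_real pi * \<i> * E) \<le> (4 * M * t / r\<^sup>2) * (2 * pi * r)"
    proof (rule has_contour_integral_bound_circlepath)
      fix z :: complex assume z: "norm (z - 0) = r"
      have zs: "z \<notin> cspectrum T" using sub z by auto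
      have znz: "z \<noteq> 0" using z rpos by auto
      have "z * \<psi> (cresolvent T z) = \<psi> ?I + \<psi> (complexify T o\<^sub>L cresolvent T z)"
        using arg_cong[OF cresolvent_expand[OF zs], of \<psi>] by (simp add: complex_functionalD[OF \<psi>])
      then have "\<psi> (cresolvent T z) - \<psi> ?I / (z - 0) = \<psi> (complexify T o\<^sub>L cresolvent T z) / z"
        using znz by (simp add: field_simps)
      moreover have "norm (\<psi> (complexify T o\<^sub>L cresolvent T z)) \<le> M * (t * (4 / r))"
      proof -
        have "norm (complexify T o\<^sub>L cresolvent T z) \<le> t * norm (cresolvent T z)"
          unfolding t_def by (rule norm_blinfun_compose)
        also have "\<dots> \<le> t * (4 / r)"
          using norm_cresolvent_le[of T z] z r t by (intro mult_left_mono) (auto simp: t_def)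
        finally show ?thesis using M by (meson mult_left_mono order_trans)
      qed
      ultimately show "norm (\<psi> (cresolvent T z) - \<psi> ?I / (z - 0)) \<le> 4 * M * t / r\<^sup>2"
        using z rpos by (simp add: norm_divide power2_eq_square field_simps)
    qed (use M t rpos in auto)
    then have "2 * pi * norm E \<le> 2 * pi * (4 * M * t / r)"
      using rpos by (simp add: norm_mult power2_eq_square field_simps)
    moreover have "2 * pi > 0" by simp
    ultimately show ?thesis by (simp only: mult_le_cancel_left_pos)
  qed
  have "norm E \<le> e" if e: "e > 0" for e
  proof -
    \<comment> \<open>Large enough both for the resolvent estimate, which needs
      \<open>r > 4 * t\<close>, and for the error \<open>4 * M * t / r\<close> to drop below
      \<open>e\<close>.\<close>
    define r where "r = 4 * t + 1 + 4 * M * t / e"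
    have nn: "4 * M * t / e \<ge> 0" using M t e by simp
    then have r: "r > 4 * t" "r > 0" "4 * M * t / e \<le> r" using t by (auto simp: r_def)
    then have "4 * M * t / r \<le> e" using e by (simp add: field_simps)
    then show ?thesis using bound[OF r(1)] by linarith
  qed
  then have "norm E \<le> 0" by (rule field_le_epsilon[of _ 0, simplified])
  then show "\<psi> (riesz_integral T (\<lambda>_. 1) \<Gamma>) = \<psi> ?I" by (simp add: E_def)
qed

text \<open>The point \<open>w\<close> is arbitrary: the lemma is applied to a point of the spectrum
  for one inclusion, and to points of \<open>\<Delta>\<close> off the spectrum in the construction
  of the inverse.\<close>

lemma riesz_integral_linear_factor:
  fixes T :: "'v::banach \<Rightarrow>\<^sub>L 'v"
  assumes \<Gamma>: "spectral_cycle (cspectrum T) U \<Gamma>" and U: "open U"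
    and f: "f holomorphic_on U" and q: "q holomorphic_on U"
    and eq: "\<And>z. z \<in> U \<Longrightarrow> f z = c + (z - w) * q z"
  shows "riesz_integral T f \<Gamma> = cscale c + ((complexify T - cscale w) o\<^sub>L riesz_integral T q \<Gamma>)"
proof (rule complex_functional_eqI)
  fix \<psi> :: "(('v \<times> 'v) \<Rightarrow>\<^sub>L ('v \<times> 'v)) \<Rightarrow> complex" assume \<psi>: "complex_functional \<psi>"
  let ?I = "id_blinfun :: ('v \<times> 'v) \<Rightarrow>\<^sub>L ('v \<times> 'v)"
  let ?A = "complexify T - cscale w"
  let ?k = "1 / (2 * of_real pi * \<i>)"
  have \<psi>A: "complex_functional (\<lambda>X. \<psi> (?A o\<^sub>L X))"
    by (intro complex_functional_compose_left[OF \<psi>] complex_linear_op_diff complex_linear_op_complexify complex_linear_op_cscale)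
  have h1: "(\<lambda>_. 1) holomorphic_on U" by (rule holomorphic_on_const)
  note hR = holomorphic_functional_cresolvent[OF \<psi>, of T U] and hA = holomorphic_functional_cresolvent[OF \<psi>A, of T U]
  have qU: "q holomorphic_on U - cspectrum T" using q by (rule holomorphic_on_subset) auto
  have sum: "contour_integral \<gamma> (\<lambda>z. f z * \<psi> (cresolvent T z))
      = c * contour_integral \<gamma> (\<lambda>z. 1 * \<psi> (cresolvent T z))
        + (contour_integral \<gamma> (\<lambda>z. q z * \<psi> (?A o\<^sub>L cresolvent T z)) + \<psi> ?I * contour_integral \<gamma> q)"
    if \<gamma>: "\<gamma> \<in> \<Gamma>" for \<gamma>
  proof -
    note g = spectral_cycleD(2,4)[OF \<Gamma> \<gamma>]
    have ci: "k contour_integrable_on \<gamma>" if "k holomorphic_on U - cspectrum T" for k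
      by (rule contour_integrable_holomorphic_simple[OF that open_Diff_cspectrum[OF U] g])
    have i1: "(\<lambda>z. 1 * \<psi> (cresolvent T z)) contour_integrable_on \<gamma>" using hR by (intro ci) simp
    have i2: "(\<lambda>z. q z * \<psi> (?A o\<^sub>L cresolvent T z)) contour_integrable_on \<gamma>"
      using hA qU by (intro ci holomorphic_intros)
    have i3: "q contour_integrable_on \<gamma>" using qU by (rule ci)
    have "contour_integral \<gamma> (\<lambda>z. f z * \<psi> (cresolvent T z))
        = contour_integral \<gamma> (\<lambda>z. c * (1 * \<psi> (cresolvent T z)) + (q z * \<psi> (?A o\<^sub>L cresolvent T z) + \<psi> ?I * q z))"
    proof (rule contour_integral_cong)
      fix z assume "z \<in> path_image \<gamma>"
      then have z: "z \<in> U" "z \<notin> cspectrum T" using g by auto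
      have "?A o\<^sub>L cresolvent T z = (cscale (z - w) o\<^sub>L cresolvent T z) - id_blinfun"
        using cresolvent_expand[OF z(2)] by (simp add: cscale_diff blinfun_compose_simps)
      then have "\<psi> (?A o\<^sub>L cresolvent T z) = (z - w) * \<psi> (cresolvent T z) - \<psi> ?I"
        by (simp add: complex_functionalD[OF \<psi>])
      then show "f z * \<psi> (cresolvent T z) = c * (1 * \<psi> (cresolvent T z)) + (q z * \<psi> (?A o\<^sub>L cresolvent T z) + \<psi> ?I * q z)"
        unfolding eq[OF z(1)] by (simp only:) (simp add: algebra_simps)
    qed simp
    also have "\<dots> = c * contour_integral \<gamma> (\<lambda>z. 1 * \<psi> (cresolvent T z))
        + (contour_integral \<gamma> (\<lambda>z. q z * \<psi> (?A o\<^sub>L cresolvent T z)) + \<psi> ?I * contour_integral \<gamma> q)"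
      using i1 i2 i3
      by (simp only: contour_integral_add contour_integral_lmul contour_integrable_lmul contour_integrable_add)
    finally show ?thesis .
  qed
  have "\<psi> (riesz_integral T f \<Gamma>) = ?k * (\<Sum>\<gamma>\<in>\<Gamma>. contour_integral \<gamma> (\<lambda>z. f z * \<psi> (cresolvent T z)))"
    by (rule complex_functional_riesz_integral[OF \<Gamma> U f \<psi>])
  also have "(\<Sum>\<gamma>\<in>\<Gamma>. contour_integral \<gamma> (\<lambda>z. f z * \<psi> (cresolvent T z)))
      = c * (\<Sum>\<gamma>\<in>\<Gamma>. contour_integral \<gamma> (\<lambda>z. 1 * \<psi> (cresolvent T z)))
        + ((\<Sum>\<gamma>\<in>\<Gamma>. contour_integral \<gamma> (\<lambda>z. q z * \<psi> (?A o\<^sub>L cresolvent T z))) + \<psi> ?I * (\<Sum>\<gamma>\<in>\<Gamma>. contour_integral \<gamma> q))"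
  proof -
    have "(\<Sum>\<gamma>\<in>\<Gamma>. contour_integral \<gamma> (\<lambda>z. f z * \<psi> (cresolvent T z)))
        = (\<Sum>\<gamma>\<in>\<Gamma>. c * contour_integral \<gamma> (\<lambda>z. 1 * \<psi> (cresolvent T z))
          + (contour_integral \<gamma> (\<lambda>z. q z * \<psi> (?A o\<^sub>L cresolvent T z)) + \<psi> ?I * contour_integral \<gamma> q))"
      by (rule sum.cong[OF refl sum])
    then show ?thesis by (simp only: sum.distrib sum_distrib_left)
  qed
  also have "(\<Sum>\<gamma>\<in>\<Gamma>. contour_integral \<gamma> q) = 0" by (rule spectral_cycle_integral_zero[OF \<Gamma> U q])
  finally have "\<psi> (riesz_integral T f \<Gamma>) = c * (?k * (\<Sum>\<gamma>\<in>\<Gamma>. contour_integral \<gamma> (\<lambda>z. 1 * \<psi> (cresolvent T z))))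
        + ?k * (\<Sum>\<gamma>\<in>\<Gamma>. contour_integral \<gamma> (\<lambda>z. q z * \<psi> (?A o\<^sub>L cresolvent T z)))"
    by (simp add: algebra_simps)
  also have "\<dots> = c * \<psi> (riesz_integral T (\<lambda>_. 1) \<Gamma>) + \<psi> (?A o\<^sub>L riesz_integral T q \<Gamma>)"
    by (simp only: complex_functional_riesz_integral[OF \<Gamma> U h1 \<psi>] complex_functional_riesz_integral[OF \<Gamma> U q \<psi>A])
  also have "\<dots> = \<psi> (cscale c + (?A o\<^sub>L riesz_integral T q \<Gamma>))"
    using complex_functionalD(2)[OF \<psi>, of c ?I] by (simp add: riesz_integral_one[OF \<Gamma>] complex_functionalD(3)[OF \<psi>])
  finally show "\<psi> (riesz_integral T f \<Gamma>) = \<psi> (cscale c + (?A o\<^sub>L riesz_integral T q \<Gamma>))" .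
qed

section \<open>The two inclusions of the spectral mapping theorem\<close>

lemma spectral_mapping_subset:
  assumes \<Gamma>: "spectral_cycle (cspectrum T) U \<Gamma>" and U: "open U" "cspectrum T \<subseteq> U" and f: "f holomorphic_on U"
    and S: "complexify S = riesz_integral T f \<Gamma>"
  shows "f ` cspectrum T \<subseteq> cspectrum S"
proof
  fix \<mu> assume "\<mu> \<in> f ` cspectrum T"
  then obtain w where w: "w \<in> cspectrum T" "\<mu> = f w" by blast
  define q where "q z = (if z = w then deriv f w else (f z - f w) / (z - w))" for z
  have q: "q holomorphic_on U" unfolding q_def by (rule pole_lemma_open[OF f U(1)])
  let ?Q = "riesz_integral T q \<Gamma>"
  have "riesz_integral T f \<Gamma> = cscale \<mu> + ((complexify T - cscale w) o\<^sub>L ?Q)"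
    by (rule riesz_integral_linear_factor[OF \<Gamma> U(1) f q]) (simp add: q_def w)
  then have eq: "cscale \<mu> - complexify S = (cscale w - complexify T) o\<^sub>L ?Q"
    by (simp add: S blinfun_compose_simps)
  have comm: "(cscale w - complexify T) o\<^sub>L ?Q = ?Q o\<^sub>L (cscale w - complexify T)"
    by (rule riesz_integral_commute[OF \<Gamma> U(1) q])
      (auto intro: complex_linear_op_diff complex_linear_op_cscale complex_linear_op_complexify
        simp: blinfun_compose_simps complexify_commute_cscale)
  show "\<mu> \<in> cspectrum S"
  proof (rule ccontr)
    assume "\<mu> \<notin> cspectrum S"
    then obtain B where "op_inverse_of (cscale \<mu> - complexify S) B" by (auto simp: cspectrum_def)
    then have "\<exists>D. op_inverse_of (cscale w - complexify T) D"
      unfolding eq by (rule op_invertible_factor[OF _ comm])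
    then show False using w(1) by (simp add: cspectrum_def)
  qed
qed

text \<open>Differentiation under the integral sign, with first derivative given by the squared
  kernel. The bound on the speed that the constructed contours carry is consumed here.\<close>

lemma Cauchy_type_integral_holomorphic:
  assumes \<gamma>: "valid_path \<gamma>" "bounded_speed \<gamma>" and V: "open V" "path_image \<gamma> \<subseteq> V" and k: "k holomorphic_on V"
  shows "(\<lambda>w. contour_integral \<gamma> (\<lambda>z. k z / (z - w))) holomorphic_on - path_image \<gamma>"
proof (rule holomorphic_onI)
  fix w assume w: "w \<in> - path_image \<gamma>"
  obtain B where B: "\<And>t. t \<in> {0..1} \<Longrightarrow> norm (vector_derivative \<gamma> (at t)) \<le> B"
    using bounded_speed_vector_derivative[OF \<gamma>(2)] by blast
  have "((\<lambda>w. contour_integral \<gamma> (\<lambda>z. k z / (z - w))) has_field_derivative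
      (of_nat 1 * contour_integral \<gamma> (\<lambda>z. k z / (z - w) ^ Suc 1))) (at w)"
  proof (rule Cauchy_next_derivative(2)[where S = UNIV and B = B])
    show "continuous_on (path_image \<gamma>) k"
      using k V(2) holomorphic_on_imp_continuous_on continuous_on_subset by blast
    fix u assume u: "u \<in> UNIV - path_image \<gamma>"
    have "(\<lambda>z. k z / (z - u)) holomorphic_on V - {u}"
      using holomorphic_on_subset[OF k] by (intro holomorphic_intros) auto
    then have "(\<lambda>z. k z / (z - u)) contour_integrable_on \<gamma>"
      by (rule contour_integrable_holomorphic_simple) (use V \<gamma> u in auto)
    then show "((\<lambda>z. k z / (z - u) ^ 1) has_contour_integral contour_integral \<gamma> (\<lambda>z. k z / (z - u))) \<gamma>"
      by (simp add: has_contour_integral_integral)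
  qed (use w B \<gamma> in auto)
  then show "(\<lambda>w. contour_integral \<gamma> (\<lambda>z. k z / (z - w))) field_differentiable at w within - path_image \<gamma>"
    using field_differentiable_at_within field_differentiable_def by blast
qed

text \<open>
  The integrand of \<open>h(T) (1/h)(T) - I\<close> is \<open>(1/h)(w) (h(T) - h(w)) R(w)\<close>. Away from the spectrum
  \<open>(h(T) - h(w)) R(w) = - q\<^sub>w(T)\<close> with \<open>q\<^sub>w(z) = (h(z) - h(w)) / (z - w)\<close>, and the right-hand
  side is holomorphic in \<open>w\<close> on \<open>\<Delta>\<close>; so the integrand extends holomorphically across the spectrum
  and its integral vanishes by Cauchy's theorem, without a double contour integral.
\<close>

lemma riesz_integral_inverse:
  fixes T :: "'v::banach \<Rightarrow>\<^sub>L 'v"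
  assumes sd: "smooth_domain \<Delta> \<Gamma>" and sub: "cspectrum T \<subseteq> \<Delta>" "closure \<Delta> \<subseteq> U"
    and U: "open U" and h: "h holomorphic_on U" and nz: "\<And>z. z \<in> U \<Longrightarrow> h z \<noteq> 0"
  shows "riesz_integral T h \<Gamma> o\<^sub>L riesz_integral T (\<lambda>z. 1 / h z) \<Gamma> = id_blinfun"
proof (rule complex_functional_eqI)
  fix \<psi> :: "(('v \<times> 'v) \<Rightarrow>\<^sub>L ('v \<times> 'v)) \<Rightarrow> complex" assume \<psi>: "complex_functional \<psi>"
  let ?\<sigma> = "cspectrum T" and ?k = "1 / (2 * of_real pi * \<i>)"
  have \<Delta>: "open \<Delta>" "bounded \<Delta>" and pob: "positively_oriented_boundary \<Delta> \<Gamma>"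
    using sd by (auto simp: smooth_domain_def)
  have speed: "bounded_speed \<gamma>" if "\<gamma> \<in> \<Gamma>" for \<gamma> using sd that by (auto simp: smooth_domain_def)
  have \<Gamma>: "spectral_cycle ?\<sigma> U \<Gamma>"
    using \<Delta> pob sub by (intro spectral_cycle_admissible) (auto simp: admissible_contour_def)
  have img: "path_image \<gamma> \<inter> \<Delta> = {}" if "\<gamma> \<in> \<Gamma>" for \<gamma>
    using pob that \<Delta>(1) by (auto simp: positively_oriented_boundary_def frontier_def interior_open)
  have \<Delta>U: "\<Delta> \<subseteq> U" using sub(2) closure_subset by blast
  define H where "H = riesz_integral T h \<Gamma>"
  have Hlin: "complex_linear_op H" unfolding H_def by (rule complex_linear_op_riesz_integral[OF \<Gamma> U h])
  have g: "(\<lambda>z. 1 / h z) holomorphic_on U" using h nz by (intro holomorphic_intros) auto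
  define \<kappa> where "\<kappa> z = \<psi> (cresolvent T z)" for z
  have \<kappa>: "\<kappa> holomorphic_on U - ?\<sigma>" unfolding \<kappa>_def by (rule holomorphic_functional_cresolvent[OF \<psi>])
  have hU: "h holomorphic_on U - ?\<sigma>" using h by (rule holomorphic_on_subset) auto
  \<comment> \<open>For \<open>w\<close> in \<open>\<Delta>\<close>, the functional
    \<open>\<psi>\<close> takes the value \<open>c w - h w * d w\<close> on the Riesz integral of
    the divided difference of \<open>h\<close> at \<open>w\<close>. Unlike the resolvent,
    \<open>c\<close> and \<open>d\<close> make sense and are holomorphic at points of the
    spectrum.\<close>
  define c where "c w = ?k * (\<Sum>\<gamma>\<in>\<Gamma>. contour_integral \<gamma> (\<lambda>z. h z * \<kappa> z / (z - w)))" for w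
  define d where "d w = ?k * (\<Sum>\<gamma>\<in>\<Gamma>. contour_integral \<gamma> (\<lambda>z. \<kappa> z / (z - w)))" for w
  have cauchy: "(\<lambda>w. contour_integral \<gamma> (\<lambda>z. l z / (z - w))) holomorphic_on \<Delta>"
    if "\<gamma> \<in> \<Gamma>" "l holomorphic_on U - ?\<sigma>" for \<gamma> l
    using Cauchy_type_integral_holomorphic[OF spectral_cycleD(2)[OF \<Gamma> that(1)] speed[OF that(1)]
        open_Diff_cspectrum[OF U] spectral_cycleD(4)[OF \<Gamma> that(1)] that(2)]
    by (rule holomorphic_on_subset) (use img[OF that(1)] in blast)
  have cd: "c holomorphic_on \<Delta>" "d holomorphic_on \<Delta>"
    unfolding c_def d_def
    by (intro holomorphic_on_mult holomorphic_on_const holomorphic_on_sum cauchy hU \<kappa>; assumption)+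
  \<comment> \<open>The second branch is the integrand, the first its continuation across the
    spectrum; \<open>Kout\<close> shows that they agree on the overlap.\<close>
  define K where "K w = (if w \<in> \<Delta> then h w * d w - c w else \<psi> ((H - cscale (h w)) o\<^sub>L cresolvent T w))" for w
  have Kout: "K w = \<psi> ((H - cscale (h w)) o\<^sub>L cresolvent T w)" if w: "w \<in> U - ?\<sigma>" for w
  proof (cases "w \<in> \<Delta>")
    case True
    define q where "q z = (if z = w then deriv h w else (h z - h w) / (z - w))" for z
    have q: "q holomorphic_on U" unfolding q_def by (rule pole_lemma_open[OF h U])
    let ?Q = "riesz_integral T q \<Gamma>"
    have "H = cscale (h w) + ((complexify T - cscale w) o\<^sub>L ?Q)"
      unfolding H_def by (rule riesz_integral_linear_factor[OF \<Gamma> U h q]) (simp add: q_def)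
    moreover have "(complexify T - cscale w) o\<^sub>L ?Q = ?Q o\<^sub>L (complexify T - cscale w)"
      by (rule riesz_integral_commute[OF \<Gamma> U q])
        (auto intro: complex_linear_op_diff complex_linear_op_cscale complex_linear_op_complexify
          simp: blinfun_compose_simps complexify_commute_cscale)
    ultimately have "H - cscale (h w) = - (?Q o\<^sub>L (cscale w - complexify T))"
      by (simp add: blinfun_compose_simps)
    then have "(H - cscale (h w)) o\<^sub>L cresolvent T w = - (?Q o\<^sub>L ((cscale w - complexify T) o\<^sub>L cresolvent T w))"
      by (simp only: blinfun_compose_simps blinfun_compose_assoc)
    also have "(cscale w - complexify T) o\<^sub>L cresolvent T w = id_blinfun"
      using cresolvent_inverse[of w T] w by (simp add: op_inverse_of_def)
    finally have eq: "(H - cscale (h w)) o\<^sub>L cresolvent T w = - ?Q" by simp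
    have "contour_integral \<gamma> (\<lambda>z. q z * \<psi> (cresolvent T z))
        = contour_integral \<gamma> (\<lambda>z. h z * \<kappa> z / (z - w)) - h w * contour_integral \<gamma> (\<lambda>z. \<kappa> z / (z - w))"
      if \<gamma>: "\<gamma> \<in> \<Gamma>" for \<gamma>
    proof -
      note sc = spectral_cycleD(2,4)[OF \<Gamma> \<gamma>]
      have wi: "w \<notin> path_image \<gamma>" using img[OF \<gamma>] True by blast
      have ci: "(\<lambda>z. l z / (z - w)) contour_integrable_on \<gamma>" if l: "l holomorphic_on U - ?\<sigma>" for l
      proof (rule contour_integrable_holomorphic_simple)
        show "(\<lambda>z. l z / (z - w)) holomorphic_on U - ?\<sigma> - {w}"
          using holomorphic_on_subset[OF l] by (intro holomorphic_intros) auto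
        show "open (U - ?\<sigma> - {w})" using open_Diff_cspectrum[OF U] by (rule open_delete)
      qed (use sc wi in auto)
      have i1: "(\<lambda>z. h z * \<kappa> z / (z - w)) contour_integrable_on \<gamma>" using hU \<kappa> by (intro ci holomorphic_intros)
      have i2: "(\<lambda>z. \<kappa> z / (z - w)) contour_integrable_on \<gamma>" by (rule ci[OF \<kappa>])
      have "contour_integral \<gamma> (\<lambda>z. q z * \<psi> (cresolvent T z))
          = contour_integral \<gamma> (\<lambda>z. h z * \<kappa> z / (z - w) - h w * (\<kappa> z / (z - w)))"
      proof (rule contour_integral_cong)
        fix z assume "z \<in> path_image \<gamma>"
        then have "z \<noteq> w" using wi by auto
        then show "q z * \<psi> (cresolvent T z) = h z * \<kappa> z / (z - w) - h w * (\<kappa> z / (z - w))"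
          by (simp add: q_def \<kappa>_def diff_divide_distrib left_diff_distrib)
      qed simp
      also have "\<dots> = contour_integral \<gamma> (\<lambda>z. h z * \<kappa> z / (z - w)) - h w * contour_integral \<gamma> (\<lambda>z. \<kappa> z / (z - w))"
        using i1 i2 by (simp only: contour_integral_diff contour_integral_lmul contour_integrable_lmul)
      finally show ?thesis .
    qed
    then have "(\<Sum>\<gamma>\<in>\<Gamma>. contour_integral \<gamma> (\<lambda>z. q z * \<psi> (cresolvent T z)))
        = (\<Sum>\<gamma>\<in>\<Gamma>. contour_integral \<gamma> (\<lambda>z. h z * \<kappa> z / (z - w)) - h w * contour_integral \<gamma> (\<lambda>z. \<kappa> z / (z - w)))"
      by (intro sum.cong) auto
    then have "\<psi> ?Q = c w - h w * d w"
      unfolding complex_functional_riesz_integral[OF \<Gamma> U q \<psi>] c_def d_def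
      by (simp add: sum_subtractf sum_distrib_left[symmetric] right_diff_distrib)
    then show ?thesis using True by (simp add: K_def eq complex_functionalD(5)[OF \<psi>])
  next
    case False
    then show ?thesis by (simp add: K_def)
  qed
  have "K holomorphic_on \<Delta> \<union> (U - ?\<sigma>)"
  proof (rule holomorphic_on_Un)
    have "(\<lambda>w. h w * d w - c w) holomorphic_on \<Delta>"
      using cd holomorphic_on_subset[OF h \<Delta>U] by (intro holomorphic_intros)
    then show "K holomorphic_on \<Delta>" by (rule holomorphic_transform) (simp add: K_def)
    have "(\<lambda>w. \<psi> (H o\<^sub>L cresolvent T w) - h w * \<kappa> w) holomorphic_on U - ?\<sigma>"
      using holomorphic_functional_cresolvent[OF complex_functional_compose_left[OF \<psi> Hlin]] hU \<kappa>
      by (intro holomorphic_intros)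
    then show "K holomorphic_on U - ?\<sigma>"
      by (rule holomorphic_transform)
        (simp add: Kout \<kappa>_def blinfun_compose_simps complex_functionalD[OF \<psi>])
  qed (use \<Delta>(1) open_Diff_cspectrum[OF U] in auto)
  moreover have "\<Delta> \<union> (U - ?\<sigma>) = U" using \<Delta>U sub(1) by blast
  ultimately have "(\<lambda>w. 1 / h w * K w) holomorphic_on U" using g by (intro holomorphic_on_mult) auto
  then have zero: "(\<Sum>\<gamma>\<in>\<Gamma>. contour_integral \<gamma> (\<lambda>w. 1 / h w * K w)) = 0"
    by (rule spectral_cycle_integral_zero[OF \<Gamma> U])
  have "contour_integral \<gamma> (\<lambda>w. 1 / h w * K w)
      = contour_integral \<gamma> (\<lambda>w. 1 / h w * \<psi> (H o\<^sub>L cresolvent T w)) - contour_integral \<gamma> (\<lambda>w. 1 * \<psi> (cresolvent T w))"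
    if \<gamma>: "\<gamma> \<in> \<Gamma>" for \<gamma>
  proof -
    note sc = spectral_cycleD(2,4)[OF \<Gamma> \<gamma>]
    have ci: "l contour_integrable_on \<gamma>" if "l holomorphic_on U - ?\<sigma>" for l
      by (rule contour_integrable_holomorphic_simple[OF that open_Diff_cspectrum[OF U] sc])
    have gU: "(\<lambda>z. 1 / h z) holomorphic_on U - ?\<sigma>" using g by (rule holomorphic_on_subset) auto
    have i1: "(\<lambda>w. 1 / h w * \<psi> (H o\<^sub>L cresolvent T w)) contour_integrable_on \<gamma>"
      using holomorphic_on_mult[OF gU holomorphic_functional_cresolvent[OF complex_functional_compose_left[OF \<psi> Hlin]]]
      by (rule ci)
    have i2: "(\<lambda>w. 1 * \<psi> (cresolvent T w)) contour_integrable_on \<gamma>"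
      using holomorphic_functional_cresolvent[OF \<psi>] by (intro ci) simp
    have "contour_integral \<gamma> (\<lambda>w. 1 / h w * K w)
        = contour_integral \<gamma> (\<lambda>w. 1 / h w * \<psi> (H o\<^sub>L cresolvent T w) - 1 * \<psi> (cresolvent T w))"
    \<comment> \<open>On the contour \<open>K\<close> is the genuine integrand, and its term with
      \<open>h w\<close> is cancelled by the factor \<open>1 / h w\<close>.\<close>
    proof (rule contour_integral_cong)
      fix w assume "w \<in> path_image \<gamma>"
      then have w: "w \<in> U - ?\<sigma>" using sc by blast
      then have "h w \<noteq> 0" using nz by blast
      then show "1 / h w * K w = 1 / h w * \<psi> (H o\<^sub>L cresolvent T w) - 1 * \<psi> (cresolvent T w)"
        by (simp add: Kout[OF w] blinfun_compose_simps complex_functionalD[OF \<psi>] field_simps)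
    qed simp
    then show ?thesis using contour_integral_diff[OF i1 i2] by simp
  qed
  then have "(\<Sum>\<gamma>\<in>\<Gamma>. contour_integral \<gamma> (\<lambda>w. 1 / h w * K w))
      = (\<Sum>\<gamma>\<in>\<Gamma>. contour_integral \<gamma> (\<lambda>w. 1 / h w * \<psi> (H o\<^sub>L cresolvent T w)) - contour_integral \<gamma> (\<lambda>w. 1 * \<psi> (cresolvent T w)))"
    by (intro sum.cong) auto
  then have eq: "(\<Sum>\<gamma>\<in>\<Gamma>. contour_integral \<gamma> (\<lambda>w. 1 / h w * \<psi> (H o\<^sub>L cresolvent T w)))
      = (\<Sum>\<gamma>\<in>\<Gamma>. contour_integral \<gamma> (\<lambda>w. 1 * \<psi> (cresolvent T w)))"
    using zero by (simp only: sum_subtractf) simp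
  have "\<psi> (H o\<^sub>L riesz_integral T (\<lambda>z. 1 / h z) \<Gamma>) = ?k * (\<Sum>\<gamma>\<in>\<Gamma>. contour_integral \<gamma> (\<lambda>w. 1 / h w * \<psi> (H o\<^sub>L cresolvent T w)))"
    by (rule complex_functional_riesz_integral[OF \<Gamma> U g complex_functional_compose_left[OF \<psi> Hlin]])
  also have "\<dots> = \<psi> (riesz_integral T (\<lambda>_. 1) \<Gamma>)"
    unfolding eq by (rule complex_functional_riesz_integral[OF \<Gamma> U holomorphic_on_const \<psi>, symmetric])
  finally show "\<psi> (riesz_integral T h \<Gamma> o\<^sub>L riesz_integral T (\<lambda>z. 1 / h z) \<Gamma>) = \<psi> id_blinfun"
    by (simp add: H_def riesz_integral_one[OF \<Gamma>])
qed

lemma spectral_mapping_superset: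
  fixes T :: "'v::banach \<Rightarrow>\<^sub>L 'v"
  assumes \<Gamma>: "spectral_cycle (cspectrum T) U \<Gamma>" and U: "open U" "cspectrum T \<subseteq> U" and f: "f holomorphic_on U"
    and S: "complexify S = riesz_integral T f \<Gamma>"
  shows "cspectrum S \<subseteq> f ` cspectrum T"
proof
  fix \<mu> assume \<mu>: "\<mu> \<in> cspectrum S"
  show "\<mu> \<in> f ` cspectrum T"
  proof (rule ccontr)
    assume not: "\<mu> \<notin> f ` cspectrum T"
    \<comment> \<open>\<open>V\<close> drops the zeros of \<open>f - \<mu>\<close> from
      \<open>U\<close> but keeps the spectrum, so \<open>1 / h\<close> is holomorphic on it. The
      given cycle may leave \<open>V\<close> or have unbounded speed, hence a new contour inside
      \<open>V\<close>.\<close>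
    define V where "V = U \<inter> f -` (- {\<mu>})"
    have V: "open V" unfolding V_def
      by (rule continuous_open_preimage[OF holomorphic_on_imp_continuous_on[OF f] U(1)]) (simp add: open_Compl)
    have VU: "V \<subseteq> U" and \<sigma>V: "cspectrum T \<subseteq> V" using not U(2) by (auto simp: V_def)
    obtain \<Delta> \<Theta> where \<Delta>: "smooth_domain \<Delta> \<Theta>" "cspectrum T \<subseteq> \<Delta>" "closure \<Delta> \<subseteq> V"
      using smooth_domain_between[OF V compact_cspectrum \<sigma>V] by blast
    have \<Theta>: "spectral_cycle (cspectrum T) V \<Theta>"
      using \<Delta> by (intro spectral_cycle_admissible[of _ _ \<Delta>]) (auto simp: admissible_contour_def smooth_domain_def)
    have fV: "f holomorphic_on V" using f VU by (rule holomorphic_on_subset)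
    define h where "h z = f z - \<mu>" for z
    have h: "h holomorphic_on V" unfolding h_def using fV by (intro holomorphic_intros)
    have nz: "h z \<noteq> 0" if "z \<in> V" for z using that by (auto simp: h_def V_def)
    have g: "(\<lambda>z. 1 / h z) holomorphic_on V" using h nz by (intro holomorphic_intros) auto
    let ?H = "riesz_integral T h \<Theta>" and ?G = "riesz_integral T (\<lambda>z. 1 / h z) \<Theta>"
    have HG: "?H o\<^sub>L ?G = id_blinfun"
      by (rule riesz_integral_inverse[OF \<Delta> V h nz])
    have "?H o\<^sub>L ?G = ?G o\<^sub>L ?H"
      by (rule riesz_integral_commute[OF \<Theta> V g complex_linear_op_riesz_integral[OF \<Theta> V h]])
        (rule riesz_integral_commute[OF \<Theta> V h complex_linear_op_complexify refl, symmetric])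
    \<comment> \<open>The signs match the convention \<open>\<mu> - S\<close> in
      \<open>cspectrum\<close>, which is minus \<open>?H\<close>.\<close>
    then have inv: "op_inverse_of (- ?H) (- ?G)" using HG by (simp add: op_inverse_of_def blinfun_compose_simps)
    have "riesz_integral T f \<Theta> = cscale \<mu> + ?H"
    proof (rule complex_functional_eqI)
      fix \<psi> :: "(('v \<times> 'v) \<Rightarrow>\<^sub>L ('v \<times> 'v)) \<Rightarrow> complex" assume \<psi>: "complex_functional \<psi>"
      have sum: "contour_integral \<gamma> (\<lambda>z. f z * \<psi> (cresolvent T z)) = \<mu> * contour_integral \<gamma> (\<lambda>z. 1 * \<psi> (cresolvent T z)) + contour_integral \<gamma> (\<lambda>z. h z * \<psi> (cresolvent T z))"
        if \<gamma>: "\<gamma> \<in> \<Theta>" for \<gamma>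
      proof -
        note sc = spectral_cycleD(2,4)[OF \<Theta> \<gamma>]
        have ci: "(\<lambda>z. l z * \<psi> (cresolvent T z)) contour_integrable_on \<gamma>" if l: "l holomorphic_on V" for l
        proof (rule contour_integrable_holomorphic_simple[OF _ open_Diff_cspectrum[OF V] sc])
          show "(\<lambda>z. l z * \<psi> (cresolvent T z)) holomorphic_on V - cspectrum T"
            using holomorphic_on_subset[OF l, of "V - cspectrum T"] holomorphic_functional_cresolvent[OF \<psi>]
            by (intro holomorphic_on_mult) auto
        qed
        have i1: "(\<lambda>z. 1 * \<psi> (cresolvent T z)) contour_integrable_on \<gamma>" by (rule ci) (rule holomorphic_on_const)
        have "contour_integral \<gamma> (\<lambda>z. f z * \<psi> (cresolvent T z)) = contour_integral \<gamma> (\<lambda>z. \<mu> * (1 * \<psi> (cresolvent T z)) + h z * \<psi> (cresolvent T z))"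
          by (rule contour_integral_cong) (simp_all add: h_def algebra_simps)
        also have "\<dots> = \<mu> * contour_integral \<gamma> (\<lambda>z. 1 * \<psi> (cresolvent T z)) + contour_integral \<gamma> (\<lambda>z. h z * \<psi> (cresolvent T z))"
          using i1 ci[OF h] by (simp only: contour_integral_add contour_integral_lmul contour_integrable_lmul)
        finally show ?thesis .
      qed
      have "(\<Sum>\<gamma>\<in>\<Theta>. contour_integral \<gamma> (\<lambda>z. f z * \<psi> (cresolvent T z)))
          = (\<Sum>\<gamma>\<in>\<Theta>. \<mu> * contour_integral \<gamma> (\<lambda>z. 1 * \<psi> (cresolvent T z)) + contour_integral \<gamma> (\<lambda>z. h z * \<psi> (cresolvent T z)))"
        by (rule sum.cong[OF refl sum])
      then have "\<psi> (riesz_integral T f \<Theta>) = \<mu> * \<psi> (riesz_integral T (\<lambda>_. 1) \<Theta>) + \<psi> ?H"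
        unfolding complex_functional_riesz_integral[OF \<Theta> V fV \<psi>] complex_functional_riesz_integral[OF \<Theta> V h \<psi>]
          complex_functional_riesz_integral[OF \<Theta> V holomorphic_on_const \<psi>]
        by (simp add: sum.distrib sum_distrib_left[symmetric] algebra_simps add_divide_distrib)
      then show "\<psi> (riesz_integral T f \<Theta>) = \<psi> (cscale \<mu> + ?H)"
        using complex_functionalD(2)[OF \<psi>, of \<mu> id_blinfun]
        by (simp add: riesz_integral_one[OF \<Theta>] complex_functionalD(3)[OF \<psi>])
    qed
    \<comment> \<open>\<open>f\<close> itself is holomorphic on all of \<open>U\<close>, so there
      the two cycles may be exchanged although \<open>1 / h\<close> lives only on
      \<open>V\<close>.\<close>
    moreover have "riesz_integral T f \<Gamma> = riesz_integral T f \<Theta>"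
      by (rule riesz_integral_cycle_independent[OF \<Gamma> spectral_cycle_mono[OF \<Theta> VU] U(1) f])
    ultimately have "cscale \<mu> - complexify S = - ?H" by (simp add: S)
    then show False using inv \<mu> by (auto simp: cspectrum_def)
  qed
qed

section \<open>Conjugation and descent to the real space\<close>

definition cconj :: "('v::banach \<times> 'v) \<Rightarrow>\<^sub>L ('v \<times> 'v)" where
  "cconj = Blinfun (\<lambda>z. (fst z, - snd z))"

lemma cconj_apply: "cconj z = (fst z, - snd z)"
  unfolding cconj_def
  by (subst bounded_linear_Blinfun_apply)
    (intro bounded_linear_Pair bounded_linear_fst bounded_linear_minus bounded_linear_snd refl)+

lemma cconj_cconj: "cconj o\<^sub>L cconj = id_blinfun"
  by (rule blinfun_eqI) (simp add: cconj_apply)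

lemma cconj_cscale: "cconj o\<^sub>L cscale c = cscale (cnj c) o\<^sub>L cconj"
  by (rule blinfun_eqI) (simp add: cconj_apply cscale_apply)

lemma cconj_complexify: "cconj o\<^sub>L complexify T = complexify T o\<^sub>L cconj"
  by (rule blinfun_eqI) (simp add: cconj_apply complexify_apply blinfun.bilinear_simps)

lemma op_inverse_of_cnj:
  assumes "op_inverse_of (cscale \<zeta> - complexify T) B"
  shows "op_inverse_of (cscale (cnj \<zeta>) - complexify T) (cconj o\<^sub>L B o\<^sub>L cconj)"
proof -
  have c: "op_inverse_of cconj cconj" by (simp add: op_inverse_of_def cconj_cconj)
  have "cconj o\<^sub>L (cscale \<zeta> - complexify T) o\<^sub>L cconj = (cscale (cnj \<zeta>) - complexify T) o\<^sub>L (cconj o\<^sub>L cconj)"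
    by (simp only: blinfun_compose_simps cconj_cscale cconj_complexify blinfun_compose_assoc)
  then have "cconj o\<^sub>L (cscale \<zeta> - complexify T) o\<^sub>L cconj = cscale (cnj \<zeta>) - complexify T"
    by (simp add: cconj_cconj)
  then show ?thesis
    using op_inverse_of_compose[OF op_inverse_of_compose[OF c assms] c] by (simp add: blinfun_compose_assoc)
qed

lemma cresolvent_cnj:
  assumes "\<zeta> \<notin> cspectrum T"
  shows "cnj \<zeta> \<notin> cspectrum T" "cresolvent T (cnj \<zeta>) = cconj o\<^sub>L cresolvent T \<zeta> o\<^sub>L cconj"
  using cresolvent_eqI[OF op_inverse_of_cnj[OF cresolvent_inverse[OF assms]]] by auto

text \<open>Conjugating a functional on both sides gives a complex functional
  \<open>\<psi>'\<close>, and turns integration along \<open>\<gamma>\<close> into integration along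
  \<open>cnj \<circ> \<gamma>\<close>. Reflection reverses orientation, so the reflected cycle is
  homologous to minus \<open>\<Gamma>\<close> in \<open>U\<close> minus the spectrum.\<close>

lemma riesz_integral_cconj:
  fixes T :: "'v::banach \<Rightarrow>\<^sub>L 'v"
  assumes \<Gamma>: "spectral_cycle (cspectrum T) U \<Gamma>" and U: "open U" "\<And>z. z \<in> U \<Longrightarrow> cnj z \<in> U"
    and f: "f holomorphic_on U" "\<And>z. z \<in> U \<Longrightarrow> f (cnj z) = cnj (f z)"
  shows "cconj o\<^sub>L riesz_integral T f \<Gamma> o\<^sub>L cconj = riesz_integral T f \<Gamma>"
proof (rule complex_functional_eqI)
  fix \<psi> :: "(('v \<times> 'v) \<Rightarrow>\<^sub>L ('v \<times> 'v)) \<Rightarrow> complex" assume \<psi>: "complex_functional \<psi>"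
  let ?\<sigma> = "cspectrum T" and ?k = "1 / (2 * of_real pi * \<i>)"
  define \<psi>' where "\<psi>' X = cnj (\<psi> (cconj o\<^sub>L X o\<^sub>L cconj))" for X
  have \<psi>': "complex_functional \<psi>'"
    unfolding complex_functional_def
  proof (intro conjI allI)
    have "bounded_linear (\<lambda>X. cconj o\<^sub>L X o\<^sub>L cconj)"
      by (rule bounded_linear_compose[OF bounded_linear_blinfun_compose_left bounded_linear_blinfun_compose_right])
    then show "bounded_linear \<psi>'"
      unfolding \<psi>'_def
      by (intro bounded_linear_compose[OF bounded_linear_cnj] bounded_linear_compose[OF complex_functionalD(1)[OF \<psi>]])
    fix c and X :: "('v \<times> 'v) \<Rightarrow>\<^sub>L ('v \<times> 'v)"
    have "cconj o\<^sub>L (cscale c o\<^sub>L X) o\<^sub>L cconj = cscale (cnj c) o\<^sub>L (cconj o\<^sub>L X o\<^sub>L cconj)"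
      by (simp only: blinfun_compose_assoc[symmetric] cconj_cscale)
    then show "\<psi>' (cscale c o\<^sub>L X) = c * \<psi>' X" by (simp add: \<psi>'_def complex_functionalD(2)[OF \<psi>])
  qed
  define k where "k z = f z * \<psi> (cresolvent T z)" for z
  have k: "k holomorphic_on U - ?\<sigma>"
    unfolding k_def using holomorphic_on_subset[OF f(1), of "U - ?\<sigma>"] holomorphic_functional_cresolvent[OF \<psi>]
    by (intro holomorphic_on_mult) auto
  have sym: "cnj z \<in> U - ?\<sigma>" if "z \<in> U - ?\<sigma>" for z using that U(2) cresolvent_cnj(1) by blast
  note sc = spectral_cycleD[OF \<Gamma>]
  have img: "path_image (cnj \<circ> \<gamma>) \<subseteq> U - ?\<sigma>" if "\<gamma> \<in> \<Gamma>" for \<gamma>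
    using sc(4)[OF that] sym by (auto simp: path_image_compose)
  have conj: "cnj (contour_integral \<gamma> (\<lambda>z. f z * \<psi>' (cresolvent T z))) = contour_integral (cnj \<circ> \<gamma>) k"
    if \<gamma>: "\<gamma> \<in> \<Gamma>" for \<gamma>
  proof -
    have "contour_integral \<gamma> (\<lambda>z. f z * \<psi>' (cresolvent T z)) = contour_integral \<gamma> (cnj \<circ> k \<circ> cnj)"
    proof (rule contour_integral_cong)
      fix z assume "z \<in> path_image \<gamma>"
      then have z: "z \<in> U" "z \<notin> ?\<sigma>" using sc(4)[OF \<gamma>] by auto
      then show "f z * \<psi>' (cresolvent T z) = (cnj \<circ> k \<circ> cnj) z"
        by (simp add: k_def \<psi>'_def f(2) cresolvent_cnj(2))
    qed simp
    then show ?thesis using contour_integral_cnj[OF sc(2)[OF \<gamma>], of k] by simp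
  qed
  have "(\<Sum>i\<in>\<Gamma> <+> \<Gamma>. contour_integral (case_sum (\<lambda>\<gamma>. \<gamma>) (\<lambda>\<gamma>. cnj \<circ> \<gamma>) i) k) = 0"
  proof (rule Cauchy_theorem_homology[OF open_Diff_cspectrum[OF U(1)] k])
    show "finite (\<Gamma> <+> \<Gamma>)" using sc(1) by simp
    show "valid_path (case_sum (\<lambda>\<gamma>. \<gamma>) (\<lambda>\<gamma>. cnj \<circ> \<gamma>) i) \<and>
        pathfinish (case_sum (\<lambda>\<gamma>. \<gamma>) (\<lambda>\<gamma>. cnj \<circ> \<gamma>) i) = pathstart (case_sum (\<lambda>\<gamma>. \<gamma>) (\<lambda>\<gamma>. cnj \<circ> \<gamma>) i) \<and>
        path_image (case_sum (\<lambda>\<gamma>. \<gamma>) (\<lambda>\<gamma>. cnj \<circ> \<gamma>) i) \<subseteq> U - ?\<sigma>" if "i \<in> \<Gamma> <+> \<Gamma>" for i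
    proof -
      from that consider \<gamma> where "\<gamma> \<in> \<Gamma>" "i = Inl \<gamma>" | \<gamma> where "\<gamma> \<in> \<Gamma>" "i = Inr \<gamma>" by blast
      then show ?thesis
      proof cases
        case (1 \<gamma>)
        then show ?thesis using sc(2,3,4)[of \<gamma>] by simp
      next
        case (2 \<gamma>)
        then show ?thesis using sc(2,3)[of \<gamma>] img[of \<gamma>] by (simp add: valid_path_cnj pathfinish_compose pathstart_compose)
      qed
    qed
    fix z assume z: "z \<notin> U - ?\<sigma>"
    have cz: "cnj z \<notin> U - ?\<sigma>" using z sym[of "cnj z"] by auto
    have "winding_number (cnj \<circ> \<gamma>) z = - cnj (winding_number \<gamma> (cnj z))" if "\<gamma> \<in> \<Gamma>" for \<gamma>
    proof -
      have "path \<gamma>" "cnj z \<notin> path_image \<gamma>" using sc(2,4)[OF that] cz valid_path_imp_path by auto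
      then show ?thesis using winding_number_cnj[of \<gamma> "cnj z"] by simp
    qed
    then have "(\<Sum>i\<in>\<Gamma> <+> \<Gamma>. winding_number (case_sum (\<lambda>\<gamma>. \<gamma>) (\<lambda>\<gamma>. cnj \<circ> \<gamma>) i) z)
        = (\<Sum>\<gamma>\<in>\<Gamma>. winding_number \<gamma> z) - cnj (\<Sum>\<gamma>\<in>\<Gamma>. winding_number \<gamma> (cnj z))"
      using sc(1) by (simp add: sum.Plus sum_negf)
    \<comment> \<open>Spectrum and \<open>U\<close> are both symmetric, so \<open>z\<close> and
      \<open>cnj z\<close> have the same total index, 1 on the spectrum and 0 off
      \<open>U\<close>.\<close>
    also have "\<dots> = 0"
    proof (cases "z \<in> ?\<sigma>")
      case True
      then have "cnj z \<in> ?\<sigma>" using cresolvent_cnj(1)[of "cnj z" T] by auto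
      then show ?thesis using True sc(5) by simp
    next
      case False
      then have "z \<notin> U" using z by simp
      moreover from this have "cnj z \<notin> U" using U(2)[of "cnj z"] by auto
      ultimately show ?thesis using sc(6) by simp
    qed
    finally show "(\<Sum>i\<in>\<Gamma> <+> \<Gamma>. winding_number (case_sum (\<lambda>\<gamma>. \<gamma>) (\<lambda>\<gamma>. cnj \<circ> \<gamma>) i) z) = 0" .
  qed
  then have neg: "(\<Sum>\<gamma>\<in>\<Gamma>. contour_integral (cnj \<circ> \<gamma>) k) = - (\<Sum>\<gamma>\<in>\<Gamma>. contour_integral \<gamma> k)"
    using sc(1) by (simp add: sum.Plus add_eq_0_iff)
  have "\<psi> (cconj o\<^sub>L riesz_integral T f \<Gamma> o\<^sub>L cconj) = cnj (\<psi>' (riesz_integral T f \<Gamma>))" by (simp add: \<psi>'_def)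
  also have "\<dots> = cnj ?k * (\<Sum>\<gamma>\<in>\<Gamma>. cnj (contour_integral \<gamma> (\<lambda>z. f z * \<psi>' (cresolvent T z))))"
    by (simp add: complex_functional_riesz_integral[OF \<Gamma> U(1) f(1) \<psi>'])
  also have "(\<Sum>\<gamma>\<in>\<Gamma>. cnj (contour_integral \<gamma> (\<lambda>z. f z * \<psi>' (cresolvent T z)))) = (\<Sum>\<gamma>\<in>\<Gamma>. contour_integral (cnj \<circ> \<gamma>) k)"
    by (rule sum.cong[OF refl conj])
  \<comment> \<open>\<open>cnj ?k = - ?k\<close>: the sign from conjugating \<open>\<i>\<close>
    cancels the one from the reversed orientation.\<close>
  also have "cnj ?k * \<dots> = ?k * (\<Sum>\<gamma>\<in>\<Gamma>. contour_integral \<gamma> k)" by (simp add: neg)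
  also have "\<dots> = \<psi> (riesz_integral T f \<Gamma>)"
    by (simp add: complex_functional_riesz_integral[OF \<Gamma> U(1) f(1) \<psi>] k_def[abs_def])
  finally show "\<psi> (cconj o\<^sub>L riesz_integral T f \<Gamma> o\<^sub>L cconj) = \<psi> (riesz_integral T f \<Gamma>)" .
qed

text \<open>Commuting with conjugation forces vectors \<open>(x, 0)\<close> to real vectors, which
  defines \<open>S\<close>; complex linearity then determines the operator on \<open>(0, y)\<close>,
  which is \<open>\<i>\<close> times \<open>(y, 0)\<close>.\<close>

lemma complexify_of_real_op:
  fixes A :: "('v::banach \<times> 'v) \<Rightarrow>\<^sub>L ('v \<times> 'v)"
  assumes lin: "complex_linear_op A" and real: "cconj o\<^sub>L A o\<^sub>L cconj = A"
  shows "\<exists>S. complexify S = A"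
proof -
  have bl: "bounded_linear (\<lambda>x. fst (A (x, 0)))"
    by (intro bounded_linear_compose[OF bounded_linear_fst] bounded_linear_compose[OF blinfun.bounded_linear_right]
        bounded_linear_Pair bounded_linear_ident bounded_linear_zero)
  define S where "S = Blinfun (\<lambda>x. fst (A (x, 0)))"
  have S: "S x = fst (A (x, 0))" for x unfolding S_def by (simp add: bounded_linear_Blinfun_apply[OF bl])
  have A1: "A (x, 0) = (S x, 0)" for x
  proof -
    have "cconj (A (cconj (x, 0))) = A (x, 0)"
      using arg_cong[OF real, of "\<lambda>B. blinfun_apply B (x, 0)"] by simp
    then have "- snd (A (x, 0)) = snd (A (x, 0))" by (metis cconj_apply fst_conv snd_conv neg_0_equal_iff_equal)
    then have "snd (A (x, 0)) = 0" by (metis add.right_inverse scaleR_2 scaleR_eq_0_iff zero_neq_numeral)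
    then show ?thesis by (simp add: S prod_eq_iff)
  qed
  have "complexify S = A"
  proof (rule blinfun_eqI)
    fix z :: "'v \<times> 'v"
    have z: "z = (fst z, 0) + cscale \<i> (snd z, 0)" by (simp add: cscale_apply)
    have "A (cscale \<i> (snd z, 0)) = cscale \<i> (A (snd z, 0))"
      using lin unfolding complex_linear_op_def by (metis blinfun_apply_blinfun_compose)
    then have "A z = A (fst z, 0) + cscale \<i> (A (snd z, 0))"
      using arg_cong[OF z, of "blinfun_apply A"] by (simp only: blinfun.add_right)
    then show "complexify S z = A z" by (simp add: A1 cscale_apply complexify_apply)
  qed
  then show ?thesis by blast
qed

text \<open>Right multiplication by a fixed Clifford element is a bounded real operator commuting
  with \<open>T\<close>. Its complexification commutes with the Riesz integral, and injectivity of
  \<open>complexify\<close> brings the identity back to the real space.\<close>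

lemma riesz_integral_right_linear:
  assumes sp: "banach_cl_space n lact ract" and T: "T \<in> right_linear_ops n ract"
    and \<Gamma>: "spectral_cycle (cspectrum T) U \<Gamma>" "open U" "f holomorphic_on U"
    and S: "complexify S = riesz_integral T f \<Gamma>"
  shows "S \<in> right_linear_ops n ract"
  unfolding right_linear_ops_def
proof (intro CollectI allI ballI)
  interpret banach_cl_space n lact ract by (rule sp)
  fix x a assume a: "a \<in> cl_carrier n"
  obtain C where C: "\<And>x. norm (ract x a) \<le> C * norm x * cl_norm n a" using bounded_actions a by blast
  have bl: "bounded_linear (\<lambda>x. ract x a)"
    by (rule bounded_linear_intro[where K = "C * cl_norm n a"])
      (use C a in \<open>auto simp: ract_add_left ract_scaleR_left mult_ac\<close>)
  define \<rho> where "\<rho> = Blinfun (\<lambda>x. ract x a)"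
  have \<rho>: "\<rho> x = ract x a" for x by (simp add: \<rho>_def bounded_linear_Blinfun_apply[OF bl])
  have comp: "complexify (A o\<^sub>L B) = complexify A o\<^sub>L complexify B" for A B :: "'a \<Rightarrow>\<^sub>L 'a"
    by (rule blinfun_eqI) (simp add: complexify_apply)
  have "\<rho> o\<^sub>L T = T o\<^sub>L \<rho>"
    using T a by (intro blinfun_eqI) (simp add: \<rho> right_linear_ops_def)
  then have "complexify \<rho> o\<^sub>L complexify T = complexify T o\<^sub>L complexify \<rho>" by (simp add: comp[symmetric])
  from riesz_integral_commute[OF \<Gamma> complex_linear_op_complexify this]
  have "\<rho> o\<^sub>L S = S o\<^sub>L \<rho>" by (simp add: S[symmetric] comp[symmetric] complexify_inject)
  from arg_cong[OF this, of "\<lambda>A. blinfun_apply A x"]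
  show "S (ract x a) = ract (S x) a" by (simp add: \<rho>)
qed

theorem mainTheorem7:
  fixes n :: nat
    and lact :: "clifford \<Rightarrow> 'v::banach \<Rightarrow> 'v"
    and ract :: "'v \<Rightarrow> clifford \<Rightarrow> 'v"
    and T :: "'v \<Rightarrow>\<^sub>L 'v"
    and U :: "complex set"
    and f :: "complex \<Rightarrow> complex"
  assumes "banach_cl_space n lact ract"
    and "T \<in> right_linear_ops n ract"
    and "open U"
    and "\<forall>\<zeta>\<in>U. cnj \<zeta> \<in> U"
    and "cspectrum T \<subseteq> U"
    and "f \<in> stem_functions U"
  shows "f ` cspectrum T = cspectrum (functional_calculus n ract U f T)"
proof -
  have f: "f holomorphic_on U" "\<And>z. z \<in> U \<Longrightarrow> f (cnj z) = cnj (f z)"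
    using assms(6) by (auto simp: stem_functions_def analytic_imp_holomorphic)
  obtain \<Delta> \<Gamma> where \<Delta>: "smooth_domain \<Delta> \<Gamma>" "cspectrum T \<subseteq> \<Delta>" "closure \<Delta> \<subseteq> U"
    using smooth_domain_between[OF assms(3) compact_cspectrum assms(5)] by blast
  then have adm: "admissible_contour (cspectrum T) U \<Delta> \<Gamma>"
    by (simp add: admissible_contour_def smooth_domain_def)
  note \<Gamma> = spectral_cycle_admissible[OF adm]
  have "cconj o\<^sub>L riesz_integral T f \<Gamma> o\<^sub>L cconj = riesz_integral T f \<Gamma>"
    using assms(4) by (intro riesz_integral_cconj[OF \<Gamma> assms(3) _ f]) auto
  then obtain S where S: "complexify S = riesz_integral T f \<Gamma>"
    using complexify_of_real_op[OF complex_linear_op_riesz_integral[OF \<Gamma> assms(3) f(1)]] by blast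
  \<comment> \<open>Resolves the description: the constructed contour gives existence, while
    independence of the contour with injectivity of \<open>complexify\<close> gives
    uniqueness.\<close>
  have "functional_calculus n ract U f T = S"
    unfolding functional_calculus_def
  proof (rule the_equality)
    show "S \<in> right_linear_ops n ract \<and>
        (\<exists>\<Delta> \<Gamma>. admissible_contour (cspectrum T) U \<Delta> \<Gamma> \<and> complexify S = riesz_integral T f \<Gamma>)"
      using riesz_integral_right_linear[OF assms(1,2) \<Gamma> assms(3) f(1) S] adm S by blast
    fix S' assume "S' \<in> right_linear_ops n ract \<and>
        (\<exists>\<Delta> \<Gamma>. admissible_contour (cspectrum T) U \<Delta> \<Gamma> \<and> complexify S' = riesz_integral T f \<Gamma>)"
    then obtain \<Delta>' \<Gamma>' where "admissible_contour (cspectrum T) U \<Delta>' \<Gamma>'" "complexify S' = riesz_integral T f \<Gamma>'" by blast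
    then have "complexify S' = complexify S"
      using riesz_integral_cycle_independent[OF spectral_cycle_admissible \<Gamma> assms(3) f(1)] S by metis
    then show "S' = S" by (simp add: complexify_inject)
  qed
  then show ?thesis
    using spectral_mapping_subset[OF \<Gamma> assms(3,5) f(1) S] spectral_mapping_superset[OF \<Gamma> assms(3,5) f(1) S] by auto
qed

end
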